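(* Let $R>0$ and $p\ge 4$. There exists a constant $C_R>0$, depending on $R$ (but not on $f$ or $n$), such that for every $f\in H^p(\mathbb{R}^3)$ compactly supported in the ball $\mathcal{B}(0,R)$ and every even positive integer $n$, $$ \| \mathcal{C}^R(f,f) - \mathcal{C}^R_n(f_n,f_n) \|_{L^2}\,\leq\,\frac{C_R}{n^{p-4}} \, \|f\|_{H^p}\,\|f\|_{H^4}. $$ Here $\mathcal{C}^R$ is the truncated Landau operator with kernel $\psi^R$, $f_n=\mathcal{I}_n f$ is the trigonometric interpolant of $f$, and $\mathcal{C}_n^R$ is the spectral collocation approximation of the operator, all defined in the context.
   Context: Fix $R>0$ and let $T=2R$. $\mathcal{B}(0,R)\subset\mathbb{R}^3$ is the ball of radius $R$ centered at the origin. Truncated operator: let $\psi(\boldsymbol z)=|\boldsymbol z|$ on $\mathbb{R}^3$ and $\psi^R=\chi_{[-2R,2R]^3}\,\psi$, where $\chi_B$ is the characteristic function of the set $B$. For $f$ on $\mathbb{R}^3$ set $g^R=\psi^R\star f$ (convolution on $\mathbb{R}^3$) and $$\mathcal{C}^R(f,f)=\mathrm{div}_{\boldsymbol v}\left(\nabla_{\boldsymbol v}^2 g^R\,\nabla_{\boldsymbol v} f-\nabla_{\boldsymbol v}\Delta_{\boldsymbol v} g^R\, f\right),$$ where $\nabla^2_{\boldsymbol v} g^R$ is the Hessian matrix, acting on the vector $\nabla_{\boldsymbol v} f$. Grids: for an even positive integer $n$, let $\mathcal{J}_n=\{-n/2,\dots,n/2-1\}^3$ and $\mathcal{J}_{2n}=\{-n,\dots,n-1\}^3$.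 The collocation points are $\boldsymbol v_j=\frac{2R}{n}\,j$; those with $j\in\mathcal{J}_n$ lie in $[-R,R]^3$ and those with $j\in\mathcal{J}_{2n}$ lie in $[-T,T]^3$. Interpolation on $[-R,R]^3$: let $\mathcal{P}_n=\mathrm{span}\{e^{\frac{i\pi}{R}\boldsymbol k\cdot\boldsymbol v}:\boldsymbol k\in\mathcal{J}_n\}$. For a continuous function $h$ on $[-R,R]^3$, $\mathcal{I}_n h\in\mathcal{P}_n$ is the trigonometric polynomial with $(\mathcal{I}_n h)(\boldsymbol v_j)=h(\boldsymbol v_j)$ for all $j\in\mathcal{J}_n$, i.e. $\mathcal{I}_n h(\boldsymbol v)=\sum_{\boldsymbol k\in\mathcal{J}_n}\widetilde h_n(\boldsymbol k)e^{\frac{i\pi}{R}\boldsymbol k\cdot\boldsymbol v}$ with $\widetilde h_n(\boldsymbol k)=\frac1{n^3}\sum_{j\in\mathcal{J}_n}h(\boldsymbol v_j)e^{-\frac{i\pi}{R}\boldsymbol k\cdot\boldsymbol v_j}$. It acts componentwise on vector-valued functions. Set $f_n=\mathcal{I}_n f$. Discrete convolution on $[-T,T]^3$: set the values $f(\boldsymbol v_j)=0$ for $j\in\mathcal{J}_{2n}\setminus\mathcal{J}_n$, and define $$\widetilde f_{2n}(\boldsymbol k)=\frac1{(2n)^3}\sum_{j\in\mathcal{J}_{2n}}f(\boldsymbol v_j)e^{-\frac{i\pi}{T}\boldsymbol k\cdot\boldsymbol v_j},\qquad \widetilde\psi(\boldsymbol k)=\int_{[-T,T]^3}|\boldsymbol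 u|\,e^{-\frac{i\pi}{T}\boldsymbol k\cdot\boldsymbol u}\,\mathrm{d}\boldsymbol u,$$ $$g^R_{2n}(\boldsymbol v)=\sum_{\boldsymbol k\in\mathcal{J}_{2n}}\widetilde f_{2n}(\boldsymbol k)\,\widetilde\psi(\boldsymbol k)\,e^{\frac{i\pi}{T}\boldsymbol k\cdot\boldsymbol v}.$$ Collocation operator: $$\mathcal{C}_n^R(f_n,f_n)=\mathrm{div}_{\boldsymbol v}\,\mathcal{I}_n\left(\nabla_{\boldsymbol v}^2 g_{2n}^R\,\nabla_{\boldsymbol v} f_n-\nabla_{\boldsymbol v}\Delta_{\boldsymbol v} g_{2n}^R\, f_n\right),$$ where $g_{2n}^R$ is built from the grid values $f(\boldsymbol v_j)=f_n(\boldsymbol v_j)$, $j\in\mathcal{J}_n$. The $L^2$ norm is over the computational domain $[-R,R]^3$; $H^s$ denotes the usual $L^2$-based Sobolev space. The exponent $p$ is fixed. *)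

theory Defs
  imports "HOL-Analysis.Analysis"
begin

section \<open>Sobolev spaces on Euclidean three-space\<close>

definition square_integrable :: "(real^3) set \<Rightarrow> (real^3 \<Rightarrow> complex) \<Rightarrow> bool" where
  "square_integrable S h \<longleftrightarrow>
     set_borel_measurable lborel S h \<and> set_integrable lborel S (\<lambda>v. (cmod (h v))\<^sup>2)"

definition L2_norm :: "(real^3) set \<Rightarrow> (real^3 \<Rightarrow> complex) \<Rightarrow> real" where
  "L2_norm S h = sqrt (LINT v:S|lborel. (cmod (h v))\<^sup>2)"

definition fourier_ball :: "real \<Rightarrow> (real^3 \<Rightarrow> complex) \<Rightarrow> real^3 \<Rightarrow> complex" where
  "fourier_ball r f \<xi> =
     of_real ((2 * pi) powr (-3/2)) * (LINT x:cball 0 r|lborel. f x * cis (- (x \<bullet> \<xi>)))"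

text \<open>The (unitary) Fourier--Plancherel transform of a square-integrable function, which is
  only determined almost everywhere: the \<open>L\<^sup>2\<close>-limit of the Fourier integrals over growing balls.
  The integral is the non-negative one, since the Bochner integral of a non-integrable
  function is \<open>0\<close>.\<close>

definition is_fourier_transform :: "(real^3 \<Rightarrow> complex) \<Rightarrow> (real^3 \<Rightarrow> complex) \<Rightarrow> bool" where
  "is_fourier_transform f F \<longleftrightarrow> square_integrable UNIV F \<and>
     ((\<lambda>r. \<integral>\<^sup>+ \<xi>. ennreal ((cmod (fourier_ball r f \<xi> - F \<xi>))\<^sup>2) \<partial>lborel) \<longlongrightarrow> 0) at_top"

definition fourier_transform :: "(real^3 \<Rightarrow> complex) \<Rightarrow> real^3 \<Rightarrow> complex" where
  "fourier_transform f = (SOME F. is_fourier_transform f F)"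

text \<open>The space \<open>H\<^sup>s\<close> for real \<open>s \<ge> 0\<close>.\<close>

definition sobolev_space :: "real \<Rightarrow> (real^3 \<Rightarrow> complex) set" where
  "sobolev_space s = {f. square_integrable UNIV f \<and>
     (\<exists>F. is_fourier_transform f F \<and>
          integrable lborel (\<lambda>\<xi>. (1 + (norm \<xi>)\<^sup>2) powr s * (cmod (F \<xi>))\<^sup>2))}"

definition sobolev_norm :: "real \<Rightarrow> (real^3 \<Rightarrow> complex) \<Rightarrow> real" where
  "sobolev_norm s f =
     sqrt (LINT \<xi>|lborel. (1 + (norm \<xi>)\<^sup>2) powr s * (cmod (fourier_transform f \<xi>))\<^sup>2)"


section \<open>Vector calculus for complex-valued functions\<close>

text \<open>Derivatives are classical. This is enough for the operators below: if \<open>f\<close> is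
  continuous, compactly supported and in \<open>H\<^sup>4\<close>, then \<open>f\<close> is \<open>C\<^sup>2\<close> and its convolution with the bounded,
  compactly supported truncated kernel is \<open>C\<^sup>4\<close>.\<close>

definition partial_deriv :: "3 \<Rightarrow> (real^3 \<Rightarrow> complex) \<Rightarrow> real^3 \<Rightarrow> complex" where
  "partial_deriv i F v = vector_derivative (\<lambda>t. F (v + t *\<^sub>R axis i 1)) (at 0)"

definition gradient :: "(real^3 \<Rightarrow> complex) \<Rightarrow> real^3 \<Rightarrow> complex^3" where
  "gradient F v = (\<chi> i. partial_deriv i F v)"

definition hessian :: "(real^3 \<Rightarrow> complex) \<Rightarrow> real^3 \<Rightarrow> complex^3^3" where
  "hessian F v = (\<chi> i j. partial_deriv i (partial_deriv j F) v)"

definition laplacian :: "(real^3 \<Rightarrow> complex) \<Rightarrow> real^3 \<Rightarrow> complex" where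
  "laplacian F v = (\<Sum>i\<in>UNIV. partial_deriv i (partial_deriv i F) v)"

definition divergence :: "(real^3 \<Rightarrow> complex^3) \<Rightarrow> real^3 \<Rightarrow> complex" where
  "divergence W v = (\<Sum>i\<in>UNIV. partial_deriv i (\<lambda>x. W x $ i) v)"


section \<open>The truncated Landau operator\<close>

definition cube :: "real \<Rightarrow> (real^3) set" where
  "cube a = cbox (\<chi> i. - a) (\<chi> i. a)"

definition psi_trunc :: "real \<Rightarrow> real^3 \<Rightarrow> real" where
  "psi_trunc R z = indicator (cube (2 * R)) z * norm z"

definition g_trunc :: "real \<Rightarrow> (real^3 \<Rightarrow> complex) \<Rightarrow> real^3 \<Rightarrow> complex" where
  "g_trunc R f v = (LINT u|lborel. of_real (psi_trunc R (v - u)) * f u)"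

definition landau_flux ::
    "(real^3 \<Rightarrow> complex) \<Rightarrow> (real^3 \<Rightarrow> complex) \<Rightarrow> real^3 \<Rightarrow> complex^3" where
  "landau_flux g f v = hessian g v *v gradient f v - f v *s gradient (laplacian g) v"

text \<open>\<open>landau_trunc R f\<close> is the quadratic operator \<open>C\<^sup>R(f, f)\<close>.\<close>

definition landau_trunc :: "real \<Rightarrow> (real^3 \<Rightarrow> complex) \<Rightarrow> real^3 \<Rightarrow> complex" where
  "landau_trunc R f = divergence (landau_flux (g_trunc R f) f)"


section \<open>The spectral collocation operator\<close>

definition index_set :: "nat \<Rightarrow> (int^3) set" where
  "index_set n = {k. \<forall>i. - (int n div 2) \<le> k $ i \<and> k $ i < int n div 2}"

lemma finite_index_set: "finite (index_set n)"
proof -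
  let ?B = "{- (int n div 2)..<int n div 2}"
  have "index_set n \<subseteq> vec_lambda ` (UNIV \<rightarrow>\<^sub>E ?B)"
  proof
    fix k assume "k \<in> index_set n"
    then have "vec_nth k \<in> UNIV \<rightarrow>\<^sub>E ?B"
      by (auto simp: index_set_def)
    then show "k \<in> vec_lambda ` (UNIV \<rightarrow>\<^sub>E ?B)"
      by (metis imageI vec_nth_inverse)
  qed
  then show ?thesis
    by (rule finite_subset) (auto intro!: finite_PiE)
qed

definition real_vec :: "int^3 \<Rightarrow> real^3" where
  "real_vec k = (\<chi> i. real_of_int (k $ i))"

definition node :: "real \<Rightarrow> nat \<Rightarrow> int^3 \<Rightarrow> real^3" where
  "node R n j = (2 * R / real n) *\<^sub>R real_vec j"

definition wave :: "real \<Rightarrow> int^3 \<Rightarrow> real^3 \<Rightarrow> complex" where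
  "wave L k v = exp (\<i> * of_real (pi / L * (real_vec k \<bullet> v)))"

definition interp_coeff :: "real \<Rightarrow> nat \<Rightarrow> (real^3 \<Rightarrow> complex) \<Rightarrow> int^3 \<Rightarrow> complex" where
  "interp_coeff R n h k =
     1 / of_nat n ^ 3 * (\<Sum>j\<in>index_set n. h (node R n j) * wave R (- k) (node R n j))"

definition interp :: "real \<Rightarrow> nat \<Rightarrow> (real^3 \<Rightarrow> complex) \<Rightarrow> real^3 \<Rightarrow> complex" where
  "interp R n h v = (\<Sum>k\<in>index_set n. interp_coeff R n h k * wave R k v)"

definition interp_vec :: "real \<Rightarrow> nat \<Rightarrow> (real^3 \<Rightarrow> complex^3) \<Rightarrow> real^3 \<Rightarrow> complex^3" where
  "interp_vec R n W v = (\<chi> i. interp R n (\<lambda>x. W x $ i) v)"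

text \<open>On the doubled grid the values are extended by zero, not by periodicity; the spacing of
  the doubled grid on the cube of half-width \<open>2 * R\<close> is again \<open>2 * R / n\<close>, so its points are
  \<open>node R n j\<close> for \<open>j \<in> index_set (2 * n)\<close>.\<close>

definition double_coeff :: "real \<Rightarrow> nat \<Rightarrow> (real^3 \<Rightarrow> complex) \<Rightarrow> int^3 \<Rightarrow> complex" where
  "double_coeff R n h k =
     1 / of_nat (2 * n) ^ 3 *
     (\<Sum>j\<in>index_set (2 * n). (if j \<in> index_set n then h (node R n j) else 0)
                              * wave (2 * R) (- k) (node R n j))"

definition psi_coeff :: "real \<Rightarrow> int^3 \<Rightarrow> complex" where
  "psi_coeff R k = (LINT u:cube (2 * R)|lborel. of_real (norm u) * wave (2 * R) (- k) u)"

definition g_double :: "real \<Rightarrow> nat \<Rightarrow> (real^3 \<Rightarrow> complex) \<Rightarrow> real^3 \<Rightarrow> complex" where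
  "g_double R n h v =
     (\<Sum>k\<in>index_set (2 * n). double_coeff R n h k * psi_coeff R k * wave (2 * R) k v)"

definition landau_colloc :: "real \<Rightarrow> nat \<Rightarrow> (real^3 \<Rightarrow> complex) \<Rightarrow> real^3 \<Rightarrow> complex" where
  "landau_colloc R n h = divergence (interp_vec R n (landau_flux (g_double R n h) h))"

end

theory Submission
  imports Defs
begin

text \<open>All functions are expanded in Fourier series, and errors are measured by weighted
  \<open>\<ell>\<^sup>1\<close>-norms of coefficients. A function \<open>f\<close> supported in the ball is expanded on the large cube
  of half-width \<open>2 R\<close>, with coefficients \<open>a k\<close>; there \<open>g\<close> has the coefficients
  \<open>a k * psi_coeff R k\<close>, because the support of \<open>f\<close> keeps the periodic images away. The periodic
  extension of the kernel is Lipschitz with a derivative of bounded variation along each axis, so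
  that \<open>psi_coeff R k\<close> decays like \<open>\<bar>k\<bar>\<^sup>-\<^sup>2\<close> and two derivatives of \<open>g\<close> cost nothing.

  The coefficients \<open>a k\<close> are samples of the Fourier transform of \<open>f\<close> on a lattice. As \<open>f\<close> is
  unchanged by multiplication with a cutoff, such a sample is a rapidly decaying average of the
  transform, which gives \<open>\<Sum> (1 + \<bar>k\<bar>) powr (s - 2) * \<bar>a k\<bar> \<le> C * \<parallel>f\<parallel>\<close> in the \<open>H\<^sup>s\<close>-norm, used for
  \<open>s = p\<close> and \<open>s = 4\<close>.

  On the grid every wave agrees with the wave of its residue modulo \<open>n\<close>, so interpolation only
  changes the frequencies outside the index set, where \<open>1 + \<bar>k\<bar> \<ge> n / 2\<close>. The exact flux \<open>W\<close> is
  supported in the small cube, hence a wave series there, and the error splits into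
  \<open>div (W - I\<^sub>n W)\<close>, a tail of weight \<open>p - 4\<close>, and \<open>div I\<^sub>n (W - W\<^sub>n)\<close>. By the discrete Parseval
  identity the latter is bounded in \<open>L\<^sup>2\<close> by \<open>n\<close> times the largest nodal value of \<open>W - W\<^sub>n\<close>, which
  is a tail of weight \<open>p - 3\<close>.\<close>

section \<open>Waves and integrals over cubes\<close>

text \<open>Coefficient sums take the place of Sobolev norms because the flux is quadratic: a
  product of two absolutely convergent wave series is again one, indexed by pairs, and its tails are
  bounded termwise and hence pointwise, in particular at the nodes. The price is the passage from a
  weighted mean-square norm of the transform to an absolute sum, which costs two powers of the
  weight in dimension three. In the flux the kernel decay absorbs two derivatives of
  \<open>g\<close>, so that each product carries one derivative in total; the divergence adds
  another, and \<open>p - 2\<close> powers become \<open>p - 4\<close>. Since derivatives are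
  classical, every identity between \<open>f\<close>, \<open>g\<close> and their series must hold on
  an open set around the closed small cube. A margin \<open>d\<close> between the support of
  \<open>f\<close> and the boundary secures this. It depends on \<open>f\<close>, but no estimate
  contains \<open>d\<close>, so the final constant does not depend on it.\<close>

lemma real_vec_simps [simp]:
  "real_vec 0 = 0" "real_vec (k + l) = real_vec k + real_vec l" "real_vec (- k) = - real_vec k"
  "real_vec (k - l) = real_vec k - real_vec l"
  by (simp_all add: real_vec_def vec_eq_iff)

lemma real_vec_nth [simp]: "real_vec k $ i = real_of_int (k $ i)"
  by (simp add: real_vec_def)

lemma real_vec_inject [simp]: "real_vec k = real_vec l \<longleftrightarrow> k = l"
  by (auto simp: vec_eq_iff)

lemma wave_cis: "wave L k v = cis (pi / L * (real_vec k \<bullet> v))"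
  by (simp add: wave_def cis_conv_exp)

lemma wave_0 [simp]: "wave L 0 v = 1"
  by (simp add: wave_cis)

lemma norm_wave [simp]: "cmod (wave L k v) = 1"
  by (simp add: wave_cis)

lemma wave_add: "wave L (k + l) v = wave L k v * wave L l v"
  by (simp add: wave_cis cis_mult inner_add_left distrib_left)

lemma wave_add_right: "wave L k (v + w) = wave L k v * wave L k w"
  by (simp add: wave_cis cis_mult inner_add_right distrib_left)

lemma wave_uminus_right: "wave L k (- v) = wave L (- k) v"
  by (simp add: wave_cis)

lemma wave_cnj: "cnj (wave L k v) = wave L (- k) v"
  by (simp add: wave_cis cis_cnj)

lemma continuous_on_wave [continuous_intros]:
  "continuous_on S (wave L k)"
  unfolding wave_def by (intro continuous_intros)

lemma borel_measurable_wave [measurable]: "wave L k \<in> borel_measurable borel"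
  by (intro borel_measurable_continuous_onI continuous_on_wave)

lemma wave_axis: "wave L k (t *\<^sub>R axis i 1) = cis (pi / L * real_of_int (k $ i) * t)"
  by (simp add: wave_cis inner_axis mult_ac)

lemma wave_translate: 
  assumes "L \<noteq> 0" shows "wave L k (v + (2 * L) *\<^sub>R real_vec z) = wave L k v"
proof -
  have "real_vec k \<bullet> real_vec z = of_int (\<Sum>i\<in>UNIV. k $ i * z $ i)"
    by (simp add: inner_vec_def)
  then have "wave L k ((2 * L) *\<^sub>R real_vec z) = cis (2 * pi * of_int (\<Sum>i\<in>UNIV. k $ i * z $ i))"
    using assms by (simp add: wave_cis mult_ac)
  also have "\<dots> = 1" by (rule cis_multiple_2pi) auto
  finally show ?thesis by (simp add: wave_add_right)
qed

lemma real_vec_double: "real_vec (2 * k) = 2 *\<^sub>R real_vec k"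
  by (simp add: vec_eq_iff)

lemma wave_double: "wave (2 * L) (2 * k) v = wave L k v"
  by (simp add: wave_cis real_vec_double)

section \<open>Geometry and measure of the cubes\<close>

lemma mem_cube: "v \<in> cube L \<longleftrightarrow> (\<forall>i. \<bar>v $ i\<bar> \<le> L)"
  unfolding cube_def mem_box_cart by (simp add: abs_le_iff) (metis minus_le_iff)

lemma compact_cube [simp]: "compact (cube L)"
  unfolding cube_def by simp

lemma sets_cube [measurable]: "cube L \<in> sets borel"
  unfolding cube_def by simp

lemma interior_cube: "interior (cube L) = {v. \<forall>i. \<bar>v $ i\<bar> < L}"
  unfolding cube_def interior_cbox
  by (rule set_eqI) (simp add: mem_box_cart abs_less_iff, metis minus_less_iff)

lemma Basis3: "(Basis :: (real^3) set) = range (\<lambda>i. axis i 1)"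
  by (auto simp: Basis_vec_def)

lemma measure_cube: "L \<ge> 0 \<Longrightarrow> measure lborel (cube L) = (2 * L) ^ 3"
  unfolding cube_def
  by (subst measure_lborel_cbox_eq) (auto simp: Basis3 inner_axis prod.reindex inj_on_def axis_eq_axis)

lemma emeasure_cube_finite: "emeasure lborel (cube L) < \<infinity>"
  unfolding cube_def by (rule emeasure_lborel_cbox_finite)

lemma set_integrable_cube:
  fixes h :: "real^3 \<Rightarrow> 'b :: {banach, second_countable_topology}"
  shows "continuous_on (cube L) h \<Longrightarrow> set_integrable lborel (cube L) h"
  unfolding set_integrable_def by (rule borel_integrable_compact) auto

text \<open>If \<open>f\<close> is not integrable, its Bochner integral is \<open>0\<close> and the
  bound still holds. In this form the lemma applies to slice integrals without a separate
  measurability argument.\<close>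

lemma norm_integral_dominated:
  fixes f :: "'a \<Rightarrow> 'b :: {banach, second_countable_topology}"
  assumes "integrable M g" "\<And>x. norm (f x) \<le> g x"
  shows "norm (integral\<^sup>L M f) \<le> integral\<^sup>L M g"
proof (cases "integrable M f")
  case True
  then show ?thesis using assms
    by (intro order.trans[OF integral_norm_bound] integral_mono) auto
next
  case False
  have "g x \<ge> 0" for x using assms(2)[of x] norm_ge_zero[of "f x"] by linarith
  then show ?thesis using False by (simp add: not_integrable_integral_eq)
qed

lemma set_integral_norm_bound_cube:
  fixes h :: "real^3 \<Rightarrow> complex"
  assumes "\<And>v. v \<in> cube L \<Longrightarrow> cmod (h v) \<le> B" "L \<ge> 0" "B \<ge> 0"
  shows "cmod (LINT v:cube L|lborel. h v) \<le> (2 * L) ^ 3 * B"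
proof -
  have "cmod (LINT v:cube L|lborel. h v) \<le> (LINT v:cube L|lborel. B)"
    unfolding set_lebesgue_integral_def 
    by (rule norm_integral_dominated)
       (use assms set_integrable_cube[of L "\<lambda>_. B"] in
       \<open>auto simp: indicator_def set_integrable_def\<close>)
  also have "\<dots> = (2 * L) ^ 3 * B"
    using measure_cube[of L] assms by (simp add: set_lebesgue_integral_def)
  finally show ?thesis .
qed

text \<open>With \<open>B = Basis\<close> this is the map under which Lebesgue measure is the image
  of a product measure; dropping one basis vector parametrises the hyperplane orthogonal to
  it.\<close>

definition embed :: "(real^3) set \<Rightarrow> (real^3 \<Rightarrow> real) \<Rightarrow> real^3" where
  "embed B x = (\<Sum>b\<in>B. x b *\<^sub>R b)"

text \<open>Fubini for a single coordinate: the factor along \<open>b\<close> is split off from the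
  finite product measure, and the other coordinates stay together.\<close>

lemma integral_slice:
  fixes g :: "real^3 \<Rightarrow> complex"
  assumes g: "integrable lborel g" and b: "b \<in> Basis"
  shows "(LINT v|lborel. g v) =
    (LINT x|PiM (Basis - {b}) (\<lambda>_. lborel). LINT y|lborel. g (embed (Basis - {b}) x + y *\<^sub>R b))"
proof -
  interpret product_sigma_finite "\<lambda>_::real^3. lborel :: real measure" 
    by standard
  have ins: "insert b (Basis - {b}) = (Basis :: (real^3) set)" using b by auto
  have meas: "embed Basis \<in> measurable (PiM (Basis) (\<lambda>_. lborel)) borel"
    unfolding embed_def by measurable
  have eq: "lborel = distr (PiM (Basis) (\<lambda>_. lborel)) borel (embed Basis)"
    unfolding embed_def by (rule lborel_eq)
  have emb: "embed Basis (x(b := y)) = embed (Basis - {b}) x + y *\<^sub>R b" for x y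
  proof -
    have "embed Basis (x(b := y)) = (\<Sum>c\<in>insert b (Basis - {b}). (x(b := y)) c *\<^sub>R c)"
      unfolding ins embed_def ..
    also have "\<dots> = y *\<^sub>R b + (\<Sum>c\<in>Basis - {b}. (x(b := y)) c *\<^sub>R c)"
      by (subst sum.insert) auto
    also have "(\<Sum>c\<in>Basis - {b}. (x(b := y)) c *\<^sub>R c) = embed (Basis - {b}) x"
      unfolding embed_def by (rule sum.cong) auto
    finally show ?thesis by (simp only: add.commute)
  qed
  have gm: "g \<in> borel_measurable borel" using borel_measurable_integrable[OF g] by simp
  have "(LINT v|lborel. g v) = (LINT x|PiM (Basis) (\<lambda>_. lborel). g (embed Basis x))"
    using integral_distr[OF meas gm] eq by simp
  also have "\<dots> = (LINT x|PiM (insert b (Basis - {b})) (\<lambda>_. lborel). g (embed Basis x))"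
    by (simp only: ins)
  also have "\<dots> = (LINT x|PiM (Basis - {b}) (\<lambda>_. lborel). LINT y|lborel. g (embed Basis (x(b := y))))"
  proof (rule product_integral_insert)
    have "integrable (distr (PiM (Basis) (\<lambda>_. lborel)) borel (embed Basis)) g"
      using g eq by simp
    then show "integrable (PiM (insert b (Basis - {b})) (\<lambda>_. lborel)) (\<lambda>x. g (embed Basis x))"
      unfolding ins using meas gm by (subst (asm) integrable_distr_eq) auto
  qed auto
  finally show ?thesis by (simp only: emb)
qed

lemma Basis_diff_axis: "Basis - {axis i 1} = (\<lambda>k. axis k (1::real) :: real^3) ` (UNIV - {i})"
  unfolding Basis3 by (auto simp: axis_eq_axis)

lemma embed_nth: "embed (Basis - {axis i 1}) x $ j = (if j = i then 0 else x (axis j 1))"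
proof -
  have E: "embed (Basis - {axis i 1}) x $ j = (\<Sum>b\<in>Basis - {axis i 1}. x b * b $ j)"
    by (simp add: embed_def)
  have "(\<Sum>b\<in>Basis - {axis i 1}. x b * b $ j) = (\<Sum>b\<in>(\<lambda>k. axis k 1) ` (UNIV - {i}). x b * b $ j)"
    unfolding Basis_diff_axis ..
  also have "(\<Sum>b\<in>(\<lambda>k. axis k 1) ` (UNIV - {i}). x b * b $ j) = (\<Sum>k\<in>UNIV - {i}. x (axis k 1) * axis k 1 $ j)"
    by (subst sum.reindex) (auto simp: inj_on_def axis_eq_axis)
  also have "\<dots> = (\<Sum>k\<in>UNIV - {i}. if k = j then x (axis j 1) else 0)"
    by (intro sum.cong) (auto simp: axis_def)
  also have "\<dots> = (if j = i then 0 else x (axis j 1))"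
    by (subst sum.delta) auto
  finally show ?thesis using E by simp
qed

text \<open>Oscillation is exploited along the axis \<open>i\<close> only; the two remaining
  coordinates contribute the area \<open>(2 * L)\<^sup>2\<close> of a face of the cube.\<close>

lemma cube_integral_slice_bound:
  fixes h :: "real^3 \<Rightarrow> complex"
  assumes h: "continuous_on (cube L) h" and L: "L \<ge> 0" and B: "B \<ge> 0"
    and slice: "\<And>w. (\<forall>j. \<bar>w $ j\<bar> \<le> L) \<Longrightarrow> w $ i = 0 \<Longrightarrow>
       cmod (LINT y:{-L..L}|lborel. h (w + y *\<^sub>R axis i 1)) \<le> B"
  shows "cmod (LINT v:cube L|lborel. h v) \<le> (2 * L)\<^sup>2 * B"
proof -
  interpret product_sigma_finite "\<lambda>_::real^3. lborel :: real measure" 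
    by standard
  define b where "b = (axis i 1 :: real^3)"
  have b: "b \<in> Basis" by (auto simp: b_def Basis3)
  let ?I = "Basis - {b}"
  let ?P = "\<lambda>x. \<Prod>c\<in>?I. indicator {-L..L} (x c) :: real"
  have ind: "indicator (cube L) (embed ?I x + y *\<^sub>R b) = ?P x * indicator {-L..L} y" 
    for x y
  proof -
    have "embed ?I x + y *\<^sub>R b \<in> cube L \<longleftrightarrow> (\<forall>c\<in>?I. x c \<in> {-L..L}) \<and> y \<in> {-L..L}"
    proof -
      have "(embed ?I x + y *\<^sub>R b) $ j = (if j = i then y else x (axis j 1))" for j
        by (simp add: embed_nth b_def) (simp add: axis_def)
      then have "embed ?I x + y *\<^sub>R b \<in> cube L \<longleftrightarrow> (\<forall>j. (if j = i then y else x (axis j 1)) \<in> {-L..L})"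
        by (simp only: mem_cube abs_le_iff minus_le_iff[of _ L] atLeastAtMost_iff conj_commute)
      also have "\<dots> \<longleftrightarrow> (\<forall>c\<in>?I. x c \<in> {-L..L}) \<and> y \<in> {-L..L}"
        unfolding b_def Basis_diff_axis by (auto split: if_splits)
      finally show ?thesis .
    qed
    moreover have "?P x = (if \<forall>c\<in>?I. x c \<in> {-L..L} then 1 else 0)"
      by (auto simp: indicator_def prod_zero_iff)
    ultimately show ?thesis by (auto simp: indicator_def)
  qed
  have intP: "integrable (PiM (?I) (\<lambda>_. lborel)) ?P"
    by (rule product_integrable_prod) (auto intro!: integrable_real_indicator simp: emeasure_lborel_Icc_eq)
  have "(LINT v:cube L|lborel. h v) =
    (LINT x|PiM (?I) (\<lambda>_. lborel). LINT y|lborel. indicator (cube L) (embed ?I x + y *\<^sub>R b) *\<^sub>R h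
      (embed ?I x + y *\<^sub>R b))"
    using set_integrable_cube[OF h] b unfolding set_integrable_def set_lebesgue_integral_def
    by (subst integral_slice) auto
  also have "cmod \<dots> \<le> (LINT x|PiM (?I) (\<lambda>_. lborel). B * ?P x)"
  proof (rule norm_integral_dominated)
    show "integrable (PiM (?I) (\<lambda>_. lborel)) (\<lambda>x. B * ?P x)"
      using intP by (rule integrable_mult_right)
    fix x
    let ?w = "embed ?I x"
    have *: "(LINT y|lborel. indicator (cube L) (?w + y *\<^sub>R b) *\<^sub>R h (?w + y *\<^sub>R b))
       = ?P x *\<^sub>R (LINT y:{-L..L}|lborel. h (?w + y *\<^sub>R b))"
      unfolding ind set_lebesgue_integral_def by (simp flip: scaleR_scaleR)
    have bd: "cmod (LINT y:{-L..L}|lborel. h (?w + y *\<^sub>R b)) \<le> B" if "?P x \<noteq> 0"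
      unfolding b_def
    proof (rule slice)
      have "\<forall>c\<in>?I. x c \<in> {-L..L}" using that by (auto simp: indicator_def split: if_splits)
      then show "\<forall>j. \<bar>embed (Basis - {axis i 1}) x $ j\<bar> \<le> L"
        using L unfolding b_def by (auto simp: embed_nth[unfolded Basis_diff_axis] Basis_diff_axis
          abs_le_iff minus_le_iff[of _ L])
    qed (simp add: embed_nth)
    have nn: "?P x \<ge> 0" by (intro prod_nonneg) auto
    show "cmod (LINT y|lborel. indicator (cube L) (?w + y *\<^sub>R b) *\<^sub>R h (?w + y *\<^sub>R b)) \<le> B * ?P x"
    proof (cases "?P x = 0")
      case True
      show ?thesis using * unfolding True by simp
    next
      case False
      have "cmod (?P x *\<^sub>R (LINT y:{-L..L}|lborel. h (?w + y *\<^sub>R b)))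
        = ?P x * cmod (LINT y:{-L..L}|lborel. h (?w + y *\<^sub>R b))"
        unfolding norm_scaleR abs_of_nonneg[OF nn] ..
      also have "\<dots> \<le> ?P x * B" using bd[OF False] nn by (rule mult_left_mono)
      finally show ?thesis unfolding * by (simp only: mult.commute)
    qed
  qed
  also have "\<dots> = B * (\<Prod>c\<in>?I. LINT y|lborel. indicator {-L..L} y)"
    by (subst product_integral_prod[symmetric])
      (auto intro!: integrable_real_indicator simp: emeasure_lborel_Icc_eq)
  also have "\<dots> = B * (2 * L) ^ card ?I" using L by simp
  also have "card ?I = 2" using b by (simp add: card_Diff_singleton)
  finally show ?thesis by (simp add: mult.commute)
qed

section \<open>Oscillatory integrals over full periods\<close>

lemma set_integral_FTC:
  fixes F :: "real \<Rightarrow> complex"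
  assumes "a \<le> b" "\<And>x. (F has_vector_derivative f x) (at x)" "continuous_on UNIV f"
  shows "(LINT x:{a..b}|lborel. f x) = F b - F a"
  unfolding set_lebesgue_integral_def
  using assms by (intro integral_FTC_atLeastAtMost)
    (auto intro: has_vector_derivative_at_within continuous_on_subset)

lemma has_vector_derivative_cis:
  "((\<lambda>x. cis (w * x)) has_vector_derivative (\<i> * w * cis (w * x))) (at x)"
  unfolding cis_conv_exp
  by (auto intro!: derivative_eq_intros has_vector_derivative_real_field simp: algebra_simps)

lemma integral_cis:
  assumes w: "w \<noteq> 0" and "a \<le> b"
  shows "(LINT y:{a..b}|lborel. cis (w * y)) = cis (w * b) / (\<i> * w) - cis (w * a) / (\<i> * w)"
proof (rule set_integral_FTC[OF assms(2)])
  show "((\<lambda>x. cis (w * x) / (\<i> * w)) has_vector_derivative cis (w * x)) (at x)" for x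
    using has_vector_derivative_mult_left[OF has_vector_derivative_cis[of w x], of "1 / (\<i> * w)"] w
    by simp
qed (auto intro!: continuous_intros)

text \<open>The interval from \<open>- L\<close> to \<open>L\<close> contains a whole number of
  periods; this makes boundary terms at its two ends cancel.\<close>

lemma cis_half_period:
  assumes "L > 0" shows "cis (pi / L * real_of_int m * L) = cis (pi / L * real_of_int m * (- L))"
proof -
  have "cis (pi / L * real_of_int m * L) = cis (pi / L * real_of_int m * (- L)) * cis (2 * pi
    * real_of_int m)"
    using assms by (simp add: cis_mult field_simps)
  then show ?thesis by simp
qed

text \<open>Along an axis with nonzero frequency every slice integral runs over full periods and
  vanishes, so the slice bound applies with \<open>B = 0\<close>.\<close>

lemma integral_wave_cube:
  assumes L: "L > 0" and k: "k \<noteq> 0"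
  shows "(LINT v:cube L|lborel. wave L k v) = 0"
proof -
  obtain i where i: "k $ i \<noteq> 0" using k by (auto simp: vec_eq_iff)
  define w where "w = pi / L * real_of_int (k $ i)"
  have w: "w \<noteq> 0" using i L by (simp add: w_def)
  have "cmod (LINT v:cube L|lborel. wave L k v) \<le> (2 * L)\<^sup>2 * 0"
  proof (rule cube_integral_slice_bound)
    fix u :: "real^3"
    have "(LINT y:{-L..L}|lborel. cis (w * y)) = 0"
      using L cis_half_period[OF L, of "k $ i"] by (subst integral_cis[OF w]) (auto simp: w_def)
    then show "cmod (LINT y:{-L..L}|lborel. wave L k (u + y *\<^sub>R axis i 1)) \<le> 0"
      by (simp add: wave_add_right wave_axis w_def)
  qed (use L in \<open>auto intro!: continuous_intros\<close>)
  then show ?thesis by simp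
qed

section \<open>Frequency weights and the decay of the kernel coefficients\<close>

definition weight :: "int^3 \<Rightarrow> real" where
  "weight k = 1 + norm (real_vec k)"

lemma weight_ge_1 [simp]: "weight k \<ge> 1" by (simp add: weight_def)
lemma weight_pos [simp]: "weight k > 0" using weight_ge_1[of k] by linarith
lemma weight_nonneg [simp]: "weight k \<ge> 0" using weight_ge_1[of k] by linarith
lemma weight_nz [simp]: "weight k \<noteq> 0" using weight_pos[of k] by linarith

lemma norm_ge_1_int_vec: "k \<noteq> 0 \<Longrightarrow> norm (real_vec k) \<ge> 1"
proof -
  assume "k \<noteq> 0"
  then obtain i where "k $ i \<noteq> 0" by (auto simp: vec_eq_iff)
  then have "1 \<le> \<bar>real_vec k $ i\<bar>" by simp
  also have "\<dots> \<le> norm (real_vec k)" by (rule component_le_norm_cart)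
  finally show ?thesis .
qed

lemma norm_sq_3: "(norm (v :: real^3))\<^sup>2 = (\<Sum>i\<in>UNIV. (v $ i)\<^sup>2)"
  by (simp add: norm_vec_def L2_set_def sum_nonneg)

text \<open>Selects the dominant axis, along which integration by parts gains most; only the factor
  \<open>sqrt 3\<close> is lost against the norm.\<close>

lemma norm_le_max_component: "\<exists>i. norm (v :: real^3) \<le> sqrt 3 * \<bar>v $ i\<bar>"
proof -
  obtain i where i: "\<And>j. \<bar>v $ j\<bar> \<le> \<bar>v $ i\<bar>"
  proof -
    have "finite (range (\<lambda>j. \<bar>v $ j\<bar>))" by simp
    then have "Max (range (\<lambda>j. \<bar>v $ j\<bar>)) \<in> range (\<lambda>j. \<bar>v $ j\<bar>)" by (intro Max_in) auto
    then obtain i where "Max (range (\<lambda>j. \<bar>v $ j\<bar>)) = \<bar>v $ i\<bar>" by (rule rangeE)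
    moreover have "\<bar>v $ j\<bar> \<le> Max (range (\<lambda>j. \<bar>v $ j\<bar>))" for j by (intro Max_ge) auto
    ultimately show thesis using that by metis
  qed
  have "(v $ j)\<^sup>2 \<le> (v $ i)\<^sup>2" for j using i[of j] by (simp add: abs_le_square_iff)
  then have "(norm v)\<^sup>2 \<le> (\<Sum>j\<in>(UNIV :: 3 set). (v $ i)\<^sup>2)"
    unfolding norm_sq_3 by (intro sum_mono) auto
  then have "(norm v)\<^sup>2 \<le> (sqrt 3 * \<bar>v $ i\<bar>)\<^sup>2" by (simp add: power_mult_distrib)
  then show ?thesis by (intro exI[of _ i]) (rule power2_le_imp_le, auto)
qed

text \<open>Two integrations by parts; the last term is controlled because \<open>t \<mapsto> sqrt (t\<^sup>2 + a)\<close> is convex,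
  so that the \<open>L\<^sup>1\<close> norm of its second derivative does not blow up as \<open>a\<close> tends to \<open>0\<close>.\<close>
lemma integral_sqrt_cis_pos:
  assumes L: "L > 0" and m: "m \<noteq> 0" and a: "a > 0"
  defines "w \<equiv> pi / L * real_of_int m"
  shows "cmod (LINT y:{-L..L}|lborel. of_real (sqrt (y\<^sup>2 + a)) * cis (w * y)) \<le> 4 / w\<^sup>2"
proof -
  have w: "w \<noteq> 0" using m L by (simp add: w_def)
  define f where "f = (\<lambda>y. sqrt (y\<^sup>2 + a))"
  define f1 where "f1 = (\<lambda>y. y / sqrt (y\<^sup>2 + a))"
  define f2 where "f2 = (\<lambda>y. a / sqrt (y\<^sup>2 + a) ^ 3)"
  have pos: "y\<^sup>2 + a > 0" for y using a by (simp add: add_nonneg_pos)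
  have pos': "sqrt (y\<^sup>2 + a) > 0" for y using pos by simp
  have sq: "sqrt (y\<^sup>2 + a) * sqrt (y\<^sup>2 + a) = y\<^sup>2 + a" for y using pos[of y] by simp
  have Df: "(f has_real_derivative f1 y) (at y)" for y
    unfolding f_def f1_def using pos[of y]
    by (auto intro!: derivative_eq_intros simp: field_simps)
  have Df1: "(f1 has_real_derivative f2 y) (at y)" for y
  proof -
    have "(f1 has_real_derivative (1 * sqrt (y\<^sup>2 + a) - y * (y / sqrt (y\<^sup>2 + a))) / (sqrt (y\<^sup>2 + a)
      * sqrt (y\<^sup>2 + a))) (at y)"
      unfolding f1_def using pos[of y] pos'[of y]
      by (intro DERIV_divide DERIV_ident Df[unfolded f_def f1_def]) auto
    moreover have "(1 * sqrt (y\<^sup>2 + a) - y * (y / sqrt (y\<^sup>2 + a))) / (sqrt (y\<^sup>2 + a) * sqrt (y\<^sup>2 + a)) = f2 y"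
      unfolding f2_def using pos'[of y] sq[of y]
      by (simp add: field_simps power3_eq_cube power2_eq_square)
    ultimately show ?thesis by simp
  qed
  have cf: "continuous_on UNIV f" "continuous_on UNIV f1" "continuous_on UNIV f2"
    unfolding f_def f1_def f2_def using pos pos'
      by (auto intro!: continuous_intros simp: less_imp_neq[THEN not_sym])
  have cL: "cis (w * L) = cis (w * (- L))" unfolding w_def by (rule cis_half_period[OF L])
  \<comment> \<open>Chosen so that the two terms with \<open>f1\<close> in its derivative cancel.
    This packs both integrations by parts into one use of the fundamental theorem.\<close>
  define F where "F = (\<lambda>y. of_real (f y) * cis (w * y) / (\<i> * w) + of_real (f1 y) * cis (w * y) / of_real
    (w\<^sup>2))"
  have DF: "(F has_vector_derivative (of_real (f y) * cis (w * y) + of_real (f2 y) * cis (w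
    * y) / of_real (w\<^sup>2))) (at y)" for y
  proof -
    have 1: "((\<lambda>y. of_real (f y) * cis (w * y)) has_vector_derivative
       (of_real (f y) * (\<i> * w * cis (w * y)) + of_real (f1 y) * cis (w * y))) (at y)"
      by (rule has_vector_derivative_mult[OF has_vector_derivative_of_real[OF Df] has_vector_derivative_cis])
    have 2: "((\<lambda>y. of_real (f1 y) * cis (w * y)) has_vector_derivative
       (of_real (f1 y) * (\<i> * w * cis (w * y)) + of_real (f2 y) * cis (w * y))) (at y)"
      by (rule has_vector_derivative_mult[OF has_vector_derivative_of_real[OF Df1] has_vector_derivative_cis])
    show ?thesis
      unfolding F_def
      using has_vector_derivative_add[OF has_vector_derivative_mult_left[OF 1, of "1 / (\<i> * w)"]
         has_vector_derivative_mult_left[OF 2, of "1 / of_real (w\<^sup>2)"]] w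
      by (simp add: field_simps power2_eq_square)
  qed
  have int: "set_integrable lborel {-L..L} (\<lambda>y. of_real (f y) * cis (w * y))"
            "set_integrable lborel {-L..L} (\<lambda>y. of_real (f2 y) * cis (w * y))"
    unfolding set_integrable_def
    by (rule borel_integrable_compact; auto intro!: continuous_intros continuous_on_subset[OF cf(1)]
      continuous_on_subset[OF cf(3)])+
  have "F L - F (- L) = (LINT y:{-L..L}|lborel. of_real (f y) * cis (w * y) + of_real (f2 y) * cis (w
    * y) / of_real (w\<^sup>2))"
    by (rule set_integral_FTC[symmetric, OF _ DF]) (use L w in \<open>auto intro!: continuous_intros cf\<close>)
  also have "\<dots> = (LINT y:{-L..L}|lborel. of_real (f y) * cis (w * y)) + (LINT y:{-L..L}|lborel. of_real
    (f2 y) * cis (w * y)) / of_real (w\<^sup>2)"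
    using int by (subst set_integral_add) (auto intro!: set_integrable_divide)
  finally have eq: "(LINT y:{-L..L}|lborel. of_real (f y) * cis (w * y)) = 
     F L - F (- L) - (LINT y:{-L..L}|lborel. of_real (f2 y) * cis (w * y)) / of_real (w\<^sup>2)" by simp
  have f1_le: "\<bar>f1 y\<bar> \<le> 1" for y
  proof -
    have "\<bar>y\<bar> \<le> sqrt (y\<^sup>2 + a)" using a by (intro real_le_rsqrt) auto
    then show ?thesis unfolding f1_def abs_divide abs_of_pos[OF pos'] using pos'[of y]
      by (simp only: pos_divide_le_eq mult_1)
  qed
  have f2_nonneg: "f2 y \<ge> 0" for y using pos'[of y] a by (simp add: f2_def)
  \<comment> \<open>\<open>f\<close> is even and \<open>cis (w * y)\<close> agrees at both ends, so
    the boundary terms of order \<open>1 / w\<close> cancel and only those of order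
    \<open>1 / w\<^sup>2\<close> remain.\<close>
  have FL: "F L - F (- L) = of_real (f1 L - f1 (- L)) * cis (w * L) / of_real (w\<^sup>2)"
    unfolding F_def cL[symmetric] by (simp add: f_def diff_divide_distrib left_diff_distrib)
  have "cmod (F L - F (-L)) \<le> 2 / w\<^sup>2"
    unfolding FL using f1_le[of L] f1_le[of "-L"] w
    by (auto simp: norm_mult norm_divide norm_power simp del: of_real_diff of_real_power intro!:
      divide_right_mono)
  moreover have "cmod (LINT y:{-L..L}|lborel. of_real (f2 y) * cis (w * y)) \<le> (LINT y:{-L..L}|lborel. f2 y)"
    unfolding set_lebesgue_integral_def
  proof (rule norm_integral_dominated)
    show "integrable lborel (\<lambda>x. indicator {-L..L} x *\<^sub>R f2 x)"
      by (rule borel_integrable_compact; auto intro!: continuous_on_subset[OF cf(3)])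
    show "cmod (indicator {-L..L} x *\<^sub>R (of_real (f2 x) * cis (w * x))) \<le> indicator {-L..L} x *\<^sub>R f2 x" for x
      using f2_nonneg[of x] by (auto simp: indicator_def norm_mult)
  qed
  moreover have "(LINT y:{-L..L}|lborel. f2 y) = f1 L - f1 (- L)"
    unfolding set_lebesgue_integral_def
    by (rule integral_FTC_atLeastAtMost)
       (use L Df1 in \<open>auto intro!: continuous_on_subset[OF cf(3)] DERIV_subset simp:
         has_real_derivative_iff_has_vector_derivative[symmetric] has_field_derivative_at_within\<close>)
  moreover have "f1 L - f1 (- L) \<le> 2" using f1_le[of L] f1_le[of "-L"] by linarith
  ultimately have A: "cmod (F L - F (-L)) \<le> 2 / w\<^sup>2"
    and I: "cmod (LINT y:{-L..L}|lborel. of_real (f2 y) * cis (w * y)) \<le> 2" by linarith+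
  have "cmod ((LINT y:{-L..L}|lborel. of_real (f2 y) * cis (w * y)) / of_real (w\<^sup>2)) \<le> 2 / w\<^sup>2"
    using I by (auto simp: norm_divide norm_power simp del: of_real_power intro!: divide_right_mono)
  with A have "cmod (LINT y:{-L..L}|lborel. of_real (f y) * cis (w * y)) \<le> 2 / w\<^sup>2 + 2 / w\<^sup>2"
    unfolding eq by (rule order.trans[OF norm_triangle_ineq4 add_mono])
  then show ?thesis by (simp add: f_def)
qed

text \<open>The value \<open>a = 0\<close> occurs on the line through the origin, where the square
  root has a corner. The bound for positive \<open>a\<close> does not depend on \<open>a\<close>,
  and moving \<open>a\<close> to \<open>a + d\<close> changes the integrand by at most
  \<open>sqrt d\<close>, so a limit argument suffices.\<close>

lemma integral_sqrt_cis:
  assumes L: "L > 0" and m: "m \<noteq> 0" and a: "a \<ge> 0"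
  defines "w \<equiv> pi / L * real_of_int m"
  shows "cmod (LINT y:{-L..L}|lborel. of_real (sqrt (y\<^sup>2 + a)) * cis (w * y)) \<le> 4 / w\<^sup>2"
proof (rule field_le_epsilon)
  fix e :: real assume e: "e > 0"
  \<comment> \<open>Makes \<open>2 * L * sqrt d\<close> equal to \<open>e\<close>: the uniform error
    \<open>sqrt d\<close>, integrated over the interval, costs exactly \<open>e\<close>.\<close>
  define d where "d = (e / (2 * L))\<^sup>2"
  have d: "d > 0" using e L by (simp add: d_def)
  have sd: "sqrt d = e / (2 * L)" using e L by (simp add: d_def)
  define h where "h = (\<lambda>b y. of_real (sqrt (y\<^sup>2 + b)) * cis (w * y))"
  have int: "set_integrable lborel {-L..L} (h b)" for b
    unfolding set_integrable_def h_def by (rule borel_integrable_compact; auto intro!: continuous_intros)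
  have "(LINT y:{-L..L}|lborel. h a y) = (LINT y:{-L..L}|lborel. h (a + d) y) +
    (LINT y:{-L..L}|lborel. h a y - h (a + d) y)"
    using int by (subst set_integral_diff) auto
  also have "cmod \<dots> \<le> 4 / w\<^sup>2 + e"
  proof (intro order.trans[OF norm_triangle_ineq] add_mono)
    show "cmod (LINT y:{-L..L}|lborel. h (a + d) y) \<le> 4 / w\<^sup>2"
      unfolding h_def w_def using L m a d by (intro integral_sqrt_cis_pos) auto
    have "cmod (LINT y:{-L..L}|lborel. h a y - h (a + d) y) \<le> (LINT y:{-L..L}|lborel. sqrt d)"
      unfolding set_lebesgue_integral_def
    proof (rule norm_integral_dominated)
      fix y
      have "sqrt (y\<^sup>2 + (a + d)) \<le> sqrt (y\<^sup>2 + a) + sqrt d"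
        using sqrt_add_le_add_sqrt[of "y\<^sup>2 + a" d] a d by (simp add: add.assoc)
      moreover have "sqrt (y\<^sup>2 + a) \<le> sqrt (y\<^sup>2 + (a + d))" using d by simp
      moreover have "h a y - h (a + d) y = of_real (sqrt (y\<^sup>2 + a) - sqrt (y\<^sup>2 + (a + d))) * cis (w * y)"
        by (simp add: h_def algebra_simps)
      ultimately have "cmod (h a y - h (a + d) y) \<le> sqrt d"
        by (simp add: norm_mult del: of_real_diff)
      then show "cmod (indicator {-L..L} y *\<^sub>R (h a y - h (a + d) y)) \<le> indicator {-L..L} y *\<^sub>R sqrt d"
        by (auto simp: indicator_def)
    qed (auto intro!: integrable_real_indicator simp: emeasure_lborel_Icc_eq)
    also have "\<dots> = e" using L sd by (simp add: set_lebesgue_integral_def)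
    finally show "cmod (LINT y:{-L..L}|lborel. h a y - h (a + d) y) \<le> e" .
  qed
  finally show "cmod (LINT y:{-L..L}|lborel. of_real (sqrt (y\<^sup>2 + a)) * cis (w * y)) \<le> 4 / w\<^sup>2 + e"
    by (simp add: h_def)
qed

text \<open>On a line parallel to the axis \<open>i\<close> the norm has the form
  \<open>sqrt (y\<^sup>2 + a)\<close>, where \<open>a\<close> is the squared distance of the line
  from the origin. The one-dimensional estimate along the dominant axis is integrated over the other
  two.\<close>

lemma psi_coeff_decay:
  assumes R: "R > 0"
  shows "\<exists>C>0. \<forall>k. cmod (psi_coeff R k) \<le> C / (weight k)\<^sup>2"
proof -
  \<comment> \<open>The first summand, volume times a bound for the norm, serves
    \<open>k = 0\<close>. The second is the face area times \<open>4 / w\<^sup>2\<close>; its factor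
    \<open>12\<close> is the square of \<open>2 * sqrt 3\<close>, the ratio between
    \<open>weight k\<close> and the dominant component.\<close>
  define C where "C = (4 * R) ^ 3 * (4 * R) + (4 * R)\<^sup>2 * (16 * R\<^sup>2 / pi\<^sup>2) * 12"
  have "cmod (psi_coeff R k) \<le> C / (weight k)\<^sup>2" for k
  proof (cases "k = 0")
    case True
    have "cmod (psi_coeff R k) \<le> (2 * (2 * R)) ^ 3 * (4 * R)"
      unfolding psi_coeff_def
    proof (rule set_integral_norm_bound_cube)
      fix u :: "real^3" assume u: "u \<in> cube (2 * R)"
      obtain i where "norm u \<le> sqrt 3 * \<bar>u $ i\<bar>" using norm_le_max_component by blast
      also have "\<dots> \<le> 2 * (2 * R)" using u R real_sqrt_le_mono[of 3 4]
        by (intro mult_mono) (auto simp: mem_cube)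
      finally show "cmod (complex_of_real (norm u) * wave (2 * R) (- k) u) \<le> 4 * R"
        by (simp add: norm_mult)
    qed (use R in auto)
    then show ?thesis using True R by (simp add: C_def weight_def add_increasing2)
  next
    case False
    obtain i where i: "norm (real_vec k) \<le> sqrt 3 * \<bar>real_vec k $ i\<bar>" using norm_le_max_component by blast
    then have ki: "k $ i \<noteq> 0" using norm_ge_1_int_vec[OF False] by auto
    have jbk: "(weight k)\<^sup>2 \<le> 12 * (real_of_int (k $ i))\<^sup>2"
    proof -
      have "weight k \<le> 2 * (sqrt 3 * \<bar>real_vec k $ i\<bar>)" unfolding weight_def
        using i norm_ge_1_int_vec[OF False] by linarith
      then have "(weight k)\<^sup>2 \<le> (2 * (sqrt 3 * \<bar>real_vec k $ i\<bar>))\<^sup>2" by (intro power_mono) auto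
      then show ?thesis by (simp add: power_mult_distrib)
    qed
    define w where "w = pi / (2 * R) * real_of_int (- (k $ i))"
    have "cmod (psi_coeff R k) \<le> (2 * (2 * R))\<^sup>2 * (4 / w\<^sup>2)"
      unfolding psi_coeff_def
    proof (rule cube_integral_slice_bound)
      fix u :: "real^3" assume u: "u $ i = 0"
      have nrm: "norm (u + y *\<^sub>R axis i 1) = sqrt (y\<^sup>2 + (norm u)\<^sup>2)" for y
      proof -
        have "(norm (u + y *\<^sub>R axis i 1))\<^sup>2 = (norm u)\<^sup>2 + 2 * (u \<bullet> (y *\<^sub>R axis i 1)) + (norm (y *\<^sub>R
          (axis i 1 :: real^3)))\<^sup>2"
          unfolding power2_norm_eq_inner by (simp add: inner_add_left inner_add_right inner_commute)
        also have "\<dots> = y\<^sup>2 + (norm u)\<^sup>2" using u by (simp add: inner_axis norm_axis_1)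
        finally show ?thesis by (metis norm_ge_zero real_sqrt_unique)
      qed
      have "(LINT y:{-(2*R)..2*R}|lborel. complex_of_real (norm (u + y *\<^sub>R axis i 1)) * wave (2 * R)
        (- k) (u + y *\<^sub>R axis i 1))
         = (LINT y:{-(2*R)..2*R}|lborel. wave (2 * R) (-k) u * (of_real (sqrt (y\<^sup>2 + (norm u)\<^sup>2)) * cis
           (w * y)))"
        unfolding nrm wave_add_right wave_axis w_def
        by (rule arg_cong[where f="set_lebesgue_integral lborel _"]) (simp add: mult_ac)
      also have "\<dots> = wave (2 * R) (-k) u * (LINT y:{-(2*R)..2*R}|lborel. (of_real (sqrt (y\<^sup>2 +
        (norm u)\<^sup>2)) * cis (w * y)))"
        by simp
      also have "cmod \<dots> \<le> 4 / w\<^sup>2"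
        unfolding w_def norm_mult norm_wave mult_1 using ki R by (intro integral_sqrt_cis) auto
      finally show "cmod (LINT y:{-(2*R)..2*R}|lborel. complex_of_real (norm (u + y *\<^sub>R axis i 1)) * wave
        (2 * R) (- k) (u + y *\<^sub>R axis i 1)) \<le> 4 / w\<^sup>2" .
    qed (use R in \<open>auto intro!: continuous_intros\<close>)
    also have "\<dots> = (4 * R)\<^sup>2 * (16 * R\<^sup>2 / pi\<^sup>2) / (real_of_int (k $ i))\<^sup>2"
      using R by (simp add: w_def power_mult_distrib power_divide)
    also have "\<dots> \<le> ((4 * R)\<^sup>2 * (16 * R\<^sup>2 / pi\<^sup>2) * 12) / (weight k)\<^sup>2"
    proof -
      have "12 * (real_of_int (k $ i))\<^sup>2 / (weight k)\<^sup>2 \<ge> 1" using jbk by (simp add: le_divide_eq)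
      then have "1 / (real_of_int (k $ i))\<^sup>2 \<le> 12 / (weight k)\<^sup>2" using ki by (simp add: field_simps)
      then have "((4 * R)\<^sup>2 * (16 * R\<^sup>2 / pi\<^sup>2)) * (1 / (real_of_int (k $ i))\<^sup>2)
        \<le> ((4 * R)\<^sup>2 * (16 * R\<^sup>2 / pi\<^sup>2)) * (12 / (weight k)\<^sup>2)"
        by (intro mult_left_mono) auto
      then show ?thesis by simp
    qed
    also have "\<dots> \<le> C / (weight k)\<^sup>2"
      using R by (intro divide_right_mono) (auto simp: C_def)
    finally show ?thesis .
  qed
  moreover have "C > 0" unfolding C_def using R by (intro add_pos_nonneg) auto
  ultimately show ?thesis by blast
qed

section \<open>Absolutely convergent wave series\<close>

text \<open>The index type is kept apart from the frequency map \<open>\<kappa>\<close>, which need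
  not be injective. Products, indexed by pairs, and aliased series are then wave series with the
  original coefficients, and terms of equal frequency never have to be collected.\<close>

definition wseries :: "real \<Rightarrow> ('x \<Rightarrow> complex) \<Rightarrow> ('x \<Rightarrow> int^3) \<Rightarrow> real^3 \<Rightarrow> complex" where
  "wseries L b \<kappa> v = (\<Sum>\<^sub>\<infinity>x. b x * wave L (\<kappa> x) v)"

lemma abs_summable_wave:
  "(\<lambda>x. cmod (b x)) summable_on UNIV \<Longrightarrow> (\<lambda>x. cmod (b x * wave L (\<kappa> x) v)) summable_on UNIV"
  by (simp add: norm_mult)

lemma has_sum_wseries:
  assumes "(\<lambda>x. cmod (b x)) summable_on UNIV"
  shows "((\<lambda>x. b x * wave L (\<kappa> x) v) has_sum wseries L b \<kappa> v) UNIV"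
  unfolding wseries_def using abs_summable_summable[OF abs_summable_wave[OF assms]] by (rule has_sum_infsum)

lemma norm_wseries_le:
  assumes "(\<lambda>x. cmod (b x)) summable_on UNIV"
  shows "cmod (wseries L b \<kappa> v) \<le> (\<Sum>\<^sub>\<infinity>x. cmod (b x))"
  unfolding wseries_def using norm_infsum_bound[OF abs_summable_wave[OF assms, of L \<kappa> v]]
  by (simp add: norm_mult)

lemma uniform_limit_wseries:
  assumes "(\<lambda>x. cmod (b x)) summable_on UNIV"
  shows "uniform_limit UNIV (\<lambda>X v. \<Sum>x\<in>X. b x * wave L (\<kappa> x) v) (wseries L b \<kappa>) (finite_subsets_at_top UNIV)"
  unfolding wseries_def[abs_def]
  by (rule Weierstrass_m_test_general[OF _ assms]) (simp add: norm_mult)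

lemma continuous_on_wseries:
  assumes "(\<lambda>x. cmod (b x)) summable_on UNIV"
  shows "continuous_on S (wseries L b \<kappa>)"
proof (rule continuous_on_subset)
  show "continuous_on UNIV (wseries L b \<kappa>)"
    by (rule uniform_limit_theorem[OF _ uniform_limit_wseries[OF assms]])
       (auto intro!: always_eventually continuous_intros)
qed auto

lemma integrable_mult_bounded_continuous:
  fixes w h :: "real^3 \<Rightarrow> complex"
  assumes w: "integrable lborel w" and h: "continuous_on UNIV h" and B: "\<And>u. cmod (h u) \<le> B"
  shows "integrable lborel (\<lambda>u. w u * h u)"
proof (rule Bochner_Integration.integrable_bound)
  show "integrable lborel (\<lambda>u. B * norm (w u))" using w by auto
  have "h \<in> borel_measurable lborel" using h by (simp add: borel_measurable_continuous_onI)
  then show "(\<lambda>u. w u * h u) \<in> borel_measurable lborel" using w by auto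
  show "AE u in lborel. norm (w u * h u) \<le> norm (B * norm (w u))"
    using B order.trans[OF norm_ge_zero B] by
      (auto simp: norm_mult mult.commute intro!: mult_right_mono AE_I2)
qed

text \<open>The series converges uniformly, and integration against an integrable \<open>w\<close>
  is continuous for uniform convergence.\<close>

lemma has_sum_integral_wseries:
  assumes w: "integrable lborel w" and b: "(\<lambda>x. cmod (b x)) summable_on UNIV"
  shows "((\<lambda>x. b x * (LINT u|lborel. w u * wave L (\<kappa> x) u)) has_sum
          (LINT u|lborel. w u * wseries L b \<kappa> u)) UNIV"
  unfolding has_sum_def
proof (rule tendstoI)
  fix e :: real assume e: "e > 0"
  define N where "N = (LINT u|lborel. cmod (w u))"
  have N: "N \<ge> 0" unfolding N_def by simp
  \<comment> \<open>The summand \<open>1\<close> keeps the quotient meaningful when \<open>w\<close>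
    vanishes almost everywhere.\<close>
  have "e / (N + 1) > 0" using e N by simp
  from uniform_limitD[OF uniform_limit_wseries[OF b, of L \<kappa>] this]
  show "\<forall>\<^sub>F X in finite_subsets_at_top UNIV. dist (\<Sum>x\<in>X. b x * (LINT u|lborel. w u * wave L (\<kappa> x) u))
    (LINT u|lborel. w u * wseries L b \<kappa> u) < e"
  proof eventually_elim
    case (elim X)
    have iw: "integrable lborel (\<lambda>u. w u * wave L (\<kappa> x) u)" for x
      by (rule integrable_mult_bounded_continuous[OF w, of _ 1]) (auto intro: continuous_intros)
    have iS: "integrable lborel (\<lambda>u. w u * wseries L b \<kappa> u)"
      by (rule integrable_mult_bounded_continuous[OF w continuous_on_wseries[OF b] norm_wseries_le[OF b]])
    have "(\<Sum>x\<in>X. b x * (LINT u|lborel. w u * wave L (\<kappa> x) u)) - (LINT u|lborel. w u * wseries L b \<kappa> u) =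
       (LINT u|lborel. w u * ((\<Sum>x\<in>X. b x * wave L (\<kappa> x) u) - wseries L b \<kappa> u))"
    proof -
      have "(\<Sum>x\<in>X. b x * (LINT u|lborel. w u * wave L (\<kappa> x) u))
        = (LINT u|lborel. (\<Sum>x\<in>X. b x * (w u * wave L (\<kappa> x) u)))"
        using iw by (subst Bochner_Integration.integral_sum) auto
      also have "\<dots> - (LINT u|lborel. w u * wseries L b \<kappa> u)
        = (LINT u|lborel. (\<Sum>x\<in>X. b x * (w u * wave L (\<kappa> x) u)) - w u * wseries L b \<kappa> u)"
        using iw iS by (subst Bochner_Integration.integral_diff) auto
      finally show ?thesis by (simp add: right_diff_distrib sum_distrib_left mult_ac)
    qed
    also have "cmod \<dots> \<le> (LINT u|lborel. cmod (w u) * (e / (N + 1)))"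
    proof (rule norm_integral_dominated)
      fix u
      show "cmod (w u * ((\<Sum>x\<in>X. b x * wave L (\<kappa> x) u) - wseries L b \<kappa> u)) \<le> cmod (w u) * (e / (N + 1))"
        unfolding norm_mult using elim by (intro mult_left_mono) (auto simp: dist_norm less_imp_le)
    qed (use w in auto)
    also have "\<dots> = N * (e / (N + 1))" by (simp add: N_def)
    also have "\<dots> < e" using e N by (simp add: field_simps)
    finally show ?case by (simp add: dist_norm)
  qed
qed

section \<open>Termwise differentiation and products of wave series\<close>

definition dmul :: "real \<Rightarrow> 3 \<Rightarrow> int^3 \<Rightarrow> complex" where
  "dmul L i k = \<i> * of_real (pi / L * real_of_int (k $ i))"

lemma norm_dmul: "cmod (dmul L i k) = \<bar>pi / L\<bar> * \<bar>real_of_int (k $ i)\<bar>"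
  by (simp only: dmul_def norm_mult norm_ii norm_of_real abs_mult mult_1)

lemma norm_dmul_le: "cmod (dmul L i k) \<le> \<bar>pi / L\<bar> * weight k"
proof -
  have "\<bar>real_of_int (k $ i)\<bar> \<le> norm (real_vec k)"
    using component_le_norm_cart[of "real_vec k" i] by simp
  then show ?thesis unfolding norm_dmul weight_def by (intro mult_left_mono) auto
qed

lemma norm_cis_diff_le: "cmod (cis a - 1) \<le> \<bar>a\<bar>"
proof -
  have "(cmod (cis a - 1))\<^sup>2 = (cos a - 1)\<^sup>2 + (sin a)\<^sup>2"
    by (simp add: cmod_power2)
  also have "\<dots> = 2 - 2 * cos a"
    using sin_cos_squared_add[of a] by (simp add: power2_eq_square algebra_simps)
  also have "\<dots> = (2 * sin (a / 2))\<^sup>2"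
    using cos_double_sin[of "a / 2"] by (simp add: power_mult_distrib)
  also have "\<dots> \<le> \<bar>a\<bar>\<^sup>2"
  proof -
    have "\<bar>2 * sin (a / 2)\<bar> \<le> \<bar>a\<bar>" using abs_sin_x_le_abs_x[of "a / 2"] by (simp add: abs_mult)
    then show ?thesis by (simp only: abs_le_square_iff power2_abs)
  qed
  finally show ?thesis by (rule power2_le_imp_le) auto
qed

lemma has_vector_derivative_0_iff:
  fixes h :: "real \<Rightarrow> complex"
  shows "(h has_vector_derivative D) (at 0) \<longleftrightarrow> ((\<lambda>t. (h t - h 0) / of_real t) \<longlongrightarrow> D) (at 0)"
proof -
  have "(h has_vector_derivative D) (at 0) \<longleftrightarrow> ((\<lambda>t. norm ((h t - h 0 - (t - 0) *\<^sub>R D) /\<^sub>R norm (t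
    - 0))) \<longlongrightarrow> 0) (at 0)"
    unfolding has_vector_derivative_def has_derivative_at_within tendsto_norm_zero_iff
    by (simp add: bounded_linear_scaleR_left)
  also have "\<dots> \<longleftrightarrow> ((\<lambda>t. norm ((h t - h 0) / of_real t - D)) \<longlongrightarrow> 0) (at 0)"
  proof (rule filterlim_cong[OF refl refl])
    have "norm ((h t - h 0 - (t - 0) *\<^sub>R D) /\<^sub>R norm (t - 0)) = norm ((h t - h 0) / of_real t - D)"
      if "t \<noteq> 0" for t
    proof -
      have "h t - h 0 - (t - 0) *\<^sub>R D = of_real t * ((h t - h 0) / of_real t - D)"
        using that by (simp add: scaleR_conv_of_real right_diff_distrib diff_divide_distrib)
      then show ?thesis using that by (simp add: norm_mult)
    qed
    then show "\<forall>\<^sub>F t in at 0. norm ((h t - h 0 - (t - 0) *\<^sub>R D) /\<^sub>R norm (t - 0))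
      = norm ((h t - h 0) / of_real t - D)"
      by (simp add: eventually_at_filter)
  qed
  also have "\<dots> \<longleftrightarrow> ((\<lambda>t. (h t - h 0) / of_real t) \<longlongrightarrow> D) (at 0)"
    unfolding tendsto_norm_zero_iff by (simp add: LIM_zero_iff)
  finally show ?thesis .
qed

lemma continuous_cis_quotient:
  fixes w :: real
  shows "continuous_on UNIV (\<lambda>t. if t = 0 then \<i> * w else (cis (w * t) - 1) / of_real t)"
proof -
  have "isCont (\<lambda>t. if t = 0 then \<i> * w else (cis (w * t) - 1) / of_real t) t" for t :: real
  proof (cases "t = 0")
    case True
    have "((\<lambda>t. cis (w * t)) has_vector_derivative \<i> * w * cis (w * 0)) (at 0)"
      by (rule has_vector_derivative_cis)
    then have "((\<lambda>t. (cis (w * t) - 1) / of_real t) \<longlongrightarrow> \<i> * w) (at 0)"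
      by (simp add: has_vector_derivative_0_iff)
    moreover have "\<forall>\<^sub>F t in at 0. (cis (w * t) - 1) / of_real t = (if t
      = 0 then \<i> * w else (cis (w * t) - 1) / of_real t)"
      by (simp add: eventually_at_filter)
    ultimately show ?thesis using True by (simp add: isCont_def tendsto_cong)
  next
    case False
    have cq: "isCont (\<lambda>t. (cis (w * t) - 1) / of_real t) t"
      using False unfolding cis_conv_exp by (intro continuous_intros) auto
    have "eventually (\<lambda>s. s \<noteq> 0) (nhds t)" using False by (intro t1_space_nhds) auto
    then have "\<forall>\<^sub>F s in nhds t. (if s = 0 then \<i> * w else (cis (w * s) - 1) / of_real s)
      = (cis (w * s) - 1) / of_real s"
      by eventually_elim auto
    from isCont_cong[OF this] show ?thesis using cq by simp
  qed
  then show ?thesis by (simp add: continuous_at_imp_continuous_on)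
qed

text \<open>The difference quotient is itself a series of continuous functions of \<open>t\<close>,
  once each summand is given its derivative as value at \<open>t = 0\<close>. The inequality
  \<open>norm_cis_diff_le\<close> bounds the summands uniformly in \<open>t\<close>, so the sum
  \<open>Q\<close> is continuous at \<open>0\<close>, which is the claim.\<close>

lemma has_vector_derivative_wseries:
  assumes b: "(\<lambda>x. weight (\<kappa> x) * cmod (b x)) summable_on UNIV"
  shows "((\<lambda>t. wseries L b \<kappa> (v + t *\<^sub>R axis i 1)) has_vector_derivative
     wseries L (\<lambda>x. dmul L i (\<kappa> x) * b x) \<kappa> v) (at 0)"
proof -
  have b0: "(\<lambda>x. cmod (b x)) summable_on UNIV"
  proof (rule summable_on_comparison_test[OF b])
    show "cmod (b x) \<le> weight (\<kappa> x) * cmod (b x)" for x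
      using mult_right_mono[OF weight_ge_1[of "\<kappa> x"] norm_ge_zero[of "b x"]] by simp
  qed auto
  define w where "w = (\<lambda>x. pi / L * real_of_int (\<kappa> x $ i))"
  define q where "q = (\<lambda>x t. if t = 0 then \<i> * w x else (cis (w x * t) - 1) / of_real t)"
  have nq: "cmod (q x t) \<le> \<bar>w x\<bar>" for x t
    using norm_cis_diff_le[of "w x * t"]
    by (auto simp: q_def norm_mult norm_divide divide_le_eq abs_mult)
  have wle: "\<bar>w x\<bar> \<le> \<bar>pi / L\<bar> * weight (\<kappa> x)" for x
    using norm_dmul_le[of L i "\<kappa> x"] by (simp add: norm_dmul w_def abs_mult)
  define h where "h = (\<lambda>x t. b x * wave L (\<kappa> x) v * q x t)"
  have hb: "cmod (h x t) \<le> \<bar>pi / L\<bar> * (weight (\<kappa> x) * cmod (b x))" for x t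
  proof -
    have "cmod (h x t) = cmod (b x) * cmod (q x t)" by (simp add: h_def norm_mult)
    also have "\<dots> \<le> cmod (b x) * (\<bar>pi / L\<bar> * weight (\<kappa> x))"
      using nq[of x t] wle[of x] by (intro mult_left_mono) auto
    finally show ?thesis by (simp add: mult_ac)
  qed
  have sM: "(\<lambda>x. \<bar>pi / L\<bar> * (weight (\<kappa> x) * cmod (b x))) summable_on UNIV"
    using b by (rule summable_on_cmult_right)
  define Q where "Q = (\<lambda>t. \<Sum>\<^sub>\<infinity>x. h x t)"
  have "uniform_limit UNIV (\<lambda>X t. \<Sum>x\<in>X. h x t) Q (finite_subsets_at_top UNIV)"
    unfolding Q_def by (rule Weierstrass_m_test_general[OF _ sM]) (rule hb)
  then have "continuous_on UNIV Q"
    by (rule uniform_limit_theorem[rotated])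
       (auto intro!: always_eventually continuous_intros simp: h_def q_def continuous_cis_quotient)
  then have "isCont Q 0" by (simp add: continuous_on_eq_continuous_at)
  then have lim: "(Q \<longlongrightarrow> Q 0) (at 0)" by (simp add: isCont_def)
  have Q0: "Q 0 = wseries L (\<lambda>x. dmul L i (\<kappa> x) * b x) \<kappa> v"
    unfolding Q_def wseries_def h_def q_def dmul_def w_def by (simp add: mult_ac)
  have shift: "wave L (\<kappa> x) (v + t *\<^sub>R axis i 1) = wave L (\<kappa> x) v * cis (w x * t)" for x t
    by (simp add: wave_add_right wave_axis w_def)
  have diff: "wseries L b \<kappa> (v + t *\<^sub>R axis i 1) - wseries L b \<kappa> v = of_real t * Q t" for t
  proof -
    have "((\<lambda>x. b x * wave L (\<kappa> x) (v + t *\<^sub>R axis i 1) - b x * wave L (\<kappa> x) v) has_sum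
       (wseries L b \<kappa> (v + t *\<^sub>R axis i 1) - wseries L b \<kappa> v)) UNIV"
      unfolding diff_conv_add_uminus by (intro has_sum_add has_sum_wseries b0)
        (simp add: has_sum_uminus has_sum_wseries b0)
    moreover have "b x * wave L (\<kappa> x) (v + t *\<^sub>R axis i 1) - b x * wave L (\<kappa> x) v = of_real t * h x t" for x
      unfolding shift h_def q_def by (auto simp: field_simps)
    moreover have "((\<lambda>x. of_real t * h x t) has_sum (of_real t * Q t)) UNIV"
      unfolding Q_def
    proof (intro has_sum_cmult_right has_sum_infsum)
      show "(\<lambda>x. h x t) summable_on UNIV"
        by (rule abs_summable_summable, rule summable_on_comparison_test[OF sM]) (use hb in auto)
    qed
    ultimately show ?thesis by (simp add: has_sum_unique)
  qed
  have "((\<lambda>t. (wseries L b \<kappa> (v + t *\<^sub>R axis i 1) - wseries L b \<kappa> v) / of_real t) \<longlongrightarrow> Q 0) (at 0)"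
    using lim by (rule Lim_transform_eventually) (simp add: diff eventually_at_filter)
  then show ?thesis by (simp add: has_vector_derivative_0_iff Q0)
qed

lemma partial_deriv_wseries:
  assumes "(\<lambda>x. weight (\<kappa> x) * cmod (b x)) summable_on UNIV"
  shows "partial_deriv i (wseries L b \<kappa>) v = wseries L (\<lambda>x. dmul L i (\<kappa> x) * b x) \<kappa> v"
  unfolding partial_deriv_def
  by (rule vector_derivative_at[OF has_vector_derivative_wseries[OF assms]])

text \<open>Locality of derivatives is what allows \<open>f\<close>, \<open>g\<close> and the flux
  to be replaced by their series near the small cube.\<close>

lemma partial_deriv_cong_open:
  assumes "open U" "v \<in> U" "\<And>x. x \<in> U \<Longrightarrow> F x = G x"
  shows "partial_deriv i F v = partial_deriv i G v"
  unfolding partial_deriv_def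
proof (rule vector_derivative_cong_eq)
  have "open ((\<lambda>t. v + t *\<^sub>R axis i 1) -` U)"
    using assms(1) by (intro open_vimage continuous_intros)
  then have "\<forall>\<^sub>F t in nhds 0. t \<in> (\<lambda>t. v + t *\<^sub>R axis i 1) -` U"
    using assms(2) by (intro eventually_nhds_in_open) auto
  then show "\<forall>\<^sub>F t in nhds 0. t \<in> UNIV \<longrightarrow> F (v + t *\<^sub>R axis i 1) = G (v + t *\<^sub>R axis i 1)"
    by eventually_elim (use assms in auto)
qed auto

text \<open>Absolute convergence turns the product into one sum over pairs; the frequencies add
  because waves multiply.\<close>

lemma wseries_mult:
  assumes b: "(\<lambda>x. cmod (b x)) summable_on UNIV" and c: "(\<lambda>y. cmod (c y)) summable_on UNIV"
  shows "wseries L b \<kappa> v * wseries L c \<mu> v = wseries L (\<lambda>(x, y). b x * c y) (\<lambda>(x, y). \<kappa> x + \<mu> y) v"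
    and "(\<lambda>z. cmod (case z of (x, y) \<Rightarrow> b x * c y)) summable_on UNIV"
proof -
  have sm: "(\<lambda>(x, y). cmod (b x) * cmod (c y)) summable_on UNIV \<times> UNIV"
    by (rule summable_on_SigmaI[where g="\<lambda>x. cmod (b x) * infsum (\<lambda>y. cmod (c y)) UNIV"])
       (auto intro!: has_sum_cmult_right has_sum_infsum c summable_on_cmult_left b)
  then show sm': "(\<lambda>z. cmod (case z of (x, y) \<Rightarrow> b x * c y)) summable_on UNIV"
    by (simp add: case_prod_unfold norm_mult)
  have "((\<lambda>(x, y). b x * wave L (\<kappa> x) v * (c y * wave L (\<mu> y) v))
    has_sum (wseries L b \<kappa> v * wseries L c \<mu> v)) (UNIV \<times> UNIV)"
  proof (rule has_sum_SigmaI[where g="\<lambda>x. b x * wave L (\<kappa> x) v * wseries L c \<mu> v"])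
    show "((\<lambda>x. b x * wave L (\<kappa> x) v * wseries L c \<mu> v) has_sum wseries L b \<kappa> v * wseries L c \<mu> v) UNIV"
      by (intro has_sum_cmult_left has_sum_wseries b)
    show "(\<lambda>(x, y). b x * wave L (\<kappa> x) v * (c y * wave L (\<mu> y) v)) summable_on UNIV \<times> UNIV"
      by (rule abs_summable_summable, rule summable_on_comparison_test[OF sm]) (auto simp: norm_mult)
  qed (auto intro!: has_sum_cmult_right has_sum_wseries c)
  moreover have "((\<lambda>z. (case z of (x, y) \<Rightarrow> b x * c y) * wave L (case z of (x, y) \<Rightarrow> \<kappa> x + \<mu> y) v) has_sum
      wseries L (\<lambda>(x, y). b x * c y) (\<lambda>(x, y). \<kappa> x + \<mu> y) v) UNIV"
    by (rule has_sum_wseries[OF sm'])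
  ultimately show "wseries L b \<kappa> v * wseries L c \<mu> v = wseries L (\<lambda>(x, y). b x * c y) (\<lambda>(x, y). \<kappa> x + \<mu> y) v"
    by (intro has_sum_unique) (auto simp: case_prod_unfold wave_add mult_ac)
qed

section \<open>Fourier inversion on a cube\<close>

text \<open>The powers of this trigonometric polynomial concentrate at \<open>x0\<close>, so that a continuous function
  orthogonal to all waves vanishes at \<open>x0\<close>.\<close>
definition peak :: "real \<Rightarrow> real^3 \<Rightarrow> real^3 \<Rightarrow> real" where
  "peak L x0 v = (\<Sum>i\<in>UNIV. (1 + cos (pi / L * (v $ i - x0 $ i))) / 6)"

lemma peak_nonneg: "peak L x0 v \<ge> 0"
proof -
  have "0 \<le> 1 + cos x" for x :: real using cos_ge_minus_one[of x] by linarith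
  then show ?thesis unfolding peak_def by (intro sum_nonneg divide_nonneg_pos) auto
qed

lemma continuous_on_peak [continuous_intros]: "continuous_on S (peak L x0)"
  unfolding peak_def by (intro continuous_intros) auto

lemma peak_same: "peak L x0 x0 = 1"
  by (simp add: peak_def)

text \<open>Two points of the closed cube may differ by a full period \<open>2 * L\<close> in some
  coordinate, and the peak could not tell them apart. An interior \<open>x0\<close> excludes
  this.\<close>

lemma peak_less_1:
  assumes L: "L > 0" and x0: "x0 \<in> interior (cube L)" and v: "v \<in> cube L" "v \<noteq> x0"
  shows "peak L x0 v < 1"
proof -
  obtain i where i: "v $ i \<noteq> x0 $ i" using v by (auto simp: vec_eq_iff)
  have "cos (pi / L * (v $ i - x0 $ i)) \<noteq> 1"
  proof
    assume "cos (pi / L * (v $ i - x0 $ i)) = 1"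
    then obtain n :: int where "pi / L * (v $ i - x0 $ i) = of_int n * 2 * pi" by (auto simp: cos_one_2pi_int)
    moreover have "v $ i - x0 $ i = L / pi * (pi / L * (v $ i - x0 $ i))" using L by simp
    ultimately have n: "v $ i - x0 $ i = of_int n * (2 * L)" using L by simp
    have "\<bar>v $ i - x0 $ i\<bar> < 2 * L" 
    proof -
      have "\<bar>v $ i\<bar> \<le> L" "\<bar>x0 $ i\<bar> < L" using x0 v by (auto simp: mem_cube interior_cube)
      then show ?thesis by linarith
    qed
    then have "\<bar>of_int n :: real\<bar> < 1" using n L by (simp add: abs_mult)
    then have "n = 0" by linarith
    then show False using n i by simp
  qed
  then have "cos (pi / L * (v $ i - x0 $ i)) < 1" using cos_le_one order_le_imp_less_or_eq by blast
  then have "peak L x0 v < (\<Sum>i\<in>(UNIV :: 3 set). 1 / 3)"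
    unfolding peak_def by (intro sum_strict_mono_ex1) (auto intro!: exI[of _ i])
  then show ?thesis by simp
qed

text \<open>Multiplication by the peak combines a wave with its six neighbouring frequencies, so
  orthogonality to all waves is inherited by every power of the peak.\<close>

lemma peak_mult_wave:
  "of_real (peak L x0 v) * wave L k v = 1 / 2 * wave L k v +
     (\<Sum>i\<in>UNIV. 1 / 12 * cis (- (pi / L * x0 $ i)) * wave L (k + axis i 1) v
             + 1 / 12 * cis (pi / L * x0 $ i) * wave L (k - axis i 1) v)"
proof -
  have ax: "real_vec (axis i 1) = axis i 1" for i by (auto simp: vec_eq_iff axis_def)
  have c: "complex_of_real (cos (pi / L * (v $ i - x0 $ i))) =
     (cis (- (pi / L * x0 $ i)) * wave L (axis i 1) v + cis (pi / L * x0 $ i) * wave L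
       (- axis i 1) v) / 2" for i
    by (simp add: wave_cis ax inner_axis' cis_mult complex_eq_iff right_diff_distrib left_diff_distrib
      cos_diff sin_diff)
  have "of_real (peak L x0 v) = 1 / 2 + (\<Sum>i\<in>UNIV. complex_of_real (cos (pi / L * (v $ i - x0 $ i))) / 6)"
    by (simp add: peak_def add_divide_distrib sum.distrib)
  then show ?thesis
    unfolding c by (simp add: wave_add distrib_right sum_distrib_left wave_add[of _ _ "- _", unfolded
      add_uminus_conv_diff] mult_ac add_divide_distrib distrib_left)
qed

lemma set_integral_sum:
  fixes g :: "'i \<Rightarrow> 'a \<Rightarrow> 'b :: {banach, second_countable_topology}"
  assumes "finite I" "\<And>i. set_integrable M S (g i)"
  shows "set_integrable M S (\<lambda>v. \<Sum>i\<in>I. g i v)"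
    and "(LINT v:S|M. \<Sum>i\<in>I. g i v) = (\<Sum>i\<in>I. LINT v:S|M. g i v)"
  using assms unfolding set_integrable_def set_lebesgue_integral_def scaleR_sum_right
  by (simp_all only: Bochner_Integration.integrable_sum Bochner_Integration.integral_sum)

lemma integral_peak_power:
  assumes d: "continuous_on (cube L) d" and z: "\<And>k. (LINT v:cube L|lborel. d v * wave L k v) = 0"
  shows "(LINT v:cube L|lborel. of_real (peak L x0 v) ^ m * d v * wave L k v) = 0"
proof (induction m arbitrary: k)
  case 0
  show ?case using z by simp
next
  case (Suc m)
  let ?h = "\<lambda>v. complex_of_real (peak L x0 v) ^ m * d v"
  have int: "set_integrable lborel (cube L) (\<lambda>v. c * (?h v * wave L l v))" for l c
    by (intro set_integrable_cube continuous_intros continuous_on_of_real d)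
  have eq: "of_real (peak L x0 v) ^ Suc m * d v * wave L k v = 1 / 2 * (?h v * wave L k v) +
     (\<Sum>i\<in>UNIV. 1 / 12 * cis (- (pi / L * x0 $ i)) * (?h v * wave L (k + axis i 1) v)
             + 1 / 12 * cis (pi / L * x0 $ i) * (?h v * wave L (k - axis i 1) v))" for v
  proof -
    have "of_real (peak L x0 v) ^ Suc m * d v * wave L k v = ?h v * (of_real (peak L x0 v) * wave L k v)"
      by simp
    then show ?thesis unfolding peak_mult_wave by (simp only: distrib_left sum_distrib_left mult_ac)
  qed
  have Z: "(LINT v:cube L|lborel. c * (?h v * wave L l v)) = 0" for l c
    using Suc.IH[of l] by simp
  have I2: "set_integrable lborel (cube L) (\<lambda>v. 1 / 12 * cis (- (pi / L * x0 $ i)) * (?h v * wave L (k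
    + axis i 1) v)
             + 1 / 12 * cis (pi / L * x0 $ i) * (?h v * wave L (k - axis i 1) v))" for i
    by (intro set_integral_add int)
  have Z2: "(LINT v:cube L|lborel. 1 / 12 * cis (- (pi / L * x0 $ i)) * (?h v * wave L (k + axis i 1) v)
             + 1 / 12 * cis (pi / L * x0 $ i) * (?h v * wave L (k - axis i 1) v)) = 0" for i
    by (subst set_integral_add(2)[OF int int]) (simp only: Z add_0)
  have "(LINT v:cube L|lborel. 1 / 2 * (?h v * wave L k v) +
     (\<Sum>i\<in>UNIV. 1 / 12 * cis (- (pi / L * x0 $ i)) * (?h v * wave L (k + axis i 1) v)
             + 1 / 12 * cis (pi / L * x0 $ i) * (?h v * wave L (k - axis i 1) v))) = 0"
    unfolding set_integral_add(2)[OF int set_integral_sum(1)[OF finite I2]] set_integral_sum(2)[OF finite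
      I2] Z Z2
    by simp
  then show ?case unfolding eq .
qed

text \<open>If \<open>d x0\<close> were nonzero, the integrals of \<open>P ^ m * u\<close> would
  receive a positive contribution of order at least \<open>q' ^ m\<close> near \<open>x0\<close>,
  while any negative contribution is of order at most \<open>q ^ m\<close> with
  \<open>q < q'\<close>. For large \<open>m\<close> they could not vanish.\<close>

lemma cube_coeffs_zero_imp_zero:
  assumes L: "L > 0" and d: "continuous_on (cube L) d"
    and z: "\<And>k. (LINT v:cube L|lborel. d v * wave L k v) = 0"
    and x0: "x0 \<in> interior (cube L)"
  shows "d x0 = 0"
proof (rule ccontr)
  assume nz: "d x0 \<noteq> 0"
  \<comment> \<open>Rotating \<open>d\<close> by the conjugate of its value at \<open>x0\<close>
    yields a real function that is positive at \<open>x0\<close>.\<close>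
  define u where "u = (\<lambda>v. Re (d v * cnj (d x0)))"
  define P where "P = peak L x0"
  have cu: "continuous_on (cube L) u" unfolding u_def by (intro continuous_intros d)
  have cP: "continuous_on S P" for S unfolding P_def by (rule continuous_on_peak)
  have Pnn: "P v \<ge> 0" for v unfolding P_def by (rule peak_nonneg)
  have int0: "(LINT v:cube L|lborel. P v ^ m * u v) = 0" for m
  proof -
    have "(LINT v:cube L|lborel. of_real (P v) ^ m * d v * cnj (d x0)) = 0"
      using integral_peak_power[OF d z, of x0 m 0] by (simp add: P_def)
    moreover have "set_integrable lborel (cube L) (\<lambda>v. of_real (P v) ^ m * d v * cnj (d x0))"
      by (intro set_integrable_cube continuous_intros d continuous_on_of_real cP)
    ultimately have "(LINT v:cube L|lborel. Re (of_real (P v) ^ m * d v * cnj (d x0))) = 0"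
      unfolding set_lebesgue_integral_def set_integrable_def
      using integral_Re[of lborel "\<lambda>v. indicator (cube L) v *\<^sub>R (of_real (P v) ^ m * d v * cnj (d x0))"]
        by simp
    moreover have "Re (of_real (P v) ^ m * d v * cnj (d x0)) = P v ^ m * u v" for v
      unfolding u_def of_real_power[symmetric] mult.assoc by (simp del: of_real_power)
    ultimately show ?thesis by simp
  qed
  define e where "e = u x0 / 2"
  have ux0: "u x0 = (cmod (d x0))\<^sup>2" by (simp add: u_def cmod_power2) (simp add: power2_eq_square)
  have e: "e > 0" "e < u x0" using nz ux0 by (auto simp: e_def)
  obtain r0 where r0: "r0 > 0" "ball x0 r0 \<subseteq> cube L" using x0 by (meson mem_interior)
  have x0c: "x0 \<in> cube L" using x0 interior_subset by blast
  obtain r1 where r1: "r1 > 0" "\<And>v. v \<in> cube L \<Longrightarrow> dist v x0 < r1 \<Longrightarrow> dist (u v) (u x0) < u x0 - e"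
    using cu x0c e(2) unfolding continuous_on_iff by (metis diff_gt_0_iff_gt)
  define r where "r = min r0 r1"
  have r: "r > 0" using r0 r1 by (simp add: r_def)
  have ur: "u v > e" if "v \<in> ball x0 r" for v
  proof -
    have "v \<in> cube L" using that r0 by (auto simp: r_def)
    moreover have "dist v x0 < r1" using that by (auto simp: r_def dist_commute)
    ultimately have "\<bar>u v - u x0\<bar> < u x0 - e" using r1(2) by (auto simp: dist_real_def)
    then show ?thesis by linarith
  qed
  have rc: "ball x0 r \<subseteq> cube L" using r0 by (auto simp: r_def)
  have "\<exists>q. 0 \<le> q \<and> q < 1 \<and> (\<forall>v\<in>cube L - ball x0 r. P v \<le> q)"
  proof (cases "cube L - ball x0 r = {}")
    case True then show ?thesis by (intro exI[of _ 0]) auto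
  next
    case False
    have "compact (cube L - ball x0 r)" by (intro compact_diff) auto
    from continuous_attains_sup[OF this False cP] obtain w where
      w: "w \<in> cube L - ball x0 r" "\<forall>v\<in>cube L - ball x0 r. P v \<le> P w" by blast
    have "w \<noteq> x0" using w(1) r by auto
    then have "P w < 1" unfolding P_def using w(1) by (intro peak_less_1 L x0) auto
    then show ?thesis using w Pnn by blast
  qed
  then obtain q where q: "0 \<le> q" "q < 1" "\<And>v. v \<in> cube L - ball x0 r \<Longrightarrow> P v \<le> q" by blast
  \<comment> \<open>A level strictly between \<open>q\<close>, the bound for the peak away from
    \<open>x0\<close>, and its value \<open>1\<close> at \<open>x0\<close>.\<close>
  define q' where "q' = (1 + q) / 2"
  have q': "q < q'" "q' < 1" "q' > 0" using q by (auto simp: q'_def)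
  have "P x0 = 1" by (simp add: P_def peak_same)
  moreover have "isCont P x0" using cP[of UNIV] by (simp add: continuous_on_eq_continuous_at)
  ultimately obtain s where s: "s > 0" "\<And>v. dist v x0 < s \<Longrightarrow> dist (P v) 1 < 1 - q'"
    using q'(2) unfolding continuous_at_eps_delta by (metis diff_gt_0_iff_gt)
  define t where "t = min r s"
  have t: "t > 0" using r s by (simp add: t_def)
  have Pt: "P v > q'" if "v \<in> ball x0 t" for v
    using s(2)[of v] that by (auto simp: t_def dist_commute dist_real_def)
  have tr: "ball x0 t \<subseteq> ball x0 r" by (auto simp: t_def)
  obtain M where M: "\<And>v. v \<in> cube L \<Longrightarrow> \<bar>u v\<bar> \<le> M" "M > 0"
  proof -
    have "bounded (u ` cube L)" by (intro compact_imp_bounded compact_continuous_image cu) simp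
    then obtain M where "\<forall>y\<in>u ` cube L. norm y \<le> M" by (auto simp: bounded_iff)
    then show thesis by (intro that[of "\<bar>M\<bar> + 1"]) force+
  qed
  define V where "V = measure lborel (ball x0 t)"
  have V: "V > 0" unfolding V_def using t content_ball_pos[of t x0] by simp
  have fin: "emeasure lborel (ball x0 t) < \<infinity>" by (rule emeasure_lborel_ball_finite)
  \<comment> \<open>Three regions: on the inner ball both the peak and \<open>u\<close> are bounded
    below, on the shell up to radius \<open>r\<close> the integrand is nonnegative, and outside it
    is at least \<open>- M * q ^ m\<close>.\<close>
  have key: "e * V * q' ^ m \<le> M * (2 * L) ^ 3 * q ^ m" for m
  proof -
    have "(LINT v:cube L|lborel. e * q' ^ m * indicator (ball x0 t) v - M * q ^ m)
      \<le> (LINT v:cube L|lborel. P v ^ m * u v)"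
    proof (rule set_integral_mono)
      show "set_integrable lborel (cube L) (\<lambda>v. e * q' ^ m * indicator (ball x0 t) v - M * q ^ m)"
      proof (rule set_integral_diff(1))
        have "integrable lborel (\<lambda>v. indicator (cube L \<inter> ball x0 t) v * (e * q' ^ m))"
          using order.strict_trans1[OF emeasure_mono fin, of "cube L \<inter> ball x0 t"]
          by (intro integrable_mult_left integrable_real_indicator) auto
        then show "set_integrable lborel (cube L) (\<lambda>v. e * q' ^ m * indicator (ball x0 t) v)"
          by (simp add: set_integrable_def indicator_inter_arith mult_ac)
        show "set_integrable lborel (cube L) (\<lambda>v. M * q ^ m)"
          by (intro set_integrable_cube continuous_on_const)
      qed
      show "set_integrable lborel (cube L) (\<lambda>v. P v ^ m * u v)"
        by (intro set_integrable_cube continuous_intros cu cP)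
      fix v assume v: "v \<in> cube L"
      have Mq: "0 \<le> M * q ^ m" using M q by simp
      consider "v \<in> ball x0 t" | "v \<in> ball x0 r" "v \<notin> ball x0 t" | "v \<notin> ball x0 r" by blast
      then show "e * q' ^ m * indicator (ball x0 t) v - M * q ^ m \<le> P v ^ m * u v"
      proof cases
        case 1
        have "q' ^ m * e \<le> P v ^ m * u v"
          using Pt[OF 1] ur[of v] 1 tr q' e Pnn by (intro mult_mono power_mono) (auto simp: less_imp_le)
        then show ?thesis using 1 Mq by (simp add: mult.commute)
      next
        case 2
        have "0 \<le> P v ^ m * u v" using ur[OF 2(1)] e Pnn[of v] by simp
        then show ?thesis using 2 Mq by simp
      next
        case 3
        have "\<bar>P v ^ m * u v\<bar> \<le> q ^ m * M"
          unfolding abs_mult using q(3)[of v] v 3 M(1)[OF v] Pnn[of v] q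
          by (intro mult_mono) (auto simp: power_mono)
        moreover have "v \<notin> ball x0 t" using 3 tr by blast
        ultimately show ?thesis by (simp add: mult.commute)
      qed
    qed
    also have "\<dots> = 0" by (rule int0)
    also have "(LINT v:cube L|lborel. e * q' ^ m * indicator (ball x0 t) v - M * q ^ m)
      = e * q' ^ m * V - (2 * L) ^ 3 * (M * q ^ m)"
    proof -
      have i1: "integrable lborel (\<lambda>v. indicator (ball x0 t) v * (e * q' ^ m))"
        using fin by (intro integrable_mult_left integrable_real_indicator) auto
      have i2: "integrable lborel (\<lambda>v. indicator (cube L) v * (M * q ^ m))"
        using emeasure_cube_finite by (intro integrable_mult_left integrable_real_indicator) auto
      have "indicator (cube L) v *\<^sub>R (e * q' ^ m * indicator (ball x0 t) v - M * q ^ m) = 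
         indicator (ball x0 t) v * (e * q' ^ m) - indicator (cube L) v * (M * q ^ m)" for v
        using tr rc by (auto simp: indicator_def)
      then have "(LINT v:cube L|lborel. e * q' ^ m * indicator (ball x0 t) v - M * q ^ m) = 
         (LINT v|lborel. indicator (ball x0 t) v * (e * q' ^ m)) - (LINT v|lborel. indicator (cube L) v *
           (M * q ^ m))"
        unfolding set_lebesgue_integral_def using i1 i2 by simp
      also have "\<dots> = V * (e * q' ^ m) - (2 * L) ^ 3 * (M * q ^ m)"
        using L by (simp add: V_def measure_cube)
      finally show ?thesis by (simp add: mult_ac)
    qed
    finally show ?thesis by (simp add: mult_ac)
  qed
  have "(\<lambda>m. (q / q') ^ m) \<longlonglongrightarrow> 0" using q q' by (intro LIMSEQ_realpow_zero) auto
  moreover have "e * V / (M * (2 * L) ^ 3) > 0" using e V M L by simp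
  ultimately have "\<forall>\<^sub>F m in sequentially. (q / q') ^ m < e * V / (M * (2 * L) ^ 3)"
    by (rule order_tendstoD)
  then obtain m where "(q / q') ^ m < e * V / (M * (2 * L) ^ 3)" by (auto simp: eventually_sequentially)
  then have "q ^ m * (M * (2 * L) ^ 3) < e * V * q' ^ m"
    using M L q' by (simp add: power_divide field_simps)
  then show False using key[of m] by (simp add: mult_ac)
qed

text \<open>Termwise integration and orthogonality of the waves show that \<open>h\<close> and its
  series have the same coefficients, so the continuous difference is orthogonal to every
  wave.\<close>

lemma fourier_inversion_cube:
  assumes L: "L > 0" and h: "continuous_on (cube L) h"
    and a: "\<And>k. a k = (LINT u:cube L|lborel. h u * wave L (- k) u) / of_real ((2 * L) ^ 3)"
    and sm: "(\<lambda>k. cmod (a k)) summable_on UNIV"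
    and v: "v \<in> interior (cube L)"
  shows "h v = wseries L a (\<lambda>k. k) v"
proof -
  define d where "d = (\<lambda>v. h v - wseries L a (\<lambda>k. k) v)"
  have cd: "continuous_on (cube L) d" unfolding d_def by (intro continuous_intros h continuous_on_wseries sm)
  have "(LINT v:cube L|lborel. d v * wave L k v) = 0" for k
  proof -
    have iw: "integrable lborel (\<lambda>u. indicator (cube L) u *\<^sub>R wave L k u)"
      using set_integrable_cube[OF continuous_on_wave] by (simp add: set_integrable_def)
    have "((\<lambda>l. a l * (LINT u|lborel. (indicator (cube L) u *\<^sub>R wave L k u) * wave L l u)) has_sum
        (LINT u|lborel. (indicator (cube L) u *\<^sub>R wave L k u) * wseries L a (\<lambda>k. k) u)) UNIV"
      by (rule has_sum_integral_wseries[OF iw sm])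
    moreover have "(LINT u|lborel. (indicator (cube L) u *\<^sub>R wave L k u) * wave L l u) = (if l
      = - k then of_real ((2 * L) ^ 3) else 0)" for l
    proof (cases "l = - k")
      case True
      have "(indicator (cube L) u *\<^sub>R wave L k u) * wave L l u = of_real (indicator (cube L) u)" for u
        using True by (simp add: wave_add[symmetric] scaleR_conv_of_real mult.assoc)
      then show ?thesis using True measure_cube[of L] L by simp
    next
      case False
      have "(LINT u|lborel. (indicator (cube L) u *\<^sub>R wave L k u) * wave L l u)
        = (LINT v:cube L|lborel. wave L (k + l) v)"
        by (simp add: set_lebesgue_integral_def wave_add)
      also have "\<dots> = 0" using False by (intro integral_wave_cube L) (auto simp: add_eq_0_iff)
      finally show ?thesis using False by simp
    qed
    ultimately have "((\<lambda>l. a l * (if l = - k then of_real ((2 * L) ^ 3) else 0)) has_sum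
        (LINT u|lborel. (indicator (cube L) u *\<^sub>R wave L k u) * wseries L a (\<lambda>k. k) u)) UNIV" by simp
    moreover have "((\<lambda>l. a l * (if l = - k then of_real ((2 * L) ^ 3) else 0))
      has_sum (a (- k) * of_real ((2 * L) ^ 3))) UNIV"
      by (rule has_sum_finite_neutralI[where B="{- k}"]) auto
    ultimately have "(LINT u|lborel. (indicator (cube L) u *\<^sub>R wave L k u) * wseries L a (\<lambda>k. k) u)
      = a (- k) * of_real ((2 * L) ^ 3)"
      by (rule has_sum_unique)
    also have "\<dots> = (LINT u:cube L|lborel. h u * wave L k u)"
      using L by (simp add: a)
    finally have "(LINT u:cube L|lborel. wseries L a (\<lambda>k. k) u * wave L k u)
      = (LINT u:cube L|lborel. h u * wave L k u)"
      by (simp add: set_lebesgue_integral_def mult.commute)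
    moreover have "(LINT v:cube L|lborel. d v * wave L k v)
      = (LINT u:cube L|lborel. h u * wave L k u) - (LINT u:cube L|lborel. wseries L a (\<lambda>k. k) u * wave L k u)"
      unfolding d_def left_diff_distrib
      by (rule set_integral_diff(2); intro set_integrable_cube continuous_intros h continuous_on_wseries sm)
    ultimately show ?thesis by simp
  qed
  from cube_coeffs_zero_imp_zero[OF L cd this v] show ?thesis by (simp add: d_def)
qed

section \<open>Lattice sums\<close>

definition rweight :: "real^3 \<Rightarrow> real" where
  "rweight x = 1 + norm x"

lemma rweight_ge_1 [simp]: "rweight x \<ge> 1" by (simp add: rweight_def)
lemma rweight_pos [simp]: "rweight x > 0" using rweight_ge_1[of x] by linarith
lemma rweight_nonneg [simp]: "rweight x \<ge> 0" using rweight_ge_1[of x] by linarith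
lemma rweight_nz [simp]: "rweight x \<noteq> 0" using rweight_pos[of x] by linarith

lemma rweight_add_le: "rweight (x + y) \<le> rweight x * rweight y"
proof -
  have "norm (x + y) \<le> norm x + norm y" by (rule norm_triangle_ineq)
  moreover have "norm x * norm y \<ge> 0" by simp
  ultimately show ?thesis unfolding rweight_def distrib_left distrib_right mult_1 mult_1_right by linarith
qed

lemma borel_measurable_rweight [measurable]: "rweight \<in> borel_measurable borel"
  unfolding rweight_def by measurable

text \<open>Dyadic shells: where \<open>rweight\<close> lies between \<open>2 ^ n\<close> and
  \<open>2 ^ Suc n\<close>, the integrand is at most \<open>(1 / 16) ^ n\<close> and the point lies
  in a cube of volume \<open>64 * 8 ^ n\<close>, which leaves a convergent geometric series.\<close>

lemma integrable_rweight_powr: "integrable lborel (\<lambda>x. rweight x powr (- 4))"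
proof (rule integrableI_bounded)
  have le: "ennreal (norm (rweight x powr (- 4)))
    \<le> (\<Sum>n. ennreal ((1 / 16) ^ n) * indicator (cube (2 ^ Suc n)) x)" for x
  proof -
    obtain n where n: "2 ^ n \<le> rweight x" "rweight x < 2 ^ Suc n"
    proof -
      obtain N where N: "rweight x < 2 ^ N" using real_arch_pow[of 2 "rweight x"] by auto
      define M where "M = (LEAST N. rweight x < 2 ^ N)"
      have M: "rweight x < 2 ^ M" unfolding M_def using N by (rule LeastI)
      have "M \<noteq> 0" using M rweight_ge_1[of x] by (cases M) auto
      then obtain n where "M = Suc n" by (cases M) auto
      moreover have "\<not> rweight x < 2 ^ n" using not_less_Least[of n "\<lambda>N. rweight x < 2 ^ N"] \<open>M = Suc n\<close>
        by (simp add: M_def)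
      ultimately show thesis using M that[of n] by (simp add: not_less)
    qed
    have "x \<in> cube (2 ^ Suc n)"
      unfolding mem_cube
    proof
      show "\<bar>x $ i\<bar> \<le> 2 ^ Suc n" for i
        using n(2) component_le_norm_cart[of x i] unfolding rweight_def by linarith
    qed
    moreover have "rweight x powr (- 4) \<le> (1 / 16) ^ n"
    proof -
      have "rweight x powr (- 4) \<le> (2 ^ n) powr (- 4)" using n(1) by (intro powr_mono2') auto
      also have "\<dots> = (1 / 16) ^ n" 
      proof -
        have "(2 ^ n :: real) ^ 4 = 16 ^ n" by (simp add: power_mult[symmetric] mult.commute[of n])
          (simp add: power_mult)
        then show ?thesis by (simp add: powr_minus power_one_over inverse_eq_divide)
      qed
      finally show ?thesis .
    qed
    ultimately have "ennreal (norm (rweight x powr (- 4)))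
      \<le> ennreal ((1 / 16) ^ n) * indicator (cube (2 ^ Suc n)) x"
      by (simp add: ennreal_leI)
    also have "\<dots> \<le> (\<Sum>n. ennreal ((1 / 16) ^ n) * indicator (cube (2 ^ Suc n)) x)"
    proof -
      define T :: "nat \<Rightarrow> ennreal" where "T = (\<lambda>n. ennreal ((1 / 16) ^ n) * indicator (cube (2 ^ Suc n)) x)"
      have "T n \<le> suminf T" using sum_le_suminf[OF summableI, of "{n}" T] by simp
      then show ?thesis by (simp only: T_def)
    qed
    finally show ?thesis .
  qed
  have "(\<integral>\<^sup>+x. ennreal (norm (rweight x powr (- 4))) \<partial>lborel)
    \<le> (\<integral>\<^sup>+x. (\<Sum>n. ennreal ((1 / 16) ^ n) * indicator (cube (2 ^ Suc n)) x) \<partial>lborel)"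
    by (rule nn_integral_mono) (rule le)
  also have "\<dots> = (\<Sum>n. \<integral>\<^sup>+x. ennreal ((1 / 16) ^ n) * indicator (cube (2 ^ Suc n)) x \<partial>lborel)"
    by (rule nn_integral_suminf) measurable
  also have "\<dots> = (\<Sum>n. ennreal (64 * (1 / 2) ^ n))"
  proof (rule suminf_cong)
    fix n
    have "emeasure lborel (cube (2 ^ Suc n)) = ennreal ((2 * 2 ^ Suc n) ^ 3)"
      using emeasure_cube_finite[of "2 ^ Suc n"] measure_cube[of "2 ^ Suc n"]
      by (simp add: emeasure_eq_ennreal_measure less_top)
    then have "(\<integral>\<^sup>+x. ennreal ((1 / 16) ^ n) * indicator (cube (2 ^ Suc n)) x \<partial>lborel)
      = ennreal ((1 / 16) ^ n * (2 * 2 ^ Suc n) ^ 3)"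
      by (simp add: nn_integral_cmult ennreal_mult del: power_Suc)
    also have "(1 / 16) ^ n * (2 * 2 ^ Suc n) ^ 3 = 64 * (1 / 2 :: real) ^ n"
    proof -
      have "(2 * 2 ^ Suc n) ^ 3 = 64 * (8 :: real) ^ n"
        by (simp add: power_mult_distrib power_mult[symmetric] mult.commute[of n]) (simp add: power_mult)
      then show ?thesis by (simp add: power_mult_distrib[symmetric])
    qed
    finally show "(\<integral>\<^sup>+x. ennreal ((1 / 16) ^ n) * indicator (cube (2 ^ Suc n)) x \<partial>lborel)
      = ennreal (64 * (1 / 2) ^ n)" .
  qed
  also have "\<dots> < \<infinity>"
  proof -
    have "summable (\<lambda>n. 64 * (1 / 2 :: real) ^ n)" by (intro summable_mult summable_geometric) auto
    then show ?thesis by (subst suminf_ennreal2) auto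
  qed
  finally show "(\<integral>\<^sup>+x. ennreal (norm (rweight x powr (- 4))) \<partial>lborel) < \<infinity>" .
qed measurable

section \<open>Comparison of lattice sums with integrals\<close>

definition cell :: "real \<Rightarrow> int^3 \<Rightarrow> (real^3) set" where
  "cell c k = {y. \<forall>i. c * real_of_int (k $ i) < y $ i \<and> y $ i < c * real_of_int (k $ i) + c}"

lemma cell_eq_box: "cell c k = box (c *\<^sub>R real_vec k) (c *\<^sub>R real_vec k + (\<chi> i. c))"
  by (auto simp: cell_def mem_box_cart)

lemma sets_cell [measurable]: "cell c k \<in> sets borel"
  by (simp add: cell_eq_box)

lemma measure_cell: "c > 0 \<Longrightarrow> measure lborel (cell c k) = c ^ 3"
  unfolding cell_eq_box
  by (subst measure_lborel_box_eq) (auto simp: Basis3 inner_axis prod.reindex inj_on_def axis_eq_axis)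

lemma emeasure_cell: "c > 0 \<Longrightarrow> emeasure lborel (cell c k) = ennreal (c ^ 3)"
  using measure_cell[of c k] emeasure_lborel_box_finite[of "c *\<^sub>R real_vec k" "c *\<^sub>R real_vec k + (\<chi> i. c)"]
  by (simp add: emeasure_eq_ennreal_measure less_top cell_eq_box)

lemma cell_disjoint:
  assumes c: "c > 0" and y: "y \<in> cell c k" "y \<in> cell c l" shows "k = l"
proof (rule vec_eq_iff[THEN iffD2], rule allI)
  fix i
  have "c * real_of_int (k $ i) < c * (real_of_int (l $ i) + 1)" "c * real_of_int (l $ i) < c *
    (real_of_int (k $ i) + 1)"
    using y unfolding cell_def distrib_left by (auto intro: less_trans)
  then have "real_of_int (k $ i) < real_of_int (l $ i) + 1" "real_of_int (l $ i) < real_of_int (k $ i) + 1"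
    using c by simp_all
  then show "k $ i = l $ i" by linarith
qed

lemma sum_indicator_cell_le:
  assumes "c > 0" "finite A"
  shows "(\<Sum>k\<in>A. indicator (cell c k) y :: real) \<le> 1"
proof (cases "\<exists>l\<in>A. y \<in> cell c l")
  case True
  then obtain l where l: "l \<in> A" "y \<in> cell c l" by blast
  have "indicator (cell c k) y = (if k = l then 1 else 0 :: real)" for k
  proof -
    have "y \<in> cell c k \<longleftrightarrow> k = l" using cell_disjoint[OF assms(1) _ l(2), of k] l(2) by blast
    then show ?thesis by (simp add: indicator_def)
  qed
  then show ?thesis using assms(2) l by simp
next
  case False
  then have "(\<Sum>k\<in>A. indicator (cell c k) y :: real) = 0" by (intro sum.neutral) (auto simp: indicator_def)
  then show ?thesis by simp
qed

text \<open>Each lattice value is compared with the average of \<open>G\<close> over its own cell.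
  The cells are disjoint, so these averages add up to at most the full integral divided by the cell
  volume.\<close>

lemma lattice_sum_le_integral:
  fixes G :: "real^3 \<Rightarrow> real"
  assumes c: "c > 0" and A: "finite A" and G: "integrable lborel G" "\<And>x. G x \<ge> 0" and B: "B \<ge> 0"
    and cmp: "\<And>k y. y \<in> cell c k \<Longrightarrow> G (c *\<^sub>R real_vec k) \<le> B * G y"
  shows "(\<Sum>k\<in>A. G (c *\<^sub>R real_vec k)) \<le> B / c ^ 3 * (LINT x|lborel. G x)"
proof -
  have ii: "integrable lborel (\<lambda>y. indicator (cell c k) y * G y)" for k
    using integrable_mult_indicator[OF _ G(1), of "cell c k"] by simp
  have "c ^ 3 * (\<Sum>k\<in>A. G (c *\<^sub>R real_vec k)) = (\<Sum>k\<in>A. LINT y|lborel. indicator (cell c k) y * G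
    (c *\<^sub>R real_vec k))"
    using c by (simp add: sum_distrib_left measure_cell)
  also have "\<dots> \<le> (\<Sum>k\<in>A. LINT y|lborel. B * (indicator (cell c k) y * G y))"
  proof (intro sum_mono integral_mono)
    fix k
    show "integrable lborel (\<lambda>y. indicator (cell c k) y * G (c *\<^sub>R real_vec k))"
      using c by (intro integrable_mult_left integrable_real_indicator) (auto simp: emeasure_cell)
    show "integrable lborel (\<lambda>y. B * (indicator (cell c k) y * G y))" using ii by simp
    show "indicator (cell c k) y * G (c *\<^sub>R real_vec k) \<le> B * (indicator (cell c k) y * G y)" for y
      using cmp[of y k] by (auto simp: indicator_def)
  qed
  also have "\<dots> = B * (LINT y|lborel. (\<Sum>k\<in>A. indicator (cell c k) y) * G y)"
    using ii by (simp add: sum_distrib_right sum_distrib_left)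
  also have "\<dots> \<le> B * (LINT y|lborel. G y)"
  proof (intro mult_left_mono integral_mono B G(1))
    show "integrable lborel (\<lambda>y. (\<Sum>k\<in>A. indicator (cell c k) y) * G y)"
      unfolding sum_distrib_right by (intro Bochner_Integration.integrable_sum ii)
    show "(\<Sum>k\<in>A. indicator (cell c k) y) * G y \<le> G y" for y
      using mult_right_mono[OF sum_indicator_cell_le[OF c A, of y] G(2)[of y]] by simp
  qed
  finally show ?thesis using c by (simp add: field_simps)
qed

lemma cell_dist: 
  assumes "c > 0" "y \<in> cell c k"
  shows "norm (c *\<^sub>R real_vec k - y) \<le> 2 * c"
proof -
  obtain i where "norm (c *\<^sub>R real_vec k - y) \<le> sqrt 3 * \<bar>(c *\<^sub>R real_vec k - y) $ i\<bar>"
    using norm_le_max_component by blast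
  also have "\<dots> \<le> 2 * c"
  proof (rule mult_mono)
    show "sqrt 3 \<le> 2" using real_sqrt_le_mono[of 3 4] by simp
    have "c * real_of_int (k $ i) < y $ i" "y $ i < c * real_of_int (k $ i) + c"
      using assms by (auto simp: cell_def)
    then show "\<bar>(c *\<^sub>R real_vec k - y) $ i\<bar> \<le> c" by simp
  qed auto
  finally show ?thesis .
qed

text \<open>The point is uniformity in the shift \<open>x\<close>: \<open>rweight\<close> is
  submultiplicative and cells have bounded diameter, so the sum is compared with a
  translation-invariant integral.\<close>

lemma lattice_sum_rweight:
  assumes c: "c > 0"
  shows "\<exists>D>0. \<forall>x A. finite A \<longrightarrow> (\<Sum>k\<in>A. rweight (c *\<^sub>R real_vec k - x) powr (- 4)) \<le> D"
proof -
  define I where "I = (LINT x|lborel. rweight x powr (- 4))"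
  have I: "I \<ge> 0" unfolding I_def by simp
  have "(\<Sum>k\<in>A. rweight (c *\<^sub>R real_vec k - x) powr (- 4)) \<le> (1 + 2 * c) powr 4 / c ^ 3 * I"
    if A: "finite A" for x A
  proof -
    have tr: "lborel = distr lborel borel (\<lambda>y. - x + y)" by (rule lborel_distr_plus[symmetric])
    have int: "integrable lborel (\<lambda>y. rweight (y - x) powr (- 4))"
      using integrable_rweight_powr by (subst (asm) tr, subst (asm) integrable_distr_eq) auto
    have I: "I = (LINT y|lborel. rweight (y - x) powr (- 4))"
      unfolding I_def by (subst tr, subst integral_distr) auto
    show ?thesis unfolding I
    proof (rule lattice_sum_le_integral[OF c A int])
      fix k y assume y: "y \<in> cell c k"
      have "rweight (y - x) = rweight ((c *\<^sub>R real_vec k - x) + (y - c *\<^sub>R real_vec k))" by simp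
      also have "\<dots> \<le> rweight (c *\<^sub>R real_vec k - x) * rweight (y - c *\<^sub>R real_vec k)" by (rule rweight_add_le)
      also have "\<dots> \<le> rweight (c *\<^sub>R real_vec k - x) * (1 + 2 * c)"
        using cell_dist[OF c y] by (intro mult_left_mono) (auto simp: rweight_def norm_minus_commute)
      finally have "rweight (y - x) / (1 + 2 * c) \<le> rweight (c *\<^sub>R real_vec k - x)" using c
        by (simp add: divide_le_eq)
      then have "rweight (c *\<^sub>R real_vec k - x) powr (- 4) \<le> (rweight (y - x) / (1 + 2 * c)) powr (- 4)"
        using c by (intro powr_mono2') auto
      also have "\<dots> = (1 + 2 * c) powr 4 * rweight (y - x) powr (- 4)"
        using c by (simp add: powr_divide powr_minus field_simps)
      finally show "rweight (c *\<^sub>R real_vec k - x) powr (- 4)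
        \<le> (1 + 2 * c) powr 4 * rweight (y - x) powr (- 4)" .
    qed auto
  qed
  note bound = this
  have "0 \<le> (1 + 2 * c) powr 4 / c ^ 3 * I" using I c by simp
  then show ?thesis
    using bound by (intro exI[of _ "(1 + 2 * c) powr 4 / c ^ 3 * I + 1"] conjI allI impI)
      (fastforce intro: add_increasing2)+
qed

section \<open>Cutoff functions with rapidly decaying transform\<close>

text \<open>The Fourier integral without normalising factor. Unlike
  \<open>fourier_transform\<close>, which is determined only almost everywhere, it has definite
  values and can be sampled on a lattice.\<close>

definition FT :: "(real^3 \<Rightarrow> complex) \<Rightarrow> real^3 \<Rightarrow> complex" where
  "FT f \<xi> = (LINT x|lborel. f x * cis (- (x \<bullet> \<xi>)))"

lemma borel_measurable_cis [measurable]: "cis \<in> borel_measurable borel"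
  by (intro borel_measurable_continuous_onI continuous_intros)

lemma integrable_cube_support:
  fixes f :: "real^3 \<Rightarrow> complex"
  assumes f: "continuous_on UNIV f" and s: "\<And>x. x \<notin> cube s \<Longrightarrow> f x = 0"
  shows "integrable lborel f"
proof -
  have "integrable lborel (\<lambda>x. indicator (cube s) x *\<^sub>R f x)"
    using set_integrable_cube[OF continuous_on_subset[OF f]] by (auto simp: set_integrable_def)
  also have "(\<lambda>x. indicator (cube s) x *\<^sub>R f x) = f" using s by (auto simp: indicator_def)
  finally show ?thesis .
qed

lemma norm_integral_interval_le:
  fixes h :: "real \<Rightarrow> complex"
  assumes b: "b > 0" and h: "\<And>t. cmod (h t) \<le> 1"
  shows "cmod (LINT t:{-b..b}|lborel. h t) \<le> 2 * b"
proof -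
  have "cmod (LINT t:{-b..b}|lborel. h t) \<le> (LINT t|lborel. indicator {-b..b} t)"
    unfolding set_lebesgue_integral_def
  proof (rule norm_integral_dominated)
    show "integrable lborel (indicator {-b..b} :: real \<Rightarrow> real)"
      by (auto intro!: integrable_real_indicator simp: emeasure_lborel_Icc_eq)
  qed (use h in \<open>auto simp: indicator_def\<close>)
  also have "\<dots> = 2 * b" using b by simp
  finally show ?thesis .
qed

text \<open>The gain of one averaging: the trivial bound for small \<open>w\<close> and the
  oscillation bound for large \<open>w\<close>, merged into one factor of first-order decay.\<close>

lemma norm_integral_cis_le:
  assumes b: "b > 0"
  shows "cmod (LINT t:{-b..b}|lborel. cis (w * t)) / (2 * b) \<le> max 1 (1 / b) / max 1 \<bar>w\<bar>"
proof (cases "\<bar>w\<bar> \<le> 1")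
  case True
  have "cmod (LINT t:{-b..b}|lborel. cis (w * t)) \<le> 2 * b"
    using b by (rule norm_integral_interval_le) simp
  then have "cmod (LINT t:{-b..b}|lborel. cis (w * t)) / (2 * b) \<le> 1" using b by simp
  then show ?thesis using True by simp
next
  case False
  then have w: "w \<noteq> 0" by auto
  have "(LINT t:{-b..b}|lborel. cis (w * t)) = cis (w * b) / (\<i> * w) - cis (w * (- b)) / (\<i> * w)"
    using b by (intro integral_cis[OF w]) simp
  also have "cmod \<dots> \<le> 1 / \<bar>w\<bar> + 1 / \<bar>w\<bar>"
    by (rule order.trans[OF norm_triangle_ineq4]) (simp add: norm_divide norm_mult)
  finally have "cmod (LINT t:{-b..b}|lborel. cis (w * t)) / (2 * b) \<le> (1 / \<bar>w\<bar> + 1 / \<bar>w\<bar>) / (2 * b)"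
    using b by (intro divide_right_mono) auto
  also have "\<dots> = (1 / b) / \<bar>w\<bar>" using b w by (simp add: field_simps)
  also have "\<dots> \<le> max 1 (1 / b) / max 1 \<bar>w\<bar>"
    using False by (intro frac_le) auto
  finally show ?thesis .
qed

text \<open>Convolution with a normalised box kernel in direction \<open>i\<close>. It multiplies
  the transform by a cardinal sine, at the price of widening the support by
  \<open>b\<close>.\<close>

definition axis_average :: "3 \<Rightarrow> real \<Rightarrow> (real^3 \<Rightarrow> complex) \<Rightarrow> real^3 \<Rightarrow> complex" where
  "axis_average i b h x = (LINT t:{-b..b}|lborel. h (x + t *\<^sub>R axis i 1)) / (2 * b)"

lemma axis_shift_mem_cube:
  assumes "\<bar>t\<bar> \<le> b" "x \<in> cube r" shows "x + t *\<^sub>R axis i 1 \<in> cube (r + b)"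
  unfolding mem_cube
proof
  fix j
  have "\<bar>x $ j\<bar> \<le> r" using assms by (auto simp: mem_cube)
  then show "\<bar>(x + t *\<^sub>R axis i 1) $ j\<bar> \<le> r + b" using assms(1) by (auto simp: axis_def)
qed

lemma continuous_axis_average:
  fixes h :: "real^3 \<Rightarrow> complex"
  assumes h: "continuous_on UNIV h"
  shows "continuous_on UNIV (axis_average i b h)"
proof -
  have c: "continuous_on (UNIV \<times> cbox (-b) b) (\<lambda>(x, t). h (x + t *\<^sub>R axis i 1))"
    unfolding case_prod_unfold
    by (rule continuous_on_compose2[OF h]) (auto intro!: continuous_intros)
  have eq: "axis_average i b h = (\<lambda>x. integral (cbox (-b) b) (\<lambda>t. h (x + t *\<^sub>R axis i 1)) / (2 * b))"
  proof
    fix x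
    have "set_integrable lborel {-b..b} (\<lambda>t. h (x + t *\<^sub>R axis i 1))"
      unfolding set_integrable_def
      by (rule borel_integrable_compact) (auto intro!: continuous_on_compose2[OF h] continuous_intros)
    from set_borel_integral_eq_integral(2)[OF this]
    show "axis_average i b h x = integral (cbox (-b) b) (\<lambda>t. h (x + t *\<^sub>R axis i 1)) / (2 * b)"
      by (simp add: axis_average_def)
  qed
  show ?thesis unfolding eq divide_inverse
    by (intro continuous_on_mult_right integral_continuous_on_param c)
qed

text \<open>A shift by \<open>t\<close> along the axis becomes the factor
  \<open>cis (\<xi> $ i * t)\<close> of the transform. Fubini applies because the integrand is
  bounded and lives on \<open>cube (s + b) \<times> {-b..b}\<close>.\<close>

lemma FT_axis_average:
  fixes h :: "real^3 \<Rightarrow> complex"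
  assumes h: "continuous_on UNIV h" "\<And>x. cmod (h x) \<le> 1" "\<And>x. x \<notin> cube s \<Longrightarrow> h x = 0" and b: "b > 0"
  shows "FT (axis_average i b h) \<xi> = FT h \<xi> * ((LINT t:{-b..b}|lborel. cis (\<xi> $ i * t)) / (2 * b))"
proof -
  define e where "e = (axis i 1 :: real^3)"
  have [measurable]: "h \<in> borel_measurable borel" using h(1) by (rule borel_measurable_continuous_onI)
  define f where "f = (\<lambda>x t. indicator {-b..b} t *\<^sub>R (h (x + t *\<^sub>R e) * cis (- (x \<bullet> \<xi>))))"
  have int: "integrable (lborel \<Otimes>\<^sub>M lborel) (case_prod f)"
  proof (rule Bochner_Integration.integrable_bound)
    have "emeasure (lborel \<Otimes>\<^sub>M lborel) (cube (s + b) \<times> {-b..b}) < \<infinity>"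
      using b emeasure_cube_finite[of "s + b"]
        by (subst lborel.emeasure_pair_measure_Times) (auto simp: ennreal_mult_less_top)
    then show "integrable (lborel \<Otimes>\<^sub>M lborel) (\<lambda>z. indicator (cube (s + b) \<times> {-b..b}) z :: real)"
      by (intro integrable_real_indicator) auto
    show "case_prod f \<in> borel_measurable (lborel \<Otimes>\<^sub>M lborel)"
      unfolding f_def by measurable
    have "cmod (f x t) \<le> indicator (cube (s + b) \<times> {-b..b}) (x, t)" for x t
    proof (cases "t \<in> {-b..b} \<and> h (x + t *\<^sub>R e) \<noteq> 0")
      case True
      then have "x + t *\<^sub>R e \<in> cube s" using h(3) by blast
      then have "(x + t *\<^sub>R e) + (- t) *\<^sub>R e \<in> cube (s + b)" unfolding e_def using True
        by (intro axis_shift_mem_cube) auto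
      then show ?thesis using True h(2) by (simp add: f_def norm_mult)
    qed (auto simp: f_def)
    then show "AE z in lborel \<Otimes>\<^sub>M lborel. norm (case_prod f z)
      \<le> norm (indicator (cube (s + b) \<times> {-b..b}) z :: real)"
      by (intro AE_I2) (auto split: prod.split)
  qed
  have "FT (axis_average i b h) \<xi> = (LINT x|lborel. (LINT t|lborel. f x t) / (2 * b))"
    unfolding FT_def axis_average_def f_def set_lebesgue_integral_def e_def
    by (intro Bochner_Integration.integral_cong)
      (simp_all flip: scaleR_scaleR add: scaleR_conv_of_real mult.assoc[symmetric])
  also have "\<dots> = (LINT x|lborel. LINT t|lborel. f x t) / (2 * b)" by simp
  also have "(LINT x|lborel. LINT t|lborel. f x t) = (LINT t|lborel. LINT x|lborel. f x t)"
    using lborel_pair.Fubini_integral[OF int] by simp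
  also have "(\<lambda>t. LINT x|lborel. f x t) = (\<lambda>t. indicator {-b..b} t *\<^sub>R cis (\<xi> $ i * t) * FT h \<xi>)"
  proof
    fix t
    have tr: "lborel = distr lborel borel (\<lambda>x. - t *\<^sub>R e + x)" by (rule lborel_distr_plus[symmetric])
    have "(LINT x|lborel. h (x + t *\<^sub>R e) * cis (- (x \<bullet> \<xi>)))
      = (LINT x|lborel. h x * (cis (- (x \<bullet> \<xi>)) * cis (\<xi> $ i * t)))"
      by (subst tr, subst integral_distr) (auto simp: inner_diff_left e_def inner_axis' cis_mult mult.commute)
    also have "\<dots> = FT h \<xi> * cis (\<xi> $ i * t)"
      by (simp add: FT_def mult.assoc[symmetric])
    finally have "(LINT x|lborel. f x t) = indicator {-b..b} t *\<^sub>R (FT h \<xi> * cis (\<xi> $ i * t))"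
      unfolding f_def integral_scaleR_right by (rule arg_cong)
    then show "(LINT x|lborel. f x t) = indicator {-b..b} t *\<^sub>R cis (\<xi> $ i * t) * FT h \<xi>"
      by (simp add: scaleR_conv_of_real mult_ac)
  qed
  finally show ?thesis
    by (simp add: set_lebesgue_integral_def mult.commute[of "FT h \<xi>"] flip: mult_scaleR_left)
qed

text \<open>Induction on the list \<open>js\<close> of averaging directions: each averaging gains
  one order of decay in its coordinate. The radii are generalised because every step consumes part
  of the transition zone. The start is a piecewise linear function of the sup norm, for which only
  boundedness of the transform is claimed.\<close>

lemma cutoff_exists_list:
  assumes "0 < r" "r < s"
  shows "\<exists>(h :: real^3 \<Rightarrow> complex) C. continuous_on UNIV h \<and> (\<forall>x. cmod (h x) \<le> 1) \<and> (\<forall>x\<in>cube r. h x = 1) \<and>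
     (\<forall>x. x \<notin> cube s \<longrightarrow> h x = 0) \<and> C \<ge> 0 \<and>
     (\<forall>\<xi>. cmod (FT h \<xi>) \<le> C * (\<Prod>i\<leftarrow>js. 1 / max 1 \<bar>\<xi> $ i\<bar>))"
  using assms
proof (induction js arbitrary: r s)
  case Nil
  define h :: "real^3 \<Rightarrow> complex" where "h = (\<lambda>x. complex_of_real (max 0 (min 1 ((s - infnorm x) / (s - r)))))"
  have inf: "infnorm x \<le> u \<longleftrightarrow> x \<in> cube u" for x :: "real^3" and u
    by (simp add: infnorm_Max Basis3 mem_cube inner_axis image_image)
  have 1: "continuous_on UNIV h" unfolding h_def using Nil by (intro continuous_intros) auto
  have 2: "cmod (h x) \<le> 1" for x unfolding h_def norm_of_real by (simp add: abs_le_iff)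
  have 3: "h x = 1" if "x \<in> cube r" for x
  proof -
    have "infnorm x \<le> r" using that inf by blast
    then have "(s - infnorm x) / (s - r) \<ge> 1" using Nil by (simp add: le_divide_eq)
    then show ?thesis by (simp add: h_def)
  qed
  have 4: "h x = 0" if "x \<notin> cube s" for x
  proof -
    have "\<not> infnorm x \<le> s" using that inf by blast
    then have "(s - infnorm x) / (s - r) \<le> 0" using Nil by (simp add: divide_le_0_iff)
    then show ?thesis by (simp add: h_def)
  qed
  have 5: "cmod (FT h \<xi>) \<le> (2 * s) ^ 3 * 1" for \<xi>
  proof -
    have "FT h \<xi> = (LINT x:cube s|lborel. h x * cis (- (x \<bullet> \<xi>)))"
      unfolding FT_def set_lebesgue_integral_def using 4
      by (intro Bochner_Integration.integral_cong) (auto simp: indicator_def)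
    also have "cmod \<dots> \<le> (2 * s) ^ 3 * 1"
      using 2 Nil by (intro set_integral_norm_bound_cube) (auto simp: norm_mult)
    finally show ?thesis .
  qed
  have "(2 * s) ^ 3 \<ge> 0" using Nil by simp
  with 1 2 3 4 5 show ?case by (intro exI[of _ h] exI[of _ "(2 * s) ^ 3"]) auto
next
  case (Cons i js)
  \<comment> \<open>One third of the transition zone is lost at the plateau, one third at the
    support, and the middle third is left to the induction hypothesis.\<close>
  define b where "b = (s - r) / 3"
  have b: "b > 0" "0 < r + b" "r + b < s - b" using Cons.prems by (auto simp: b_def field_simps)
  from Cons.IH[OF b(2,3)] obtain h :: "real^3 \<Rightarrow> complex" and C where h: "continuous_on UNIV h" "\<And>x. cmod
    (h x) \<le> 1" "\<And>x. x\<in>cube (r + b) \<Longrightarrow> h x = 1"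
    "\<And>x. x \<notin> cube (s - b) \<Longrightarrow> h x = 0" "C \<ge> 0"
    "\<And>\<xi>. cmod (FT h \<xi>) \<le> C * (\<Prod>i\<leftarrow>js. 1 / max 1 \<bar>\<xi> $ i\<bar>)" by blast
  let ?h = "axis_average i b h"
  have cst: "(LINT t:{-b..b}|lborel. c) = of_real (2 * b) * c" for c :: complex
    using b by (simp add: set_lebesgue_integral_def scaleR_conv_of_real)
  have 2: "cmod (?h x) \<le> 1" for x
  proof -
    have "cmod (LINT t:{-b..b}|lborel. h (x + t *\<^sub>R axis i 1)) \<le> 2 * b"
      using b(1) by (rule norm_integral_interval_le) (rule h(2))
    then show ?thesis using b by (simp add: axis_average_def norm_divide norm_mult)
  qed
  have 3: "?h x = 1" if "x \<in> cube r" for x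
  proof -
    have "(LINT t:{-b..b}|lborel. h (x + t *\<^sub>R axis i 1)) = (LINT t:{-b..b}|lborel. 1)"
      using that by (intro set_lebesgue_integral_cong) (auto intro!: h(3) axis_shift_mem_cube)
    then show ?thesis using b cst[of 1] by (simp add: axis_average_def)
  qed
  have 4: "?h x = 0" if "x \<notin> cube s" for x
  proof -
    have "h (x + t *\<^sub>R axis i 1) = 0" if "t \<in> {-b..b}" for t
    proof (rule h(4))
      show "x + t *\<^sub>R axis i 1 \<notin> cube (s - b)"
        using axis_shift_mem_cube[of "- t" b "x + t *\<^sub>R axis i 1" "s - b" i] that \<open>x \<notin> cube s\<close>
        by (auto simp: abs_le_iff)
    qed
    then have "(LINT t:{-b..b}|lborel. h (x + t *\<^sub>R axis i 1)) = (LINT t:{-b..b}|lborel. 0)"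
      by (intro set_lebesgue_integral_cong) auto
    then show ?thesis by (simp add: axis_average_def)
  qed
  have 5: "cmod (FT ?h \<xi>) \<le> (C * max 1 (1 / b)) * (\<Prod>i\<leftarrow>i # js. 1 / max 1 \<bar>\<xi> $ i\<bar>)" for \<xi>
  proof -
    have "cmod (FT ?h \<xi>) = cmod (FT h \<xi>) * (cmod (LINT t:{-b..b}|lborel. cis (\<xi> $ i * t)) / (2 * b))"
      using b(1) by (subst FT_axis_average[OF h(1,2,4)]) (auto simp: norm_mult norm_divide)
    also have "\<dots> \<le> (C * (\<Prod>i\<leftarrow>js. 1 / max 1 \<bar>\<xi> $ i\<bar>)) * (max 1 (1 / b) / max 1 \<bar>\<xi> $ i\<bar>)"
      using norm_integral_cis_le[OF b(1)] h(6)[of \<xi>] b(1) order.trans[OF norm_ge_zero h(6)[of \<xi>]]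
      by (intro mult_mono) auto
    finally show ?thesis by (simp add: mult_ac)
  qed
  have "C * max 1 (1 / b) \<ge> 0" using h(5) by simp
  with 2 3 4 5 continuous_axis_average[OF h(1), of i b] show ?case
    by (intro exI[of _ ?h] exI[of _ "C * max 1 (1 / b)"]) blast
qed

text \<open>With \<open>m\<close> averagings per axis, the product of the decay factors is at most
  the factor of the dominant coordinate, which is comparable to
  \<open>rweight \<xi>\<close>.\<close>

lemma cutoff_exists:
  assumes "0 < r" "r < s"
  shows "\<exists>(h :: real^3 \<Rightarrow> complex) C. continuous_on UNIV h \<and> (\<forall>x\<in>cube r. h x = 1) \<and>
     (\<forall>x. x \<notin> cube s \<longrightarrow> h x = 0) \<and> C > 0 \<and> (\<forall>\<xi>. cmod (FT h \<xi>) \<le> C / rweight \<xi> ^ m)"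
proof -
  define js :: "3 list" where "js = replicate m 1 @ replicate m 2 @ replicate m 3"
  obtain h :: "real^3 \<Rightarrow> complex" and C where h: "continuous_on UNIV h" "\<forall>x\<in>cube r. h x
    = 1" "\<forall>x. x \<notin> cube s \<longrightarrow> h x = 0" "C \<ge> 0"
    "\<And>\<xi>. cmod (FT h \<xi>) \<le> C * (\<Prod>i\<leftarrow>js. 1 / max 1 \<bar>\<xi> $ i\<bar>)" using cutoff_exists_list[OF assms, of js] by blast
  have "cmod (FT h \<xi>) \<le> ((C + 1) * 3 ^ m) / rweight \<xi> ^ m" for \<xi>
  proof -
    obtain j where j: "norm \<xi> \<le> sqrt 3 * \<bar>\<xi> $ j\<bar>" using norm_le_max_component by blast
    define p where "p = (\<lambda>i. (1 / max 1 \<bar>\<xi> $ i\<bar>) ^ m)"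
    have p: "0 \<le> p i" "p i \<le> 1" for i unfolding p_def by (auto intro!: power_le_one)
    have "(\<Prod>i\<leftarrow>js. 1 / max 1 \<bar>\<xi> $ i\<bar>) = p 1 * p 2 * p 3"
      by (simp add: js_def p_def prod_list_replicate map_replicate)
    also have "\<dots> \<le> p j"
    proof -
      have "p 1 * p 2 \<le> p 1" "p 1 * p 2 \<le> p 2" "p 1 * p 2 * p 3 \<le> p 1 * p 2" "p 1 * p 2 * p 3 \<le> p 3"
        using p by (auto intro!: mult_left_le mult_left_le_one_le mult_nonneg_nonneg mult_le_one)
      then show ?thesis using exhaust_3[of j] by auto
    qed
    also have "p j \<le> (3 / rweight \<xi>) ^ m"
    proof -
      have "sqrt 3 * \<bar>\<xi> $ j\<bar> \<le> 2 * max 1 \<bar>\<xi> $ j\<bar>"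
        using real_sqrt_le_mono[of 3 4] by (intro mult_mono) auto
      then have "rweight \<xi> \<le> 3 * max 1 \<bar>\<xi> $ j\<bar>" using j unfolding rweight_def by linarith
      then have "1 / max 1 \<bar>\<xi> $ j\<bar> \<le> 3 / rweight \<xi>" by (simp add: divide_simps)
      then show ?thesis unfolding p_def by (intro power_mono) auto
    qed
    finally have "C * (\<Prod>i\<leftarrow>js. 1 / max 1 \<bar>\<xi> $ i\<bar>) \<le> (C + 1) * (3 / rweight \<xi>) ^ m"
      using h(4) by (intro mult_mono) (auto intro!: prod_list_nonneg)
    then show ?thesis using h(5)[of \<xi>] by (simp add: power_divide)
  qed
  moreover have "(C + 1) * 3 ^ m > 0" using h(4) by simp
  ultimately show ?thesis using h(1-3) by blast
qed

section \<open>Sampling the Fourier transform on a lattice\<close>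

text \<open>An enumeration of the lattice turns unordered sums into series of extended nonnegative
  reals, which may be exchanged with integrals.\<close>

lemma ex_bij_nat_int_vec: "\<exists>\<kappa> :: nat \<Rightarrow> int^3. bij \<kappa>"
proof -
  have "inj (\<lambda>k :: int^3. (k $ 1, k $ 2, k $ 3))"
    by (auto simp: inj_on_def vec_eq_iff forall_3)
  then have "countable (UNIV :: (int^3) set)" by (rule countableI')
  moreover have "infinite (UNIV :: (int^3) set)"
  proof -
    have "inj (\<lambda>z :: int. (axis 1 z :: int^3))" by (auto simp: inj_on_def axis_eq_axis)
    then show ?thesis using infinite_UNIV_int finite_imageD finite_subset subset_UNIV by blast
  qed
  ultimately show ?thesis using bij_betw_from_nat_into by blast
qed

lemma has_sum_norm_le_suminf:
  fixes g :: "'x \<Rightarrow> complex" and \<kappa> :: "nat \<Rightarrow> 'x"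
  assumes S: "(g has_sum S) UNIV" and k: "bij \<kappa>"
  shows "ennreal (cmod S) \<le> (\<Sum>n. ennreal (cmod (g (\<kappa> n))))"
proof -
  have "((g \<circ> \<kappa>) has_sum S) UNIV"
    using S has_sum_reindex_bij_betw[OF k, of g S] by (simp add: o_def)
  then have "(\<lambda>n. g (\<kappa> n)) sums S" by (auto dest: has_sum_imp_sums simp: o_def)
  then have "(\<lambda>N. \<Sum>n<N. g (\<kappa> n)) \<longlonglongrightarrow> S" by (simp add: sums_def)
  then have "(\<lambda>N. ennreal (cmod (\<Sum>n<N. g (\<kappa> n)))) \<longlonglongrightarrow> ennreal (cmod S)"
    by (intro tendsto_ennrealI tendsto_norm)
  then show ?thesis
  proof (rule LIMSEQ_le_const2, intro exI allI impI)
    fix N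
    have "ennreal (cmod (\<Sum>n<N. g (\<kappa> n))) \<le> ennreal (\<Sum>n<N. cmod (g (\<kappa> n)))"
      by (intro ennreal_leI norm_sum)
    also have "\<dots> = (\<Sum>n<N. ennreal (cmod (g (\<kappa> n))))" by (simp add: sum_ennreal)
    also have "\<dots> \<le> (\<Sum>n. ennreal (cmod (g (\<kappa> n))))" by (rule sum_le_suminf) auto
    finally show "ennreal (cmod (\<Sum>n<N. g (\<kappa> n))) \<le> (\<Sum>n. ennreal (cmod (g (\<kappa> n))))" .
  qed
qed

lemma nn_integral_reflect:
  fixes h :: "real^3 \<Rightarrow> ennreal"
  assumes [measurable]: "h \<in> borel_measurable borel"
  shows "(\<integral>\<^sup>+z. h (x - z) \<partial>lborel) = (\<integral>\<^sup>+z. h z \<partial>lborel)"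
proof -
  have "lborel = distr lborel borel (\<lambda>z :: real^3. x - z)"
    using lborel_affine[of "-1" x] by (simp add: density_1)
  then have "(\<integral>\<^sup>+z. h z \<partial>lborel) = (\<integral>\<^sup>+z. h z \<partial>distr lborel borel (\<lambda>z. x - z))" by simp
  also have "\<dots> = (\<integral>\<^sup>+z. h (x - z) \<partial>lborel)" by (rule nn_integral_distr) measurable
  finally show ?thesis ..
qed

lemma borel_measurable_FT [measurable]:
  assumes [measurable]: "f \<in> borel_measurable borel"
  shows "FT f \<in> borel_measurable borel"
proof -
  have "(\<lambda>\<xi>. LINT x|lborel. f x * cis (- (x \<bullet> \<xi>))) \<in> borel_measurable borel"
    by measurable
  then show ?thesis by (simp add: FT_def[abs_def])
qed

abbreviation energy :: "real \<Rightarrow> (real^3 \<Rightarrow> complex) \<Rightarrow> real^3 \<Rightarrow> real" where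
  "energy t F \<equiv> \<lambda>\<xi>. (1 + (norm \<xi>)\<^sup>2) powr t * (cmod (F \<xi>))\<^sup>2"

lemma wave_eq_cis: "wave (2 * R) k x = cis (x \<bullet> ((pi / (2 * R)) *\<^sub>R real_vec k))"
  by (simp add: wave_cis inner_commute)

text \<open>The kernel is the transform of a cutoff \<open>h\<close>. For every \<open>z\<close> the expansion of \<open>h x * cis (x \<bullet> z)\<close>
  into a Fourier series on the large cube gives a sampling formula; averaging it over \<open>z\<close> in a lattice
  cell turns the lattice sum into an integral.\<close>
lemma FT_pointwise_bound:
  assumes R: "R > 0"
  defines "c \<equiv> pi / (2 * R)"
  assumes m: "m \<ge> 4"
  shows "\<exists>C>0. \<forall>f k. continuous_on UNIV f \<longrightarrow> (\<forall>x. x \<notin> cube R \<longrightarrow> f x = 0) \<longrightarrow>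
    ennreal (cmod (FT f (c *\<^sub>R real_vec k))) \<le>
      (\<integral>\<^sup>+y. ennreal (C * (1 / rweight (c *\<^sub>R real_vec k - y) ^ m) * cmod (FT f y)) \<partial>lborel)"
proof -
  have c: "c > 0" using R by (simp add: c_def)
  obtain h :: "real^3 \<Rightarrow> complex" and C where h: "continuous_on UNIV h" "\<And>x. x\<in>cube R \<Longrightarrow> h x = 1"
     "\<And>x. x \<notin> cube (2 * R) \<Longrightarrow> h x = 0" "C > 0" "\<And>\<xi>. cmod (FT h \<xi>) \<le> C / rweight \<xi> ^ m"
    using cutoff_exists[of R "2 * R" m] R by auto
  define V where "V = (2 * (2 * R)) ^ 3"
  have V: "V > 0" using R by (simp add: V_def)
  obtain \<kappa> :: "nat \<Rightarrow> int^3" where k: "bij \<kappa>" using ex_bij_nat_int_vec by blast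
  have "ennreal (cmod (FT f (c *\<^sub>R real_vec q))) \<le>
      (\<integral>\<^sup>+y. ennreal ((C / V / c ^ 3) * (1 / rweight (c *\<^sub>R real_vec q - y) ^ m) * cmod (FT f y)) \<partial>lborel)"
    if f: "continuous_on UNIV f" and f0: "\<And>x. x \<notin> cube R \<Longrightarrow> f x = 0" for f q
  proof -
    have [measurable]: "f \<in> borel_measurable borel" using f by (rule borel_measurable_continuous_onI)
    define H where "H = (\<lambda>z. ennreal ((C / V) * (1 / rweight z ^ m) * cmod (FT f (c *\<^sub>R real_vec q - z))))"
    have H[measurable]: "H \<in> borel_measurable borel" unfolding H_def by measurable
    have samp: "ennreal (cmod (FT f (c *\<^sub>R real_vec q))) \<le> (\<Sum>n. H (c *\<^sub>R real_vec (\<kappa> n) - z))" for z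
    proof -
      \<comment> \<open>Modulation by \<open>cis (u \<bullet> z)\<close> shifts the transform, so
        the Fourier coefficients of the modulated cutoff are shifted samples of
        \<open>FT h\<close>.\<close>
      define a where "a = (\<lambda>l. FT h (c *\<^sub>R real_vec l - z) / of_real V)"
      have aeq: "a l = (LINT u:cube (2 * R)|lborel. (h u * cis (u \<bullet> z)) * wave (2 * R) (- l) u) / of_real
        ((2 * (2 * R)) ^ 3)" for l
      proof -
        have "FT h (c *\<^sub>R real_vec l - z) = (LINT u:cube (2 * R)|lborel. (h u * cis (u \<bullet> z)) * wave (2
          * R) (- l) u)"
          unfolding FT_def set_lebesgue_integral_def
          by (rule Bochner_Integration.integral_cong)
             (auto simp: indicator_def h(3) wave_eq_cis c_def mult.assoc cis_mult inner_diff_right)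
        then show ?thesis by (simp add: a_def V_def)
      qed
      obtain D where D: "\<And>A. finite A \<Longrightarrow> (\<Sum>k\<in>A. rweight (c *\<^sub>R real_vec k - z) powr (- 4)) \<le> D"
        using lattice_sum_rweight[OF c] by blast
      have na: "cmod (a l) \<le> C / V * (1 / rweight (c *\<^sub>R real_vec l - z) ^ m)" for l
        using h(5)[of "c *\<^sub>R real_vec l - z"] V by (simp add: a_def norm_divide divide_right_mono field_simps)
      have sm: "(\<lambda>l. cmod (a l)) summable_on UNIV"
      proof (rule nonneg_bdd_above_summable_on)
        show "bdd_above (sum (\<lambda>l. cmod (a l)) ` {F. F \<subseteq> UNIV \<and> finite F})"
        proof (rule bdd_aboveI2)
          fix A assume A: "A \<in> {F. F \<subseteq> (UNIV :: (int^3) set) \<and> finite F}"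
          have "(\<Sum>l\<in>A. cmod (a l)) \<le> (\<Sum>l\<in>A. C / V * rweight (c *\<^sub>R real_vec l - z) powr (- 4))"
          proof (intro sum_mono order.trans[OF na] mult_left_mono)
            fix l
            have "1 / rweight (c *\<^sub>R real_vec l - z) ^ m \<le> 1 / rweight (c *\<^sub>R real_vec l - z) ^ 4"
              using m by (intro divide_left_mono power_increasing) auto
            also have "\<dots> = rweight (c *\<^sub>R real_vec l - z) powr (- 4)"
              by (simp add: powr_minus inverse_eq_divide)
            finally show "1 / rweight (c *\<^sub>R real_vec l - z) ^ m
              \<le> rweight (c *\<^sub>R real_vec l - z) powr (- 4)" .
          qed (use h(4) V in auto)
          also have "\<dots> \<le> C / V * D"
            unfolding sum_distrib_left[symmetric] using D[of A] A h(4) V by (intro mult_left_mono) auto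
          finally show "(\<Sum>l\<in>A. cmod (a l)) \<le> C / V * D" .
        qed
      qed auto
      have inv: "cis (x \<bullet> z) = wseries (2 * R) a (\<lambda>k. k) x" if x: "x \<in> cube R" for x
      proof -
        have "\<bar>x $ i\<bar> < 2 * R" for i using x R by (auto simp: mem_cube intro: order.strict_trans1)
        then have "x \<in> interior (cube (2 * R))" by (simp add: interior_cube)
        moreover have "continuous_on (cube (2 * R)) (\<lambda>u. h u * cis (u \<bullet> z))"
          by (intro continuous_intros continuous_on_subset[OF h(1)]) auto
        ultimately have "h x * cis (x \<bullet> z) = wseries (2 * R) a (\<lambda>k. k) x"
          using R by (intro fourier_inversion_cube[OF _ _ aeq sm]) auto
        then show ?thesis using h(2)[OF x] by simp
      qed
      \<comment> \<open>The factor \<open>cis (- (x \<bullet> z))\<close> is undone by the full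
        series, which equals \<open>cis (x \<bullet> z)\<close> on the support of \<open>f\<close>.
        Against a single wave it leaves a sample of \<open>FT f\<close> at a point shifted by
        \<open>z\<close>.\<close>
      define w where "w = (\<lambda>x. f x * cis (- (x \<bullet> (c *\<^sub>R real_vec q + z))))"
      have w: "integrable lborel w" unfolding w_def
        by (rule integrable_cube_support[where s=R]) (auto intro!: continuous_intros f simp: f0)
      have "((\<lambda>l. a l * (LINT x|lborel. w x * wave (2 * R) l x))
        has_sum (LINT x|lborel. w x * wseries (2 * R) a (\<lambda>k. k) x)) UNIV"
        by (rule has_sum_integral_wseries[OF w sm])
      also have "(LINT x|lborel. w x * wseries (2 * R) a (\<lambda>k. k) x) = FT f (c *\<^sub>R real_vec q)"
        unfolding FT_def
      proof (rule Bochner_Integration.integral_cong[OF refl])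
        fix x
        show "w x * wseries (2 * R) a (\<lambda>k. k) x = f x * cis (- (x \<bullet> c *\<^sub>R real_vec q))"
          by (cases "x \<in> cube R") (simp_all add: w_def f0 inv[symmetric] mult.assoc cis_mult inner_add_right)
      qed
      also have "(\<lambda>l. LINT x|lborel. w x * wave (2 * R) l x)
        = (\<lambda>l. FT f (c *\<^sub>R real_vec q - (c *\<^sub>R real_vec l - z)))"
        unfolding FT_def w_def wave_eq_cis c_def[symmetric] mult.assoc cis_mult
        by (simp add: inner_diff_right inner_add_right algebra_simps)
      finally have hs: "((\<lambda>l. a l * FT f (c *\<^sub>R real_vec q - (c *\<^sub>R real_vec l - z)))
        has_sum FT f (c *\<^sub>R real_vec q)) UNIV" .
      have "ennreal (cmod (FT f (c *\<^sub>R real_vec q)))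
        \<le> (\<Sum>n. ennreal (cmod (a (\<kappa> n) * FT f (c *\<^sub>R real_vec q - (c *\<^sub>R real_vec (\<kappa> n) - z)))))"
        by (rule has_sum_norm_le_suminf[OF hs k])
      also have "\<dots> \<le> (\<Sum>n. H (c *\<^sub>R real_vec (\<kappa> n) - z))"
        unfolding H_def norm_mult using na by (intro suminf_le ennreal_leI mult_right_mono) auto
      finally show ?thesis .
    qed
    \<comment> \<open>The left side of the sampling inequality does not depend on \<open>z\<close>,
      so integrating over the cell only multiplies it by the cell volume. On the right the lattice
      translates of the cell fit together into an integral over the whole space.\<close>
    have "ennreal (c ^ 3) * ennreal (cmod (FT f (c *\<^sub>R real_vec q))) =
       (\<integral>\<^sup>+z. ennreal (cmod (FT f (c *\<^sub>R real_vec q))) * indicator (cell c 0) z \<partial>lborel)"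
      using emeasure_cell[OF c, of 0] by (subst nn_integral_cmult_indicator) (auto simp: mult.commute)
    also have "\<dots> \<le> (\<integral>\<^sup>+z. (\<Sum>n. H (c *\<^sub>R real_vec (\<kappa> n) - z) * indicator (cell c 0) z) \<partial>lborel)"
      using samp by (intro nn_integral_mono) (auto simp: indicator_def)
    also have "\<dots> = (\<Sum>n. \<integral>\<^sup>+z. H (c *\<^sub>R real_vec (\<kappa> n) - z) * indicator (cell c 0) z \<partial>lborel)"
      by (rule nn_integral_suminf) measurable
    also have "\<dots> = (\<Sum>n. \<integral>\<^sup>+z. H z * indicator (cell c 0) (c *\<^sub>R real_vec (\<kappa> n) - z) \<partial>lborel)"
    proof (rule suminf_cong)
      fix n
      show "(\<integral>\<^sup>+z. H (c *\<^sub>R real_vec (\<kappa> n) - z) * indicator (cell c 0) z \<partial>lborel) =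
        (\<integral>\<^sup>+z. H z * indicator (cell c 0) (c *\<^sub>R real_vec (\<kappa> n) - z) \<partial>lborel)"
        using nn_integral_reflect[of "\<lambda>z. H z * indicator (cell c 0) (c *\<^sub>R real_vec (\<kappa> n)
          - z)" "c *\<^sub>R real_vec (\<kappa> n)"]
        by simp
    qed
    also have "\<dots> = (\<integral>\<^sup>+z. (\<Sum>n. H z * indicator (cell c 0) (c *\<^sub>R real_vec (\<kappa> n) - z)) \<partial>lborel)"
      by (rule nn_integral_suminf[symmetric]) measurable
    also have "\<dots> \<le> (\<integral>\<^sup>+z. H z \<partial>lborel)"
    proof (rule nn_integral_mono)
      fix z
      have "(\<Sum>n. indicator (cell c 0) (c *\<^sub>R real_vec (\<kappa> n) - z)) \<le> (1 :: ennreal)"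
      proof (rule suminf_le_const)
        fix N
        \<comment> \<open>Reflection in the lattice point turns the condition on \<open>z\<close>
          into membership of \<open>- z\<close> in a cell, where disjointness bounds the sum of
          indicators by \<open>1\<close>.\<close>
        have ind: "indicator (cell c 0) (c *\<^sub>R real_vec l - z)
          = (indicator (cell c (- l)) (- z) :: real)" for l
        proof -
          have "c *\<^sub>R real_vec l - z \<in> cell c 0 \<longleftrightarrow> - z \<in> cell c (- l)"
            unfolding cell_def mem_Collect_eq by (rule iff_allI) auto
          then show ?thesis by (simp add: indicator_def)
        qed
        have inj: "inj_on (\<lambda>n. - \<kappa> n) {..<N}" using k by (auto simp: inj_on_def bij_def)
        have "(\<Sum>n<N. indicator (cell c 0) (c *\<^sub>R real_vec (\<kappa> n) - z))
          = ennreal (\<Sum>n<N. indicator (cell c (- \<kappa> n)) (- z))"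
          by (simp only: ind[symmetric] sum_ennreal[symmetric] ennreal_indicator indicator_pos_le sum_ennreal)
        also have "(\<Sum>n<N. indicator (cell c (- \<kappa> n)) (- z) :: real)
          = (\<Sum>l\<in>(\<lambda>n. - \<kappa> n) ` {..<N}. indicator (cell c l) (- z))"
          by (subst sum.reindex[OF inj]) simp
        also have "\<dots> \<le> 1" by (rule sum_indicator_cell_le[OF c]) simp
        finally show "(\<Sum>n<N. indicator (cell c 0) (c *\<^sub>R real_vec (\<kappa> n) - z)) \<le> (1 :: ennreal)"
          by (simp add: ennreal_leI)
      qed auto
      from mult_left_mono[OF this, of "H z"]
      show "(\<Sum>n. H z * indicator (cell c 0) (c *\<^sub>R real_vec (\<kappa> n) - z)) \<le> H z"
        by simp
    qed
    also have "\<dots> = (\<integral>\<^sup>+y. H (c *\<^sub>R real_vec q - y) \<partial>lborel)"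
      by (rule nn_integral_reflect[symmetric]) measurable
    finally have main: "ennreal (c ^ 3) * ennreal (cmod (FT f (c *\<^sub>R real_vec q)))
      \<le> (\<integral>\<^sup>+y. H (c *\<^sub>R real_vec q - y) \<partial>lborel)" .
    have "ennreal (cmod (FT f (c *\<^sub>R real_vec q)))
      = ennreal (1 / c ^ 3) * (ennreal (c ^ 3) * ennreal (cmod (FT f (c *\<^sub>R real_vec q))))"
      using c by (simp add: mult.assoc[symmetric] ennreal_mult[symmetric])
    also have "\<dots> \<le> ennreal (1 / c ^ 3) * (\<integral>\<^sup>+y. H (c *\<^sub>R real_vec q - y) \<partial>lborel)"
      by (intro mult_left_mono main) simp
    also have "\<dots> = (\<integral>\<^sup>+y. ennreal (1 / c ^ 3) * H (c *\<^sub>R real_vec q - y) \<partial>lborel)"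
      by (rule nn_integral_cmult[symmetric]) measurable
    also have "\<dots> = (\<integral>\<^sup>+y. ennreal ((C / V / c ^ 3) * (1 / rweight (c *\<^sub>R real_vec q - y) ^ m) * cmod
      (FT f y)) \<partial>lborel)"
      unfolding H_def using c V h(4) by (intro nn_integral_cong) (simp add: ennreal_mult[symmetric] mult_ac)
    finally show ?thesis .
  qed
  then show ?thesis using c V h(4) by (intro exI[of _ "C / V / c ^ 3"]) auto
qed

text \<open>Cauchy-Schwarz with the factor \<open>rweight y powr (- 2)\<close>, whose square is
  integrable in three dimensions. This is where two powers of the weight are lost.\<close>

lemma weighted_FT_integral_bound:
  fixes F :: "real^3 \<Rightarrow> complex"
  assumes t: "t \<ge> 2" and F[measurable]: "F \<in> borel_measurable borel"
    and int: "integrable lborel (energy t F)"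
  shows "(\<integral>\<^sup>+y. ennreal (rweight y powr (t - 2) * cmod (F y)) \<partial>lborel) \<le>
     ennreal (sqrt (2 powr t * (LINT x|lborel. rweight x powr (- 4))) *
       sqrt (integral\<^sup>L lborel (energy t F)))"
proof -
  define D X where "D = (LINT x|lborel. rweight x powr (- 4))"
    and "X = (integral\<^sup>L lborel (energy t F))"
  have DX: "D \<ge> 0" "X \<ge> 0" by (simp_all add: D_def X_def)
  define u v where "u = (\<lambda>y. ennreal (rweight y powr t * cmod (F y)))" and "v
    = (\<lambda>y. ennreal (rweight y powr (- 2)))"
  have [measurable]: "u \<in> borel_measurable borel" "v \<in> borel_measurable borel" unfolding u_def v_def
    by measurable
  define I where "I = (\<integral>\<^sup>+y. ennreal (rweight y powr (t - 2) * cmod (F y)) \<partial>lborel)"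
  have "I = (\<integral>\<^sup>+y. u y * v y \<partial>lborel)"
    unfolding I_def by (intro nn_integral_cong)
      (simp add: u_def v_def ennreal_mult[symmetric] powr_diff powr_minus divide_inverse mult_ac)
  then have "I\<^sup>2 \<le> (\<integral>\<^sup>+y. (u y)\<^sup>2 \<partial>lborel) * (\<integral>\<^sup>+y. (v y)\<^sup>2 \<partial>lborel)"
    using Cauchy_Schwarz_nn_integral[of u lborel v] by simp
  also have "\<dots> \<le> ennreal (2 powr t * X) * ennreal D"
  proof (intro mult_mono)
    \<comment> \<open>The two weights are compared through
      \<open>(1 + r)\<^sup>2 \<le> 2 * (1 + r\<^sup>2)\<close>, the origin of the constant
      \<open>2 powr t\<close>.\<close>
    have "(rweight y powr t)\<^sup>2 \<le> 2 powr t * (1 + (norm y)\<^sup>2) powr t" for y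
    proof -
      have "(rweight y)\<^sup>2 \<le> 2 * (1 + (norm y)\<^sup>2)"
        using sum_squares_ge_zero[of "norm y - 1" 0] by (simp add: rweight_def power2_eq_square algebra_simps)
      then have "(rweight y)\<^sup>2 powr t \<le> (2 * (1 + (norm y)\<^sup>2)) powr t" using t by (intro powr_mono2) auto
      then show ?thesis by (simp only: power2_eq_square powr_mult)
    qed
    from mult_right_mono[OF this zero_le_power2]
    have "(\<integral>\<^sup>+y. (u y)\<^sup>2 \<partial>lborel) \<le> (\<integral>\<^sup>+y. ennreal (2 powr t * (energy t F y)) \<partial>lborel)"
      unfolding u_def by (intro nn_integral_mono)
        (simp add: ennreal_power power_mult_distrib mult.assoc ennreal_leI)
    also have "\<dots> = ennreal (2 powr t * X)"
      using int by (subst nn_integral_eq_integral) (auto simp: X_def)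
    finally show "(\<integral>\<^sup>+y. (u y)\<^sup>2 \<partial>lborel) \<le> ennreal (2 powr t * X)" .
    have "(\<integral>\<^sup>+y. (v y)\<^sup>2 \<partial>lborel) = (\<integral>\<^sup>+y. ennreal (rweight y powr (- 4)) \<partial>lborel)"
      unfolding v_def by (intro nn_integral_cong)
        (simp add: power2_eq_square powr_add[symmetric] ennreal_mult[symmetric])
    also have "\<dots> = ennreal D"
      unfolding D_def using integrable_rweight_powr by (intro nn_integral_eq_integral) auto
    finally show "(\<integral>\<^sup>+y. (v y)\<^sup>2 \<partial>lborel) \<le> ennreal D" by simp
  qed auto
  also have "\<dots> = (ennreal (sqrt (2 powr t * D) * sqrt X))\<^sup>2"
    using DX by (simp add: ennreal_power ennreal_mult[symmetric] power_mult_distrib mult_ac)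
  finally have sq: "I\<^sup>2 \<le> (ennreal (sqrt (2 powr t * D) * sqrt X))\<^sup>2" .
  have "I \<le> ennreal (sqrt (2 powr t * D) * sqrt X)"
  proof (cases I)
    case (real r)
    then have "r\<^sup>2 \<le> (sqrt (2 powr t * D) * sqrt X)\<^sup>2" using sq DX by (simp add: ennreal_power)
    then show ?thesis using real DX by (auto intro!: ennreal_leI power2_le_imp_le)
  next
    case top
    then show ?thesis using sq DX by (simp add: ennreal_power top_unique)
  qed
  then show ?thesis by (simp add: I_def D_def X_def)
qed

text \<open>The pointwise bound writes a sample as an average of \<open>FT f\<close> around the
  lattice point. Submultiplicativity moves the weight from the lattice point to the variable of
  integration, the lattice sum is then bounded uniformly, and the weighted integral remains.\<close>

lemma sampling_bound:
  assumes R: "R > 0" and t: "t \<ge> 2"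
  defines "c \<equiv> pi / (2 * R)"
  shows "\<exists>C>0. \<forall>f A. continuous_on UNIV f \<longrightarrow> (\<forall>x. x \<notin> cube R \<longrightarrow> f x = 0) \<longrightarrow>
     integrable lborel (energy t (FT f)) \<longrightarrow> finite A \<longrightarrow>
     (\<Sum>k\<in>A. weight k powr (t - 2) * cmod (FT f (c *\<^sub>R real_vec k))) \<le>
       C * sqrt (integral\<^sup>L lborel (energy t (FT f)))"
proof -
  have c: "c > 0" using R by (simp add: c_def)
  define s where "s = t - 2"
  have s: "s \<ge> 0" using t by (simp add: s_def)
  \<comment> \<open>\<open>s\<close> powers of decay pay for moving the weight, and four more make
    the lattice sum converge.\<close>
  define m where "m = nat \<lceil>s\<rceil> + 4"
  have m: "m \<ge> 4" "s + 4 \<le> real m" by (auto simp: m_def) linarith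
  obtain C1 where C1: "C1 > 0" "\<And>f k. continuous_on UNIV f \<Longrightarrow> (\<And>x. x \<notin> cube R \<Longrightarrow> f x = 0) \<Longrightarrow>
    ennreal (cmod (FT f (c *\<^sub>R real_vec k))) \<le>
      (\<integral>\<^sup>+y. ennreal (C1 * (1 / rweight (c *\<^sub>R real_vec k - y) ^ m) * cmod (FT f y)) \<partial>lborel)"
    using FT_pointwise_bound[OF R m(1)] unfolding c_def by blast
  obtain D where D: "D > 0" "\<And>x A. finite A \<Longrightarrow> (\<Sum>k\<in>A. rweight (c *\<^sub>R real_vec k - x) powr (- 4)) \<le> D"
    using lattice_sum_rweight[OF c] by blast
  define C2 where "C2 = sqrt (2 powr t * (LINT x|lborel. rweight x powr (- 4))) + 1"
  have C2: "C2 > 0" "\<And>F. F \<in> borel_measurable borel \<Longrightarrow> integrable lborel (energy t F) \<Longrightarrow>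
     (\<integral>\<^sup>+y. ennreal (rweight y powr s * cmod (F y)) \<partial>lborel) \<le>
     ennreal (C2 * sqrt (integral\<^sup>L lborel (energy t F)))"
  proof -
    show "C2 > 0" unfolding C2_def by (intro add_nonneg_pos) auto
    fix F :: "real^3 \<Rightarrow> complex"
    assume "F \<in> borel_measurable borel" "integrable lborel (energy t F)"
    from weighted_FT_integral_bound[OF t this]
    show "(\<integral>\<^sup>+y. ennreal (rweight y powr s * cmod (F y)) \<partial>lborel) \<le>
     ennreal (C2 * sqrt (integral\<^sup>L lborel (energy t F)))"
      unfolding s_def by (rule order.trans) (intro ennreal_leI mult_right_mono, auto simp: C2_def)
  qed
  define E where "E = (1 + 1 / c) powr s"
  have "1 + 1 / c > 0" using c by (simp add: add_pos_pos)
  then have E: "E > 0" unfolding E_def by simp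
  have weight_le: "weight k powr s \<le> E * (rweight y powr s * rweight (c *\<^sub>R real_vec k - y) powr s)" for k y
  proof -
    have "weight k \<le> (1 + 1 / c) * rweight (c *\<^sub>R real_vec k)"
      using c by (simp add: weight_def rweight_def field_simps)
    also have "rweight (c *\<^sub>R real_vec k) \<le> rweight y * rweight (c *\<^sub>R real_vec k - y)"
      using rweight_add_le[of y "c *\<^sub>R real_vec k - y"] by simp
    finally (order.trans[OF _ mult_left_mono]) have "weight k
      \<le> (1 + 1 / c) * (rweight y * rweight (c *\<^sub>R real_vec k - y))"
      using c by simp
    then have "weight k powr s \<le> ((1 + 1 / c) * (rweight y * rweight (c *\<^sub>R real_vec k - y))) powr s"
      using s by (intro powr_mono2) auto
    then show ?thesis using c by (simp add: E_def powr_mult add_nonneg_nonneg)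
  qed
  define C where "C = C1 * E * D * C2"
  have "(\<Sum>k\<in>A. weight k powr s * cmod (FT f (c *\<^sub>R real_vec k))) \<le>
       C * sqrt (integral\<^sup>L lborel (energy t (FT f)))"
    if f: "continuous_on UNIV f" "\<And>x. x \<notin> cube R \<Longrightarrow> f x = 0"
      and int: "integrable lborel (energy t (FT f))" and A: "finite A" for f A
  proof -
    have [measurable]: "f \<in> borel_measurable borel" using f(1) by (rule borel_measurable_continuous_onI)
    let ?X = "sqrt (integral\<^sup>L lborel (energy t (FT f)))"
    define P where "P = (\<lambda>k y. C1 * (1 / rweight (c *\<^sub>R real_vec k - y) ^ m) * cmod (FT f y))"
    have [measurable]: "P k \<in> borel_measurable borel" for k unfolding P_def by measurable
    have Pnn: "P k y \<ge> 0" for k y unfolding P_def using C1(1) by simp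
    have point: "(\<Sum>k\<in>A. weight k powr s * P k y) \<le> C1 * E * D * (rweight y powr s * cmod (FT f y))" for y
    proof -
      have "weight k powr s * P k y \<le> C1 * E * (rweight y powr s * cmod (FT f y)) * rweight
        (c *\<^sub>R real_vec k - y) powr (- 4)" for k
      proof -
        define z where "z = rweight (c *\<^sub>R real_vec k - y)"
        have z: "z \<ge> 1" by (simp add: z_def)
        have "z powr s * (1 / z ^ m) = z powr (s - real m)"
          using z by (simp add: powr_diff powr_realpow)
        also have "\<dots> \<le> z powr (- 4)" using z m by (intro powr_mono) auto
        finally have z4: "z powr s * (1 / z ^ m) \<le> z powr (- 4)" .
        have "weight k powr s * P k y \<le> (E * (rweight y powr s * z powr s)) * P k y"
          using weight_le[of k y] Pnn[of k y] by (intro mult_right_mono) (auto simp: z_def)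
        also have "\<dots> = C1 * E * (rweight y powr s * cmod (FT f y)) * (z powr s * (1 / z ^ m))"
          by (simp add: P_def z_def)
        also have "\<dots> \<le> C1 * E * (rweight y powr s * cmod (FT f y)) * z powr (- 4)"
          using z4 C1 E by (intro mult_left_mono) auto
        finally show ?thesis by (simp add: z_def)
      qed
      then have "(\<Sum>k\<in>A. weight k powr s * P k y)
        \<le> (\<Sum>k\<in>A. C1 * E * (rweight y powr s * cmod (FT f y)) * rweight (c *\<^sub>R real_vec k - y) powr (- 4))"
        by (rule sum_mono)
      also have "\<dots> \<le> C1 * E * (rweight y powr s * cmod (FT f y)) * D"
        unfolding sum_distrib_left[symmetric] using D(2)[OF A, of y] C1 E by (intro mult_left_mono) auto
      finally show ?thesis by (simp add: mult_ac)
    qed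
    have "ennreal (\<Sum>k\<in>A. weight k powr s * cmod (FT f (c *\<^sub>R real_vec k)))
      = (\<Sum>k\<in>A. ennreal (weight k powr s) * ennreal (cmod (FT f (c *\<^sub>R real_vec k))))"
      by (subst sum_ennreal[symmetric]) (auto simp: ennreal_mult)
    also have "\<dots> \<le> (\<Sum>k\<in>A. ennreal (weight k powr s) * (\<integral>\<^sup>+y. ennreal (P k y) \<partial>lborel))"
      unfolding P_def by (intro sum_mono mult_left_mono C1(2) f) auto
    also have "\<dots> = (\<integral>\<^sup>+y. (\<Sum>k\<in>A. ennreal (weight k powr s) * ennreal (P k y)) \<partial>lborel)"
      by (subst nn_integral_sum) (auto simp: nn_integral_cmult)
    also have "\<dots> = (\<integral>\<^sup>+y. ennreal (\<Sum>k\<in>A. weight k powr s * P k y) \<partial>lborel)"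
      using Pnn by (intro nn_integral_cong) (subst sum_ennreal[symmetric], auto simp: ennreal_mult)
    also have "\<dots> \<le> (\<integral>\<^sup>+y. ennreal (C1 * E * D) * ennreal (rweight y powr s * cmod (FT f y)) \<partial>lborel)"
      using point C1 E D(1) by (intro nn_integral_mono)
        (auto simp: ennreal_mult[symmetric] intro!: ennreal_leI)
    also have "\<dots> = ennreal (C1 * E * D) * (\<integral>\<^sup>+y. ennreal (rweight y powr s * cmod (FT f y)) \<partial>lborel)"
      by (rule nn_integral_cmult) measurable
    also have "\<dots> \<le> ennreal (C1 * E * D) * ennreal (C2 * ?X)"
      using int by (intro mult_left_mono C2(2)) auto
    also have "\<dots> = ennreal (C * ?X)"
      using C1 E D(1) C2(1) by (simp add: C_def ennreal_mult[symmetric] mult_ac)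
    finally have "ennreal (\<Sum>k\<in>A. weight k powr s * cmod (FT f (c *\<^sub>R real_vec k))) \<le> ennreal (C * ?X)" .
    moreover have "C * ?X \<ge> 0" using C1 E D(1) C2(1) by (simp add: C_def)
    ultimately show ?thesis by simp
  qed
  moreover have "C > 0" using C1 E D(1) C2(1) by (simp add: C_def)
  ultimately show ?thesis unfolding s_def by blast
qed

section \<open>Trigonometric interpolation\<close>

lemma has_sum_finite_sum:
  fixes f :: "'i \<Rightarrow> 'x \<Rightarrow> complex"
  assumes "finite I" "\<And>i. i \<in> I \<Longrightarrow> (f i has_sum s i) A"
  shows "((\<lambda>x. \<Sum>i\<in>I. f i x) has_sum (\<Sum>i\<in>I. s i)) A"
  using assms by (induction I rule: finite_induct) (auto intro!: has_sum_add)

lemma sum_vec_prod: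
  fixes \<phi> :: "3 \<Rightarrow> int \<Rightarrow> complex"
  assumes "finite B"
  shows "(\<Sum>j\<in>{j :: int^3. \<forall>i. j $ i \<in> B}. \<Prod>i\<in>UNIV. \<phi> i (j $ i)) = (\<Prod>i\<in>UNIV. \<Sum>b\<in>B. \<phi> i b)"
proof -
  have "(\<Prod>i\<in>UNIV. \<Sum>b\<in>B. \<phi> i b) = (\<Sum>g\<in>PiE UNIV (\<lambda>_. B). \<Prod>i\<in>UNIV. \<phi> i (g i))"
    using assms by (intro prod_sum_PiE) auto
  also have "\<dots> = (\<Sum>j\<in>{j :: int^3. \<forall>i. j $ i \<in> B}. \<Prod>i\<in>UNIV. \<phi> i (j $ i))"
    by (rule sum.reindex_bij_witness[where i="vec_nth" and j="vec_lambda"]) auto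
  finally show ?thesis ..
qed

lemma index_set_eq: "index_set n = {j. \<forall>i. j $ i \<in> {- (int n div 2)..<int n div 2}}"
  by (auto simp: index_set_def)

lemma cis_eq_1_imp: "cis (2 * pi * t) = 1 \<Longrightarrow> t \<in> \<int>"
proof -
  assume "cis (2 * pi * t) = 1"
  then have "cos (2 * pi * t) = 1" by (simp add: complex_eq_iff)
  then obtain m :: int where "2 * pi * t = of_int m * 2 * pi" by (auto simp: cos_one_2pi_int)
  then have "t = of_int m" by simp
  then show ?thesis by simp
qed

lemma sum_cis_period:
  assumes n: "even n" "n > 0"
  shows "(\<Sum>b\<in>{- (int n div 2)..<int n div 2}. cis (2 * pi * (real_of_int (z * b) / real n))) =
    (if int n dvd z then of_nat n else 0)"
proof (cases "int n dvd z")
  case True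
  have "cis (2 * pi * (real_of_int (z * b) / real n)) = 1" for b
  proof -
    obtain q where "z = int n * q" using True by blast
    then have "real_of_int (z * b) / real n = real_of_int (q * b)" using n by simp
    then show ?thesis by (simp only: cis_multiple_2pi Ints_of_int)
  qed
  moreover have "int n div 2 - - (int n div 2) = int n" using n by presburger
  ultimately show ?thesis using True by simp
next
  case False
  define w where "w = cis (2 * pi * (real_of_int z / real n))"
  define m where "m = int n div 2"
  have wn: "w ^ n = 1"
  proof -
    have "w ^ n = cis (real n * (2 * pi * (real_of_int z / real n)))" unfolding w_def
      by (rule Complex.DeMoivre)
    also have "real n * (2 * pi * (real_of_int z / real n)) = 2 * pi * real_of_int z" using n by simp
    finally have "w ^ n = cis (2 * pi * real_of_int z)" .
    then show ?thesis by (simp only: cis_multiple_2pi Ints_of_int)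
  qed
  have w1: "w \<noteq> 1"
  proof
    assume "w = 1"
    then have "real_of_int z / real n \<in> \<int>" unfolding w_def by (rule cis_eq_1_imp)
    then obtain q where "real_of_int z / real n = real_of_int q" by (auto elim: Ints_cases)
    then have "real_of_int z = real_of_int (int n * q)" using n by (simp add: field_simps)
    then have "z = int n * q" by (simp only: of_int_eq_iff)
    then show False using False by simp
  qed
  have "(\<Sum>b\<in>{-m..<m}. cis (2 * pi * (real_of_int (z * b) / real n))) =
     (\<Sum>a<n. cis (2 * pi * (real_of_int (z * (int a - m)) / real n)))"
  proof (rule sum.reindex_bij_witness[where i="\<lambda>a. int a - m" and j="\<lambda>b. nat (b + m)"])
    have "2 * m = int n" using n by (simp add: m_def)
    then show "nat (b + m) \<in> {..<n}" if "b \<in> {-m..<m}" for b using that by auto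
    from \<open>2 * m = int n\<close> show "int a - m \<in> {-m..<m}" if "a \<in> {..<n}" for a using that by auto
  qed auto
  also have "\<dots> = (\<Sum>a<n. cis (- (2 * pi * (real_of_int (z * m) / real n))) * w ^ a)"
    unfolding w_def Complex.DeMoivre cis_mult
      by (intro sum.cong refl arg_cong[where f=cis])
        (simp add: right_diff_distrib diff_divide_distrib algebra_simps)
  also have "\<dots> = cis (- (2 * pi * (real_of_int (z * m) / real n))) * (\<Sum>a<n. w ^ a)"
    by (simp add: sum_distrib_left)
  also have "(\<Sum>a<n. w ^ a) = 0" using w1 wn by (simp add: geometric_sum)
  finally show ?thesis using False by (simp add: m_def)
qed

lemma prod_cis:
  fixes g :: "'i \<Rightarrow> real"
  shows "finite I \<Longrightarrow> (\<Prod>i\<in>I. cis (g i)) = cis (\<Sum>i\<in>I. g i)"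
  by (induction I rule: finite_induct) (auto simp: cis_mult)

lemma wave_node:
  assumes "L > 0"
  shows "wave L k (node L n j) = (\<Prod>i\<in>UNIV. cis (2 * pi * (real_of_int (k $ i * j $ i) / real n)))"
proof -
  have "pi / L * (real_vec k \<bullet> node L n j) = (\<Sum>i\<in>UNIV. 2 * pi * (real_of_int (k $ i * j $ i) / real n))"
    using assms by (simp add: node_def inner_vec_def sum_distrib_left mult_ac)
  then show ?thesis by (simp add: wave_cis prod_cis)
qed

lemma wave_node_commute: "L > 0 \<Longrightarrow> wave L k (node L n j) = wave L j (node L n k)"
  by (simp add: wave_node mult.commute)

lemma sum_wave_node:
  assumes L: "L > 0" and n: "even n" "n > 0"
  shows "(\<Sum>j\<in>index_set n. wave L k (node L n j)) = (if \<forall>i. int n dvd k $ i then of_nat n ^ 3 else 0)"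
proof -
  have "(\<Sum>j\<in>index_set n. wave L k (node L n j))
    = (\<Prod>i\<in>UNIV. \<Sum>b\<in>{- (int n div 2)..<int n div 2}. cis (2 * pi * (real_of_int (k $ i * b) / real n)))"
    unfolding index_set_eq wave_node[OF L]
    by (rule sum_vec_prod[where \<phi>="\<lambda>i b. cis (2 * pi * (real_of_int (k $ i * b) / real n))"]) simp
  also have "\<dots> = (\<Prod>i\<in>UNIV. if int n dvd k $ i then of_nat n else 0)"
    unfolding sum_cis_period[OF n] ..
  also have "\<dots> = (if \<forall>i. int n dvd k $ i then of_nat n ^ 3 else 0)"
    by (auto simp: prod_zero_iff)
  finally show ?thesis .
qed

text \<open>The wave of frequency \<open>0\<close> is constantly \<open>1\<close>, so its sum over
  the nodes counts them.\<close>

lemma card_index_set: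
  assumes "even n" "n > 0" shows "card (index_set n) = n ^ 3"
proof -
  have "complex_of_nat (card (index_set n)) = of_nat (n ^ 3)"
    using sum_wave_node[OF zero_less_one assms, of 0] by simp
  then show ?thesis by (simp only: of_nat_eq_iff)
qed

section \<open>Residues modulo n and aliasing\<close>

definition residue :: "nat \<Rightarrow> int^3 \<Rightarrow> int^3" where
  "residue n k = (\<chi> i. (k $ i + int n div 2) mod int n - int n div 2)"

lemma residue_in_index_set:
  assumes "even n" "n > 0" shows "residue n k \<in> index_set n"
proof -
  have "(k $ i + int n div 2) mod int n \<ge> 0" "(k $ i + int n div 2) mod int n < int n" for i using assms
    by auto
  moreover have "int n = 2 * (int n div 2)" using assms by simp
  ultimately show ?thesis unfolding index_set_def residue_def by simp
qed

lemma residue_cong: "int n dvd residue n k $ i - k $ i"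
proof -
  have "residue n k $ i - k $ i = (k $ i + int n div 2) mod int n - (k $ i + int n div 2)"
    by (simp add: residue_def)
  also have "int n dvd \<dots>" by (subst dvd_diff_commute) (rule dvd_minus_mod)
  finally show ?thesis .
qed

lemma index_set_cong_eq:
  assumes n: "even n" "n > 0" and k: "k \<in> index_set n" "l \<in> index_set n" and d: "\<forall>i. int n dvd k $ i - l $ i"
  shows "k = l"
proof (rule vec_eq_iff[THEN iffD2], rule allI)
  fix i
  obtain q where q: "k $ i - l $ i = int n * q" using d by blast
  have "int n = 2 * (int n div 2)" using n by simp
  then have "\<bar>k $ i - l $ i\<bar> < int n" using k unfolding index_set_def by (smt (verit) mem_Collect_eq)
  then have "int n * \<bar>q\<bar> < int n * 1" unfolding q by (simp add: abs_mult)
  then have "\<bar>q\<bar> < 1" using n by (simp only: mult_less_cancel_left_pos of_nat_0_less_iff)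
  then show "k $ i = l $ i" using q by simp
qed

lemma residue_id: "even n \<Longrightarrow> n > 0 \<Longrightarrow> k \<in> index_set n \<Longrightarrow> residue n k = k"
  using index_set_cong_eq[of n "residue n k" k] residue_in_index_set residue_cong by blast

lemma cong_iff_residue:
  assumes n: "even n" "n > 0" and k: "k \<in> index_set n"
  shows "(\<forall>i. int n dvd (l - k) $ i) \<longleftrightarrow> k = residue n l"
proof
  assume "\<forall>i. int n dvd (l - k) $ i"
  then have "int n dvd residue n l $ i - k $ i" for i
    using dvd_add[OF residue_cong[of n l i], of "l $ i - k $ i"] by simp
  then show "k = residue n l" using index_set_cong_eq[OF n residue_in_index_set[OF n] k] by metis
next
  assume "k = residue n l"
  then show "\<forall>i. int n dvd (l - k) $ i"
    using residue_cong[of n l] by (simp add: dvd_diff_commute)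
qed

text \<open>Aliasing can only lower frequencies, so weighted bounds of a series carry over to its
  interpolant. A coordinate that is changed has absolute value at least \<open>n / 2\<close>, and
  its residue at most that.\<close>

lemma abs_residue_le:
  assumes n: "even n" "n > 0" shows "\<bar>residue n k $ i\<bar> \<le> \<bar>k $ i\<bar>"
proof (cases "- (int n div 2) \<le> k $ i \<and> k $ i < int n div 2")
  case True
  have "int n = 2 * (int n div 2)" using n by simp
  then have "(k $ i + int n div 2) mod int n = k $ i + int n div 2" using True
    by (intro mod_pos_pos_trivial) auto
  then show ?thesis by (simp add: residue_def)
next
  case False
  have "- (int n div 2) \<le> residue n k $ i" "residue n k $ i < int n div 2"
    using residue_in_index_set[OF n, of k] by (auto simp: index_set_def)
  then show ?thesis using False by linarith
qed

lemma weight_mono: "(\<And>i. \<bar>k $ i\<bar> \<le> \<bar>l $ i\<bar>) \<Longrightarrow> weight k \<le> weight l"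
proof -
  assume "\<And>i. \<bar>k $ i\<bar> \<le> \<bar>l $ i\<bar>"
  then have "real_of_int \<bar>k $ i\<bar> \<le> real_of_int \<bar>l $ i\<bar>" for i by (simp only: of_int_le_iff)
  then show ?thesis
    unfolding weight_def norm_vec_def by (intro add_left_mono L2_set_mono) auto
qed

lemma weight_residue_le: "even n \<Longrightarrow> n > 0 \<Longrightarrow> weight (residue n k) \<le> weight k"
  by (intro weight_mono abs_residue_le)

lemma weight_ge_of_not_in_index_set:
  assumes n: "even n" and k: "k \<notin> index_set n"
  shows "real n / 2 \<le> weight k"
proof -
  obtain i where "\<not> (- (int n div 2) \<le> k $ i \<and> k $ i < int n div 2)" using k by (auto simp: index_set_def)
  then have "int n div 2 \<le> \<bar>k $ i\<bar>" by linarith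
  moreover have "int n = 2 * (int n div 2)" using n by simp
  ultimately have "int n \<le> 2 * \<bar>k $ i\<bar>" by linarith
  then have "real n \<le> 2 * \<bar>real_of_int (k $ i)\<bar>" by linarith
  also have "\<bar>real_of_int (k $ i)\<bar> \<le> norm (real_vec k)" using component_le_norm_cart[of "real_vec k" i]
    by simp
  finally show ?thesis by (simp add: weight_def)
qed

text \<open>Aliasing: on the grid a wave coincides with the wave of the residue of its frequency.\<close>
lemma has_sum_interp_coeff:
  assumes L: "L > 0" and n: "even n" "n > 0" and b: "(\<lambda>x. cmod (b x)) summable_on UNIV"
    and h: "\<And>j. j \<in> index_set n \<Longrightarrow> h (node L n j) = wseries L b \<kappa> (node L n j)"
  shows "((\<lambda>x. b x * \<mu> (residue n (\<kappa> x))) has_sum (\<Sum>k\<in>index_set n. interp_coeff L n h k * \<mu> k)) UNIV"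
proof -
  let ?J = "index_set n"
  \<comment> \<open>The multiplier \<open>\<mu>\<close> is arbitrary: a wave gives the interpolant,
    a kernel coefficient times a wave gives the discrete potential.\<close>
  let ?c = "\<lambda>k j. 1 / of_nat n ^ 3 * wave L (- k) (node L n j) * \<mu> k"
  have "((\<lambda>x. \<Sum>k\<in>?J. \<Sum>j\<in>?J. ?c k j * (b x * wave L (\<kappa> x) (node L n j))) has_sum
     (\<Sum>k\<in>?J. \<Sum>j\<in>?J. ?c k j * wseries L b \<kappa> (node L n j))) UNIV"
    by (intro has_sum_finite_sum finite_index_set has_sum_cmult_right has_sum_wseries b)
  moreover have "(\<Sum>k\<in>?J. \<Sum>j\<in>?J. ?c k j * wseries L b \<kappa> (node L n j)) = (\<Sum>k\<in>?J. interp_coeff L n h k * \<mu> k)"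
    unfolding interp_coeff_def sum_distrib_left sum_distrib_right
    by (intro sum.cong refl) (simp add: h)
  moreover have "(\<Sum>k\<in>?J. \<Sum>j\<in>?J. ?c k j * (b x * wave L (\<kappa> x) (node L n j))) = b x * \<mu> (residue n (\<kappa> x))" for x
  proof -
    have "(\<Sum>k\<in>?J. \<Sum>j\<in>?J. ?c k j * (b x * wave L (\<kappa> x) (node L n j))) =
       (\<Sum>k\<in>?J. b x * \<mu> k * (1 / of_nat n ^ 3 * (\<Sum>j\<in>?J. wave L (\<kappa> x - k) (node L n j))))"
      unfolding sum_distrib_left diff_conv_add_uminus wave_add by (intro sum.cong refl) simp
    also have "\<dots> = (\<Sum>k\<in>?J. if k = residue n (\<kappa> x) then b x * \<mu> k else 0)"
    proof (rule sum.cong[OF refl])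
      fix k assume k: "k \<in> ?J"
      show "b x * \<mu> k * (1 / of_nat n ^ 3 * (\<Sum>j\<in>?J. wave L (\<kappa> x - k) (node L n j))) = (if k
        = residue n (\<kappa> x) then b x * \<mu> k else 0)"
        unfolding sum_wave_node[OF L n] cong_iff_residue[OF n k] using n by auto
    qed
    also have "\<dots> = b x * \<mu> (residue n (\<kappa> x))"
      using residue_in_index_set[OF n] by (simp add: finite_index_set)
    finally show ?thesis .
  qed
  ultimately show ?thesis by simp
qed

lemma interp_eq_wseries:
  assumes L: "L > 0" and n: "even n" "n > 0" and b: "(\<lambda>x. cmod (b x)) summable_on UNIV"
    and h: "\<And>j. j \<in> index_set n \<Longrightarrow> h (node L n j) = wseries L b \<kappa> (node L n j)"
  shows "interp L n h v = wseries L b (\<lambda>x. residue n (\<kappa> x)) v"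
  using has_sum_unique[OF has_sum_interp_coeff[OF L n b h, of "\<lambda>k. wave L k v"] has_sum_wseries[OF b]]
  by (simp add: interp_def)

text \<open>Frequency and node index play symmetric roles in \<open>wave_node\<close>. The sum over
  frequencies thus becomes a sum of one wave over nodes, which discrete orthogonality
  evaluates.\<close>

lemma interp_node:
  assumes L: "L > 0" and n: "even n" "n > 0" and j: "j \<in> index_set n"
  shows "interp L n h (node L n j) = h (node L n j)"
proof -
  let ?J = "index_set n"
  have "interp L n h (node L n j) = (\<Sum>k\<in>?J. \<Sum>q\<in>?J. h (node L n q) * (1 / of_nat n ^ 3 * wave L (j - q)
    (node L n k)))"
    unfolding interp_def interp_coeff_def sum_distrib_left sum_distrib_right diff_conv_add_uminus wave_add
  proof (intro sum.cong refl)
    fix k q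
    have 1: "wave L (- k) (node L n q) = wave L (- q) (node L n k)"
      unfolding wave_node[OF L] by (simp add: mult.commute)
    have 2: "wave L k (node L n j) = wave L j (node L n k)"
      by (rule wave_node_commute[OF L])
    show "1 / of_nat n ^ 3 * (h (node L n q) * wave L (- k) (node L n q)) * wave L k (node L n j) =
       h (node L n q) * (1 / of_nat n ^ 3 * (wave L j (node L n k) * wave L (- q) (node L n k)))"
      unfolding 1 2 by simp
  qed
  also have "\<dots> = (\<Sum>q\<in>?J. h (node L n q) * (1 / of_nat n ^ 3 * (\<Sum>k\<in>?J. wave L (j - q) (node L n k))))"
    by (subst sum.swap) (simp add: sum_distrib_left)
  also have "\<dots> = (\<Sum>q\<in>?J. if q = j then h (node L n q) else 0)"
  proof (rule sum.cong[OF refl])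
    fix q assume q: "q \<in> ?J"
    show "h (node L n q) * (1 / of_nat n ^ 3 * (\<Sum>k\<in>?J. wave L (j - q) (node L n k))) = (if q
      = j then h (node L n q) else 0)"
      unfolding sum_wave_node[OF L n] cong_iff_residue[OF n q] residue_id[OF n j] using n by auto
  qed
  also have "\<dots> = h (node L n j)" using j by (simp add: finite_index_set)
  finally show ?thesis .
qed

section \<open>Parseval identities and an inverse inequality\<close>

lemma discrete_parseval:
  assumes L: "L > 0" and n: "even n" "n > 0"
  shows "(\<Sum>k\<in>index_set n. (cmod (interp_coeff L n h k))\<^sup>2)
    = (\<Sum>j\<in>index_set n. (cmod (h (node L n j)))\<^sup>2) / real n ^ 3"
proof -
  let ?J = "index_set n"
  let ?c = "interp_coeff L n h"
  have "(\<Sum>j\<in>?J. complex_of_real ((cmod (h (node L n j)))\<^sup>2))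
    = (\<Sum>j\<in>?J. \<Sum>k\<in>?J. \<Sum>l\<in>?J. ?c k * cnj (?c l) * wave L (k - l) (node L n j))"
  proof (rule sum.cong[OF refl])
    fix j assume j: "j \<in> ?J"
    have "complex_of_real ((cmod (h (node L n j)))\<^sup>2)
      = interp L n h (node L n j) * cnj (interp L n h (node L n j))"
      unfolding interp_node[OF L n j] by (rule complex_norm_square)
    also have "\<dots> = (\<Sum>k\<in>?J. \<Sum>l\<in>?J. ?c k * cnj (?c l) * wave L (k - l) (node L n j))"
      unfolding interp_def cnj_sum sum_product complex_cnj_mult wave_cnj diff_conv_add_uminus wave_add
      by (intro sum.cong refl) simp
    finally show "complex_of_real ((cmod (h (node L n j)))\<^sup>2) = \<dots>" .
  qed
  also have "\<dots> = (\<Sum>k\<in>?J. \<Sum>l\<in>?J. ?c k * cnj (?c l) * (\<Sum>j\<in>?J. wave L (k - l) (node L n j)))"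
    unfolding sum_distrib_left
    by (subst sum.swap, rule sum.cong[OF refl], subst sum.swap, rule refl)
  also have "\<dots> = (\<Sum>k\<in>?J. \<Sum>l\<in>?J. if l = k then of_nat n ^ 3 * (?c k * cnj (?c k)) else 0)"
  proof (intro sum.cong refl)
    fix k l assume kl: "k \<in> ?J" "l \<in> ?J"
    show "?c k * cnj (?c l) * (\<Sum>j\<in>?J. wave L (k - l) (node L n j)) = (if l
      = k then of_nat n ^ 3 * (?c k * cnj (?c k)) else 0)"
      unfolding sum_wave_node[OF L n] cong_iff_residue[OF n kl(2)] residue_id[OF n kl(1)] by auto
  qed
  also have "\<dots> = (\<Sum>k\<in>?J. of_nat n ^ 3 * complex_of_real ((cmod (?c k))\<^sup>2))"
    unfolding complex_norm_square by (simp add: finite_index_set)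
  finally have "complex_of_real (\<Sum>j\<in>?J. (cmod (h (node L n j)))\<^sup>2)
    = complex_of_real (real n ^ 3 * (\<Sum>k\<in>?J. (cmod (?c k))\<^sup>2))"
    by (simp add: sum_distrib_left)
  then have "(\<Sum>j\<in>?J. (cmod (h (node L n j)))\<^sup>2) = real n ^ 3 * (\<Sum>k\<in>?J. (cmod (?c k))\<^sup>2)"
    by (simp only: of_real_eq_iff)
  then show ?thesis using n by simp
qed

lemma integral_trig_poly_sq:
  assumes L: "L > 0" and J: "finite J"
  shows "(LINT v:cube L|lborel. (cmod (\<Sum>k\<in>J. c k * wave L k v))\<^sup>2) = (2 * L) ^ 3 * (\<Sum>k\<in>J. (cmod (c k))\<^sup>2)"
proof -
  have int: "set_integrable lborel (cube L) (\<lambda>v. c k * cnj (c l) * wave L (k - l) v)" for k l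
    by (intro set_integrable_cube continuous_intros)
  have one: "(LINT v:cube L|lborel. c k * cnj (c l) * wave L (k - l) v) = (if l
    = k then of_real ((2 * L) ^ 3 * (cmod (c k))\<^sup>2) else 0)" for k l
  proof (cases "l = k")
    case True
    then show ?thesis using measure_cube[of L] L
      by (simp add: set_lebesgue_integral_def complex_norm_square[symmetric] scaleR_conv_of_real del:
        of_real_power of_real_mult)
         (simp add: mult.commute)
  next
    case False
    then show ?thesis using integral_wave_cube[OF L, of "k - l"] by simp
  qed
  have "of_real (LINT v:cube L|lborel. (cmod (\<Sum>k\<in>J. c k * wave L k v))\<^sup>2)
    = (LINT v:cube L|lborel. complex_of_real ((cmod (\<Sum>k\<in>J. c k * wave L k v))\<^sup>2))"
    unfolding set_lebesgue_integral_def by (simp flip: integral_complex_of_real add: scaleR_conv_of_real)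
  also have "(\<lambda>v. complex_of_real ((cmod (\<Sum>k\<in>J. c k * wave L k v))\<^sup>2))
    = (\<lambda>v. \<Sum>k\<in>J. \<Sum>l\<in>J. c k * cnj (c l) * wave L (k - l) v)"
    unfolding complex_norm_square cnj_sum sum_product complex_cnj_mult wave_cnj diff_conv_add_uminus wave_add
    by (intro ext sum.cong refl) simp
  also have "(LINT v:cube L|lborel. \<Sum>k\<in>J. \<Sum>l\<in>J. c k * cnj (c l) * wave L (k - l) v) = (\<Sum>k\<in>J. \<Sum>l\<in>J. if l
    = k then of_real ((2 * L) ^ 3 * (cmod (c k))\<^sup>2) else 0)"
    by (simp only: set_integral_sum[OF J] set_integral_sum(1)[OF J int] int one)
  also have "\<dots> = of_real ((2 * L) ^ 3 * (\<Sum>k\<in>J. (cmod (c k))\<^sup>2))"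
    using J by (simp add: sum_distrib_left)
  finally show ?thesis by (simp only: of_real_eq_iff)
qed

lemma interp_wseries_finite:
  "interp L n h v = wseries L (\<lambda>k. if k \<in> index_set n then interp_coeff L n h k else 0) (\<lambda>k. k) v"
  unfolding interp_def wseries_def
  by (subst infsum_cong_neutral[where T="index_set n" and g="\<lambda>k. interp_coeff L n h k * wave L k v"])
     (auto simp: finite_index_set)

lemma summable_on_finite_support:
  fixes g :: "'x \<Rightarrow> real"
  assumes "finite F" "\<And>x. x \<notin> F \<Longrightarrow> g x = 0" shows "g summable_on UNIV"
  using assms summable_on_cong_neutral[of F UNIV g g] by auto

lemma partial_deriv_interp:
  "partial_deriv i (interp L n h) v = (\<Sum>k\<in>index_set n. (dmul L i k * interp_coeff L n h k) * wave L k v)"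
proof -
  have "interp L n h = wseries L (\<lambda>k. if k \<in> index_set n then interp_coeff L n h k else 0) (\<lambda>k. k)"
    by (rule ext) (rule interp_wseries_finite)
  then have "partial_deriv i (interp L n h) v
    = wseries L (\<lambda>k. dmul L i k * (if k \<in> index_set n then interp_coeff L n h k else 0)) (\<lambda>k. k) v"
    by (simp only:) (rule partial_deriv_wseries, rule summable_on_finite_support[OF finite_index_set], auto)
  also have "\<dots> = (\<Sum>k\<in>index_set n. (dmul L i k * interp_coeff L n h k) * wave L k v)"
    unfolding wseries_def
    by (subst infsum_cong_neutral[where T="index_set n" and g="\<lambda>k. dmul L i k * interp_coeff L n h k
      * wave L k v"])
       (auto simp: finite_index_set)
  finally show ?thesis .
qed

text \<open>An inverse inequality: on the frequencies of the interpolant a derivative costs at most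
  \<open>pi / L * n\<close>. Parseval on the cube and on the grid surround this multiplier bound,
  and the mean over the \<open>n ^ 3\<close> nodes is at most the largest nodal value.\<close>

lemma integral_partial_deriv_interp_sq_le:
  assumes L: "L > 0" and n: "even n" "n > 0" and M: "\<And>j. j \<in> index_set n \<Longrightarrow> cmod (h (node L n j)) \<le> M"
  shows "(LINT v:cube L|lborel. (cmod (partial_deriv i (interp L n h) v))\<^sup>2)
    \<le> (2 * L) ^ 3 * (pi / L * real n * M)\<^sup>2"
proof -
  have M0: "M \<ge> 0" using M[OF residue_in_index_set[OF n, of 0]] norm_ge_zero order.trans by blast
  have "(LINT v:cube L|lborel. (cmod (partial_deriv i (interp L n h) v))\<^sup>2)
    = (2 * L) ^ 3 * (\<Sum>k\<in>index_set n. (cmod (dmul L i k * interp_coeff L n h k))\<^sup>2)"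
    unfolding partial_deriv_interp by (rule integral_trig_poly_sq[OF L finite_index_set])
  also have "(\<Sum>k\<in>index_set n. (cmod (dmul L i k * interp_coeff L n h k))\<^sup>2)
    \<le> (\<Sum>k\<in>index_set n. (pi / L * real n)\<^sup>2 * (cmod (interp_coeff L n h k))\<^sup>2)"
  proof (rule sum_mono)
    fix k assume k: "k \<in> index_set n"
    have "\<bar>k $ i\<bar> \<le> int n"
    proof -
      have "- (int n div 2) \<le> k $ i \<and> k $ i < int n div 2" using k by (auto simp: index_set_def)
      then show ?thesis by linarith
    qed
    then have "\<bar>real_of_int (k $ i)\<bar> \<le> real n" by linarith
    then have "cmod (dmul L i k) \<le> pi / L * real n" unfolding norm_dmul using L by (intro mult_mono) auto
    then have "(cmod (dmul L i k))\<^sup>2 \<le> (pi / L * real n)\<^sup>2" by (intro power_mono) auto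
    then show "(cmod (dmul L i k * interp_coeff L n h k))\<^sup>2
      \<le> (pi / L * real n)\<^sup>2 * (cmod (interp_coeff L n h k))\<^sup>2"
      unfolding norm_mult power_mult_distrib[of "cmod _"] by (intro mult_right_mono) auto
  qed
  also have "\<dots> = (pi / L * real n)\<^sup>2 * ((\<Sum>j\<in>index_set n. (cmod (h (node L n j)))\<^sup>2) / real n ^ 3)"
    unfolding sum_distrib_left[symmetric] discrete_parseval[OF L n] ..
  also have "\<dots> \<le> (pi / L * real n)\<^sup>2 * M\<^sup>2"
  proof (intro mult_left_mono)
    have "(\<Sum>j\<in>index_set n. (cmod (h (node L n j)))\<^sup>2) \<le> (\<Sum>j\<in>index_set n. M\<^sup>2)"
      using M by (intro sum_mono power_mono) auto
    also have "\<dots> = real n ^ 3 * M\<^sup>2" by (simp add: card_index_set[OF n])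
    finally show "(\<Sum>j\<in>index_set n. (cmod (h (node L n j)))\<^sup>2) / real n ^ 3 \<le> M\<^sup>2" using n
      by (simp add: divide_le_eq mult.commute)
  qed auto
  finally show ?thesis using L by (simp add: power_mult_distrib power_divide)
qed

text \<open>Meant for frequencies with even coordinates. At the others the folded coefficients are
  set to \<open>0\<close>, so the rounding of \<open>div\<close> is harmless.\<close>

definition half :: "int^3 \<Rightarrow> int^3" where "half k = (\<chi> i. k $ i div 2)"

lemma weight_half_le: "weight (half k) \<le> weight k"
proof (rule weight_mono)
  have "\<bar>z div 2\<bar> \<le> \<bar>z\<bar>" for z :: int by presburger
  then show "\<bar>half k $ i\<bar> \<le> \<bar>k $ i\<bar>" for i by (simp add: half_def)
qed

lemma half_double: "\<forall>i. even (k $ i) \<Longrightarrow> 2 * half k = k"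
  by (simp add: vec_eq_iff half_def)

text \<open>Summing over the translates by the half periods \<open>2 R \<epsilon>\<close>, \<open>\<epsilon> \<in> {0, 1}\<^sup>3\<close>, kills all frequencies
  except the even ones, which are those of the small cube.\<close>
lemma wseries_fold:
  assumes R: "R > 0" and b: "(\<lambda>x. cmod (b x)) summable_on UNIV"
    and z: "\<And>e. (\<forall>i. e $ i \<in> {0, 1}) \<Longrightarrow> e \<noteq> 0 \<Longrightarrow> wseries (2 * R) b \<kappa> (v + (2 * R) *\<^sub>R real_vec e) = 0"
  shows "wseries (2 * R) b \<kappa> v = wseries R (\<lambda>x. if \<forall>i. even (\<kappa> x $ i) then 8 * b x else 0) (\<lambda>x. half (\<kappa> x)) v"
proof -
  define E where "E = {e :: int^3. \<forall>i. e $ i \<in> {0, 1}}"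
  have finE: "finite E"
  proof (rule finite_subset)
    show "E \<subseteq> index_set 4"
    proof
      fix e assume "e \<in> E"
      then have "e $ i = 0 \<or> e $ i = 1" for i by (auto simp: E_def)
      then have "- 2 \<le> e $ i \<and> e $ i < 2" for i
        by (metis add_0 neg_le_0_iff_le one_less_numeral_iff order.trans semiring_norm(76)
          zero_le_numeral zero_le_one zero_less_numeral)
      then show "e \<in> index_set 4" by (simp add: index_set_def)
    qed
  qed (rule finite_index_set)
  \<comment> \<open>The sum factorises over the coordinates into factors
    \<open>1 + cis (pi * k $ i)\<close>, each equal to \<open>2\<close> or \<open>0\<close>; this is
    the origin of the factor \<open>8\<close>.\<close>
  have sumE: "(\<Sum>e\<in>E. wave (2 * R) k ((2 * R) *\<^sub>R real_vec e)) = (if \<forall>i. even (k $ i) then 8 else 0)" for k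
  proof -
    have w: "wave (2 * R) k ((2 * R) *\<^sub>R real_vec e)
      = (\<Prod>i\<in>UNIV. cis (pi * real_of_int (k $ i * e $ i)))" for e
      using R by (simp add: wave_cis prod_cis inner_vec_def sum_distrib_left)
    have "(\<Sum>e\<in>E. wave (2 * R) k ((2 * R) *\<^sub>R real_vec e))
      = (\<Prod>i\<in>UNIV. \<Sum>b\<in>{0, 1}. cis (pi * real_of_int (k $ i * b)))"
      unfolding E_def w by (rule sum_vec_prod[where \<phi>="\<lambda>i b. cis (pi * real_of_int (k $ i * b))"]) simp
    also have "\<dots> = (\<Prod>i\<in>UNIV. if even (k $ i) then 2 else 0)"
    proof (rule prod.cong[OF refl])
      fix i
      show "(\<Sum>b\<in>{0, 1}. cis (pi * real_of_int (k $ i * b))) = (if even (k $ i) then 2 else 0)"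
        by (auto elim!: evenE oddE simp: complex_eq_iff distrib_left cos_add sin_add)
    qed
    also have "\<dots> = (if \<forall>i. even (k $ i) then 8 else 0)" by (auto simp: prod_zero_iff)
    finally show ?thesis .
  qed
  have "((\<lambda>x. \<Sum>e\<in>E. b x * wave (2 * R) (\<kappa> x) (v + (2 * R) *\<^sub>R real_vec e)) has_sum
     (\<Sum>e\<in>E. wseries (2 * R) b \<kappa> (v + (2 * R) *\<^sub>R real_vec e))) UNIV"
    by (intro has_sum_finite_sum finE has_sum_wseries b)
  also have "(\<Sum>e\<in>E. wseries (2 * R) b \<kappa> (v + (2 * R) *\<^sub>R real_vec e)) = (\<Sum>e\<in>E. if e
    = 0 then wseries (2 * R) b \<kappa> v else 0)"
    by (intro sum.cong refl) (use z in \<open>auto simp: E_def\<close>)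
  also have "\<dots> = wseries (2 * R) b \<kappa> v"
    using finE by (simp add: E_def)
  also have "(\<lambda>x. \<Sum>e\<in>E. b x * wave (2 * R) (\<kappa> x) (v + (2 * R) *\<^sub>R real_vec e)) =
     (\<lambda>x. (if \<forall>i. even (\<kappa> x $ i) then 8 * b x else 0) * wave R (half (\<kappa> x)) v)"
  proof
    fix x
    have "(\<Sum>e\<in>E. b x * wave (2 * R) (\<kappa> x) (v + (2 * R) *\<^sub>R real_vec e))
      = b x * wave (2 * R) (\<kappa> x) v * (\<Sum>e\<in>E. wave (2 * R) (\<kappa> x) ((2 * R) *\<^sub>R real_vec e))"
      by (simp add: wave_add_right sum_distrib_left mult.assoc)
    also have "\<dots> = (if \<forall>i. even (\<kappa> x $ i) then 8 * b x else 0) * wave R (half (\<kappa> x)) v"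
    proof (cases "\<forall>i. even (\<kappa> x $ i)")
      case True
      have "wave (2 * R) (\<kappa> x) v = wave (2 * R) (2 * half (\<kappa> x)) v" by (simp only: half_double[OF True])
      then show ?thesis using True unfolding sumE wave_double by simp
    next
      case False
      show ?thesis unfolding sumE by (simp only: if_not_P[OF False] mult_zero_left mult_zero_right)
    qed
    finally show "(\<Sum>e\<in>E. b x * wave (2 * R) (\<kappa> x) (v + (2 * R) *\<^sub>R real_vec e)) = \<dots>" .
  qed
  finally have "((\<lambda>x. (if \<forall>i. even (\<kappa> x $ i) then 8 * b x else 0) * wave R (half (\<kappa> x)) v)
    has_sum wseries (2 * R) b \<kappa> v) UNIV" .
  then show ?thesis unfolding wseries_def[of R] by (simp add: infsumI)
qed

section \<open>Sobolev functions as wave series\<close>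

lemma fourier_ball_eq_FT:
  assumes "\<And>x. x \<notin> ball 0 R \<Longrightarrow> f x = 0" "r \<ge> R"
  shows "fourier_ball r f \<xi> = of_real ((2 * pi) powr (-3/2)) * FT f \<xi>"
proof -
  have "(LINT x:cball 0 r|lborel. f x * cis (- (x \<bullet> \<xi>))) = FT f \<xi>"
    unfolding FT_def set_lebesgue_integral_def
  proof (rule Bochner_Integration.integral_cong[OF refl])
    fix x :: "real^3"
    show "indicator (cball 0 r) x *\<^sub>R (f x * cis (- (x \<bullet> \<xi>))) = f x * cis (- (x \<bullet> \<xi>))"
      using assms(1)[of x] assms(2) by (cases "x \<in> ball 0 R") auto
  qed
  then show ?thesis by (simp add: fourier_ball_def)
qed

text \<open>For compact support the integrals over balls are constant from radius \<open>R\<close>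
  on, so the mean-square limit forces \<open>F\<close> to agree almost everywhere with the
  normalised Fourier integral.\<close>

lemma fourier_transform_eq_FT:
  assumes f: "continuous_on UNIV f" "\<And>x. x \<notin> ball 0 R \<Longrightarrow> f x = 0" and F: "is_fourier_transform f F"
  shows "AE \<xi> in lborel. F \<xi> = of_real ((2 * pi) powr (-3/2)) * FT f \<xi>" and "F \<in> borel_measurable borel"
proof -
  have [measurable]: "f \<in> borel_measurable borel" using f(1) by (rule borel_measurable_continuous_onI)
  show F_meas[measurable]: "F \<in> borel_measurable borel"
    using F by (simp add: is_fourier_transform_def square_integrable_def set_borel_measurable_def)
  let ?F = "\<lambda>\<xi>. of_real ((2 * pi) powr (-3/2)) * FT f \<xi>"
  define I where "I = (\<integral>\<^sup>+ \<xi>. ennreal ((cmod (?F \<xi> - F \<xi>))\<^sup>2) \<partial>lborel)"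
  have "\<forall>\<^sub>F r in at_top. (\<integral>\<^sup>+ \<xi>. ennreal ((cmod (fourier_ball r f \<xi> - F \<xi>))\<^sup>2) \<partial>lborel) = I"
    using eventually_ge_at_top[of R]
  proof eventually_elim
    case (elim r)
    have "fourier_ball r f \<xi> = ?F \<xi>" for \<xi>
      by (rule fourier_ball_eq_FT[OF _ elim]) (rule f(2))
    then show ?case by (simp add: I_def)
  qed
  moreover have "((\<lambda>r. \<integral>\<^sup>+ \<xi>. ennreal ((cmod (fourier_ball r f \<xi> - F \<xi>))\<^sup>2) \<partial>lborel) \<longlongrightarrow> 0) at_top"
    using F by (simp add: is_fourier_transform_def)
  ultimately have "((\<lambda>r :: real. I) \<longlongrightarrow> 0) at_top" by (rule Lim_transform_eventually[rotated])
  then have "I = 0" by (simp add: tendsto_const_iff)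
  then have "AE \<xi> in lborel. ennreal ((cmod (?F \<xi> - F \<xi>))\<^sup>2) = 0"
    unfolding I_def by (subst (asm) nn_integral_0_iff_AE) measurable
  then show "AE \<xi> in lborel. F \<xi> = of_real ((2 * pi) powr (-3/2)) * FT f \<xi>"
    by eventually_elim auto
qed

text \<open>Every admissible transform agrees almost everywhere with the normalised
  \<open>FT f\<close>, so the arbitrary choice in \<open>fourier_transform\<close> does not affect
  the norm. The factor is the inverse of the unitary normalisation.\<close>

lemma sobolev_FT:
  assumes f: "continuous_on UNIV f" "\<And>x. x \<notin> ball 0 R \<Longrightarrow> f x = 0" and p: "f \<in> sobolev_space p" and s: "s \<le> p"
  shows "integrable lborel (energy s (FT f))"
    and "sqrt (integral\<^sup>L lborel (energy s (FT f))) = (2 * pi) powr (3/2) * sobolev_norm s f"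
proof -
  define c where "c = (2 * pi) powr (-3/2)"
  have c: "c > 0" by (simp add: c_def)
  have [measurable]: "f \<in> borel_measurable borel" using f(1) by (rule borel_measurable_continuous_onI)
  have eq: "AE \<xi> in lborel. energy s F \<xi> = c\<^sup>2 * (energy s (FT f) \<xi>)"
    if "is_fourier_transform f F" for F s
  proof -
    have "AE \<xi> in lborel. F \<xi> = of_real ((2 * pi) powr (-3/2)) * FT f \<xi>"
      by (rule fourier_transform_eq_FT(1)[OF f(1) _ that]) (rule f(2))
    then show ?thesis
      by eventually_elim (simp add: norm_mult power_mult_distrib c_def)
  qed
  obtain F where F: "is_fourier_transform f F" "integrable lborel (energy p F)"
    using p by (auto simp: sobolev_space_def)
  have [measurable]: "F \<in> borel_measurable borel"
    by (rule fourier_transform_eq_FT(2)[OF f(1) _ F(1)]) (rule f(2))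
  have "integrable lborel (\<lambda>\<xi>. c\<^sup>2 * (energy p (FT f) \<xi>))"
    using F(2) by (subst integrable_cong_AE[OF _ _ eq[OF F(1)], symmetric]) measurable
  then have ip: "integrable lborel (energy p (FT f))"
    using c by simp
  show "integrable lborel (energy s (FT f))"
  proof (rule Bochner_Integration.integrable_bound[OF ip])
    have "energy s (FT f) \<xi> \<le> energy p (FT f) \<xi>" for \<xi> :: "real^3"
      using s by (intro mult_right_mono powr_mono) auto
    then show "AE \<xi> in lborel. norm (energy s (FT f) \<xi>) \<le> norm (energy p (FT f) \<xi>)"
      by (intro AE_I2) auto
  qed measurable
  define G where "G = fourier_transform f"
  have G: "is_fourier_transform f G" unfolding G_def fourier_transform_def
    by (rule someI[where P="is_fourier_transform f", OF F(1)])
  have [measurable]: "G \<in> borel_measurable borel"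
    by (rule fourier_transform_eq_FT(2)[OF f(1) _ G]) (rule f(2))
  have "(integral\<^sup>L lborel (energy s G)) = (LINT \<xi>|lborel. c\<^sup>2 * (energy s (FT f) \<xi>))"
    by (rule integral_cong_AE[OF _ _ eq[OF G]]) measurable
  then have "sobolev_norm s f = c * sqrt (integral\<^sup>L lborel (energy s (FT f)))"
    unfolding sobolev_norm_def G_def[symmetric] using c by (simp add: real_sqrt_mult)
  moreover have "(2 * pi) powr (3/2) * c = 1" unfolding c_def by (simp add: powr_add[symmetric])
  ultimately show "sqrt (integral\<^sup>L lborel (energy s (FT f))) = (2 * pi) powr (3/2) * sobolev_norm s f"
    by (simp add: mult.assoc[symmetric])
qed

text \<open>Both sides are continuous, so the identity extends from the interior. Boundary points
  matter: nodes of the doubled grid lie on the faces with coordinate \<open>- L\<close>.\<close>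

lemma inversion_on_closed_cube:
  assumes L: "L > 0" and f: "continuous_on UNIV f"
    and a: "\<And>k. a k = (LINT u:cube L|lborel. f u * wave L (- k) u) / of_real ((2 * L) ^ 3)"
    and sm: "(\<lambda>k. cmod (a k)) summable_on UNIV" and v: "v \<in> cube L"
  shows "f v = wseries L a (\<lambda>k. k) v"
proof -
  have "closed {v. f v = wseries L a (\<lambda>k. k) v}"
    by (intro closed_Collect_eq f continuous_on_wseries sm)
  moreover have "interior (cube L) \<subseteq> {v. f v = wseries L a (\<lambda>k. k) v}"
    using fourier_inversion_cube[OF L continuous_on_subset[OF f] a sm] by auto
  ultimately have "closure (interior (cube L)) \<subseteq> {v. f v = wseries L a (\<lambda>k. k) v}"
    by (simp add: closure_minimal)
  moreover have "closure (interior (cube L)) = cube L"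
  proof -
    have "(0 :: real^3) \<in> interior (cube L)" using L by (simp add: interior_cube)
    then show ?thesis unfolding cube_def interior_cbox by (intro closure_box) auto
  qed
  ultimately show ?thesis using v by auto
qed

text \<open>The collar of width \<open>2 * d\<close> between the support of \<open>f\<close> and the
  faces of the small cube keeps \<open>f\<close> apart from its periodic images with room to spare,
  so that the series identities extend to an open neighbourhood of that cube.\<close>

locale periodic_series =
  fixes R d :: real and f :: "real^3 \<Rightarrow> complex" and a :: "int^3 \<Rightarrow> complex"
  assumes R: "R > 0" and d: "0 < d" "2 * d \<le> R"
    and summable_weight2_a: "(\<lambda>k. (weight k)\<^sup>2 * cmod (a k)) summable_on UNIV"
    and f_eq: "\<And>v. v \<in> cube (2 * R) \<Longrightarrow> f v = wseries (2 * R) a (\<lambda>k. k) v"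
    and f_0: "\<And>v. v \<notin> cube (R - 2 * d) \<Longrightarrow> f v = 0"
begin

abbreviation "fper \<equiv> wseries (2 * R) a (\<lambda>k. k)"

text \<open>Half of the collar is used to enlarge the closed cube to an open set, on which series
  may be differentiated in place of the functions; the other half keeps inequalities valid.\<close>

definition U :: "(real^3) set" where "U = {v. \<forall>i. \<bar>v $ i\<bar> < R + d}"

lemma open_U: "open U"
  unfolding U_def interior_cube[symmetric] by simp

lemma cube_subset_U: "cube R \<subseteq> U"
proof
  fix x assume "x \<in> cube R"
  then have *: "\<bar>x $ i\<bar> \<le> R" for i by (auto simp: mem_cube)
  have "R < R + d" using d by simp
  with * have "\<bar>x $ i\<bar> < R + d" for i by (rule order.strict_trans1)
  then show "x \<in> U" by (simp add: U_def)
qed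

lemma summable_weight_a: "(\<lambda>k. weight k * cmod (a k)) summable_on UNIV"
proof (rule summable_on_comparison_test[OF summable_weight2_a])
  show "weight k * cmod (a k) \<le> (weight k)\<^sup>2 * cmod (a k)" for k
    using self_le_power[of "weight k" 2] by (intro mult_right_mono) auto
qed auto

lemma summable_a: "(\<lambda>k. cmod (a k)) summable_on UNIV"
proof (rule summable_on_comparison_test[OF summable_weight_a])
  show "cmod (a k) \<le> weight k * cmod (a k)" for k
    using mult_right_mono[OF weight_ge_1[of k] norm_ge_zero[of "a k"]] by simp
qed auto

text \<open>Along each axis the nearest periodic image of the support begins at
  \<open>3 * R + 2 * d\<close>. One coordinate in the gap is enough: rounding moves \<open>x\<close>
  into the fundamental cube and keeps that coordinate outside the support.\<close>

lemma fper_zero: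
  assumes x: "R - 2 * d < \<bar>x $ i\<bar>" "\<bar>x $ i\<bar> < 3 * R + 2 * d"
  shows "fper x = 0"
proof -
  define z :: "int^3" where "z = (\<chi> j. - round (x $ j / (4 * R)))"
  define y where "y = x + (2 * (2 * R)) *\<^sub>R real_vec z"
  have yj: "y $ j = x $ j - 4 * R * real_of_int (round (x $ j / (4 * R)))" for j
    by (simp add: y_def z_def)
  have y: "y \<in> cube (2 * R)"
    unfolding mem_cube
  proof
    fix j
    have "y $ j = 4 * R * (x $ j / (4 * R) - real_of_int (round (x $ j / (4 * R))))"
      using R by (simp add: yj right_diff_distrib)
    then have "\<bar>y $ j\<bar> = 4 * R * \<bar>of_int (round (x $ j / (4 * R))) - x $ j / (4 * R)\<bar>"
      using R by (simp add: abs_mult abs_minus_commute)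
    also have "\<dots> \<le> 4 * R * (1 / 2)" using R of_int_round_abs_le by (intro mult_left_mono) auto
    finally show "\<bar>y $ j\<bar> \<le> 2 * R" by simp
  qed
  have "\<bar>y $ i\<bar> > R - 2 * d"
  proof -
    define q where "q = round (x $ i / (4 * R))"
    have yi: "y $ i = x $ i - 4 * R * real_of_int q" by (simp add: yj q_def)
    consider "q = 0" | "q \<ge> 1" | "q \<le> -1" by linarith
    then show ?thesis
    proof cases
      case 1 then show ?thesis using x yi by simp
    next
      case 2
      then have "4 * R * real_of_int q \<ge> 4 * R" using R by simp
      then show ?thesis using x yi by linarith
    next
      case 3
      then have "real_of_int q \<le> -1" by linarith
      then have "4 * R * real_of_int q \<le> 4 * R * (-1)" using R by (intro mult_left_mono) auto
      then show ?thesis using x yi by linarith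
    qed
  qed
  then have "y \<notin> cube (R - 2 * d)" by (auto simp: mem_cube not_le)
  then have "fper y = 0" using f_0 f_eq[OF y] by simp
  moreover have "fper y = fper x" unfolding y_def wseries_def using R by (simp only: wave_translate)
  ultimately show ?thesis by simp
qed

lemma f_eq_fper:
  assumes "\<And>i. \<bar>x $ i\<bar> < 3 * R + 2 * d"
  shows "f x = fper x"
proof (cases "x \<in> cube (2 * R)")
  case False
  then obtain i where i: "\<bar>x $ i\<bar> > 2 * R" by (auto simp: mem_cube not_le)
  then have "x \<notin> cube (R - 2 * d)" using R d by (auto simp: mem_cube not_le intro!: exI[of _ i])
  moreover have "fper x = 0" using i assms R d by (intro fper_zero[of x i]) auto
  ultimately show ?thesis using f_0 by simp
qed (rule f_eq)

lemma f_eq_fper_U: "x \<in> U \<Longrightarrow> f x = fper x"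
  using R d by (intro f_eq_fper) (force simp: U_def intro: order.strict_trans)

abbreviation "gper \<equiv> wseries (2 * R) (\<lambda>k. a k * psi_coeff R k) (\<lambda>k. k)"

text \<open>For \<open>v\<close> in \<open>U\<close> the truncated kernel reaches only points with
  coordinates below \<open>3 * R + d\<close>, where \<open>f\<close> and its periodic extension
  agree. This is what doubling the cube achieves; termwise integration then multiplies each
  coefficient by the one of the kernel.\<close>

lemma g_trunc_eq:
  assumes v: "v \<in> U" shows "g_trunc R f v = gper v"
proof -
  define w where "w = (\<lambda>z. complex_of_real (psi_trunc R z))"
  have w: "integrable lborel w"
  proof -
    have "integrable lborel (\<lambda>z. indicator (cube (2 * R)) z *\<^sub>R complex_of_real (norm z))"
      using set_integrable_cube[of "2 * R" "\<lambda>z. complex_of_real (norm z)"]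
        by (auto simp: set_integrable_def intro!: continuous_intros)
    then show ?thesis by (simp add: w_def psi_trunc_def scaleR_conv_of_real)
  qed
  have rfl: "lborel = distr lborel borel (\<lambda>z :: real^3. v - z)"
    using lborel_affine[of "-1" v] by (simp add: density_1)
  have fm: "fper \<in> borel_measurable borel"
    by (intro borel_measurable_continuous_onI continuous_on_wseries summable_a)
  have wm: "w \<in> borel_measurable borel" using borel_measurable_integrable[OF w] by simp
  have "g_trunc R f v = (LINT u|lborel. w (v - u) * fper u)"
    unfolding g_trunc_def
  proof (rule Bochner_Integration.integral_cong[OF refl])
    fix u
    show "complex_of_real (psi_trunc R (v - u)) * f u = w (v - u) * fper u"
    proof (cases "v - u \<in> cube (2 * R)")
      case True
      have "\<bar>u $ i\<bar> < 3 * R + 2 * d" for i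
      proof -
        have "\<bar>v $ i - u $ i\<bar> \<le> 2 * R" using True by (auto simp: mem_cube)
        moreover have "\<bar>v $ i\<bar> < R + d" using v by (auto simp: U_def)
        ultimately show ?thesis using d by linarith
      qed
      then have "f u = fper u" by (rule f_eq_fper)
      then show ?thesis by (simp add: w_def)
    qed (simp add: w_def psi_trunc_def)
  qed
  also have "\<dots> = (LINT z|distr lborel borel (\<lambda>z. v - z). w z * fper (v - z))"
    using fm wm by (subst integral_distr) auto
  also have "\<dots> = (LINT z|lborel. w z * fper (v - z))" using rfl by simp
  also have "(\<lambda>z. fper (v - z)) = wseries (2 * R) (\<lambda>k. a k * wave (2 * R) k v) (\<lambda>k. - k)"
    unfolding wseries_def by (rule ext) (simp only: diff_conv_add_uminus wave_add_right wave_uminus_right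
      mult.assoc)
  finally have "g_trunc R f v = (LINT z|lborel. w z * wseries (2 * R) (\<lambda>k. a k * wave (2 * R) k v) (\<lambda>k.
    - k) z)" .
  moreover have "((\<lambda>k. a k * wave (2 * R) k v * (LINT z|lborel. w z * wave (2 * R) (- k) z)) has_sum
      (LINT z|lborel. w z * wseries (2 * R) (\<lambda>k. a k * wave (2 * R) k v) (\<lambda>k. - k) z)) UNIV"
    by (rule has_sum_integral_wseries[OF w]) (simp add: norm_mult summable_a)
  moreover have "(LINT z|lborel. w z * wave (2 * R) (- k) z) = psi_coeff R k" for k
    unfolding psi_coeff_def set_lebesgue_integral_def w_def psi_trunc_def
    by (intro Bochner_Integration.integral_cong) (auto simp: indicator_def)
  ultimately have "((\<lambda>k. a k * wave (2 * R) k v * psi_coeff R k) has_sum g_trunc R f v) UNIV" by simp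
  then show ?thesis unfolding wseries_def by (simp add: infsumI[symmetric] mult_ac)
qed

end

section \<open>The Landau flux\<close>

lemma wseries_sum:
  assumes "finite I" "\<And>i. i \<in> I \<Longrightarrow> (\<lambda>x. cmod (b i x)) summable_on UNIV"
  shows "(\<Sum>i\<in>I. wseries L (b i) \<kappa> v) = wseries L (\<lambda>x. \<Sum>i\<in>I. b i x) \<kappa> v"
proof -
  have "((\<lambda>x. \<Sum>i\<in>I. b i x * wave L (\<kappa> x) v) has_sum (\<Sum>i\<in>I. wseries L (b i) \<kappa> v)) UNIV"
    by (intro has_sum_finite_sum assms has_sum_wseries)
  then show ?thesis by (simp add: wseries_def sum_distrib_right infsumI)
qed

lemma wseries_diff:
  assumes b: "(\<lambda>x. cmod (b x)) summable_on UNIV" and c: "(\<lambda>x. cmod (c x)) summable_on UNIV"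
  shows "((\<lambda>x. b x * wave L (\<kappa> x) v - c x * wave L (\<mu> x) v) has_sum (wseries L b \<kappa> v - wseries L c \<mu> v)) UNIV"
  unfolding diff_conv_add_uminus
  by (intro has_sum_add has_sum_wseries b) (simp add: has_sum_uminus has_sum_wseries c)

lemma norm_wseries_diff_le:
  assumes b: "(\<lambda>x. cmod (b x)) summable_on UNIV" and c: "(\<lambda>x. cmod (c x)) summable_on UNIV"
    and \<beta>: "\<beta> summable_on UNIV" "\<And>x. cmod (b x * wave L (\<kappa> x) v - c x * wave L (\<mu> x) v) \<le> \<beta> x"
  shows "cmod (wseries L b \<kappa> v - wseries L c \<mu> v) \<le> (\<Sum>\<^sub>\<infinity>x. \<beta> x)"
  by (rule norm_infsum_le[OF wseries_diff[OF b c] has_sum_infsum[OF \<beta>(1)]]) (rule \<beta>(2))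

text \<open>Series and interpolant differ only in the terms with frequency outside the index set.
  There both derivatives obey the same bound, since residues do not increase weights; hence the
  factor \<open>2\<close>. The majorant \<open>\<beta>\<close> leaves open how the tail is
  measured.\<close>

lemma residue_derivative_bound:
  assumes R: "R > 0" and n: "even n" "n > 0"
    and b: "(\<lambda>x. weight (\<kappa> x) * cmod (b x)) summable_on UNIV"
    and \<beta>: "\<beta> summable_on UNIV" "\<And>x. \<beta> x \<ge> 0" "\<And>x. \<kappa> x \<notin> index_set n \<Longrightarrow> weight (\<kappa> x) * cmod (b x) \<le> \<beta> x"
  shows "cmod (partial_deriv i (wseries R b \<kappa>) v - partial_deriv i (wseries R b (\<lambda>x. residue n (\<kappa> x))) v)
     \<le> 2 * (pi / R) * (\<Sum>\<^sub>\<infinity>x. \<beta> x)"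
proof -
  have b': "(\<lambda>x. weight (residue n (\<kappa> x)) * cmod (b x)) summable_on UNIV"
    by (rule summable_on_comparison_test[OF b]) (auto intro!: mult_right_mono weight_residue_le n)
  have le: "cmod (dmul R i (\<kappa> x) * b x) \<le> pi / R * (weight (\<kappa> x) * cmod (b x))"
    "cmod (dmul R i (residue n (\<kappa> x)) * b x) \<le> pi / R * (weight (\<kappa> x) * cmod (b x))" for x
  proof -
    show "cmod (dmul R i (\<kappa> x) * b x) \<le> pi / R * (weight (\<kappa> x) * cmod (b x))"
      using mult_right_mono[OF norm_dmul_le[of R i "\<kappa> x"], of "cmod (b x)"] R by (simp add: norm_mult)
    have "cmod (dmul R i (residue n (\<kappa> x))) \<le> \<bar>pi / R\<bar> * weight (residue n (\<kappa> x))" by (rule norm_dmul_le)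
    also have "\<dots> \<le> \<bar>pi / R\<bar> * weight (\<kappa> x)" by (intro mult_left_mono weight_residue_le n) simp
    finally have "cmod (dmul R i (residue n (\<kappa> x))) * cmod (b x) \<le> \<bar>pi / R\<bar> * weight (\<kappa> x) * cmod (b x)"
      by (rule mult_right_mono) simp
    then show "cmod (dmul R i (residue n (\<kappa> x)) * b x) \<le> pi / R * (weight (\<kappa> x) * cmod (b x))"
      using R by (simp add: norm_mult)
  qed
  have s: "(\<lambda>x. pi / R * (weight (\<kappa> x) * cmod (b x))) summable_on UNIV"
    by (rule summable_on_cmult_right[OF b])
  have "cmod (wseries R (\<lambda>x. dmul R i (\<kappa> x) * b x) \<kappa> v - wseries R (\<lambda>x. dmul R i (residue n (\<kappa> x)) * b x)
    (\<lambda>x. residue n (\<kappa> x)) v)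
      \<le> (\<Sum>\<^sub>\<infinity>x. 2 * (pi / R) * \<beta> x)"
  proof (rule norm_wseries_diff_le)
    show "(\<lambda>x. cmod (dmul R i (\<kappa> x) * b x)) summable_on UNIV"
      by (rule summable_on_comparison_test[OF s]) (use le in auto)
    show "(\<lambda>x. cmod (dmul R i (residue n (\<kappa> x)) * b x)) summable_on UNIV"
      by (rule summable_on_comparison_test[OF s]) (use le in auto)
    show "(\<lambda>x. 2 * (pi / R) * \<beta> x) summable_on UNIV" by (rule summable_on_cmult_right[OF \<beta>(1)])
    fix x
    show "cmod (dmul R i (\<kappa> x) * b x * wave R (\<kappa> x) v - dmul R i (residue n (\<kappa> x)) * b x * wave R
      (residue n (\<kappa> x)) v) \<le> 2 * (pi / R) * \<beta> x"
    proof (cases "\<kappa> x \<in> index_set n")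
      case True
      then show ?thesis using residue_id[OF n True] \<beta>(2)[of x] R by simp
    next
      case False
      have "cmod (dmul R i (\<kappa> x) * b x * wave R (\<kappa> x) v - dmul R i (residue n (\<kappa> x)) * b x * wave R
        (residue n (\<kappa> x)) v)
        \<le> cmod (dmul R i (\<kappa> x) * b x) + cmod (dmul R i (residue n (\<kappa> x)) * b x)"
        by (rule order.trans[OF norm_triangle_ineq4]) (simp add: norm_mult)
      also have "\<dots> \<le> pi / R * (weight (\<kappa> x) * cmod (b x)) + pi / R * (weight (\<kappa> x) * cmod (b x))"
        by (intro add_mono le)
      also have "\<dots> = 2 * (pi / R) * (weight (\<kappa> x) * cmod (b x))" by simp
      also have "\<dots> \<le> 2 * (pi / R) * \<beta> x" using \<beta>(3)[OF False] R by (intro mult_left_mono) auto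
      finally show ?thesis .
    qed
  qed
  also have "(\<Sum>\<^sub>\<infinity>x. 2 * (pi / R) * \<beta> x) = 2 * (pi / R) * (\<Sum>\<^sub>\<infinity>x. \<beta> x)"
    by (rule infsum_cmult_right) (use \<beta>(1) in auto)
  finally show ?thesis by (simp add: partial_deriv_wseries[OF b] partial_deriv_wseries[OF b'])
qed

lemma landau_flux_nth:
  "landau_flux g f v $ i = (\<Sum>j\<in>UNIV. hessian g v $ i $ j * gradient f v $ j) - f v * gradient
    (laplacian g) v $ i"
  by (simp add: landau_flux_def matrix_vector_mult_def vector_scalar_mult_def)

lemma landau_flux_cong_open:
  assumes U: "open U" "v \<in> U" and g: "\<And>x. x \<in> U \<Longrightarrow> g x = g' x" and f: "\<And>x. x \<in> U \<Longrightarrow> f x = f' x"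
  shows "landau_flux g f v = landau_flux g' f' v"
proof -
  have 1: "partial_deriv i g x = partial_deriv i g' x" "partial_deriv i f x = partial_deriv i f' x"
    if "x \<in> U" for i x
    using partial_deriv_cong_open[OF U(1) that] g f by blast+
  have 2: "partial_deriv i (partial_deriv j g) x = partial_deriv i (partial_deriv j g') x"
    if "x \<in> U" for i j x
    using partial_deriv_cong_open[OF U(1) that] 1 by blast
  have 3: "laplacian g x = laplacian g' x" if "x \<in> U" for x
    using 2[OF that] by (simp add: laplacian_def)
  have 4: "partial_deriv i (laplacian g) v = partial_deriv i (laplacian g') v" for i
    using partial_deriv_cong_open[OF U] 3 by blast
  show ?thesis using 1(2)[OF U(2)] 2[OF U(2)] 4 f[OF U(2)]
    by (simp add: landau_flux_def hessian_def gradient_def)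
qed

lemma landau_flux_zero:
  assumes U: "open U" "v \<in> U" and f: "\<And>x. x \<in> U \<Longrightarrow> f x = 0"
  shows "landau_flux g f v = 0"
proof -
  have "partial_deriv i f v = partial_deriv i (\<lambda>_. 0) v" for i
    by (rule partial_deriv_cong_open[OF U f])
  then have "partial_deriv i f v = 0" for i by (simp add: partial_deriv_def)
  then show ?thesis using f[OF U(2)]
    by (simp add: vec_eq_iff landau_flux_nth gradient_def)
qed

lemma weight_add_le: "weight (k + l) \<le> weight k + weight l"
  using norm_triangle_ineq[of "real_vec k" "real_vec l"] by (simp add: weight_def)

lemma node_in_cube:
  assumes R: "R > 0" and n: "even n" "n > 0" and j: "j \<in> index_set n"
  shows "node R n j \<in> cube R"
  unfolding mem_cube
proof
  fix i
  have "- (int n div 2) \<le> j $ i \<and> j $ i < int n div 2" using j by (auto simp: index_set_def)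
  moreover have "int n = 2 * (int n div 2)" using n by simp
  ultimately have "2 * \<bar>j $ i\<bar> \<le> int n" by linarith
  then have "2 * \<bar>real_of_int (j $ i)\<bar> \<le> real n" by linarith
  then show "\<bar>node R n j $ i\<bar> \<le> R"
    using R n by (simp add: node_def abs_mult field_simps)
qed

section \<open>Series for the potential and the flux\<close>

locale collocation = periodic_series +
  fixes P p :: real and n :: nat
  assumes P: "P > 0" and psi: "\<And>k. cmod (psi_coeff R k) \<le> P / (weight k)\<^sup>2"
    and n: "even n" "n > 0" and p: "p \<ge> 4"
    and summable_powr_a: "(\<lambda>k. weight k powr (p - 2) * cmod (a k)) summable_on UNIV"
begin

definition c :: real where "c = pi / (2 * R)"
lemma c_pos: "c > 0" using R by (simp add: c_def)

abbreviation "D \<equiv> dmul (2 * R)"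
definition lap :: "int^3 \<Rightarrow> complex" where "lap k = (\<Sum>m\<in>UNIV. D m k * D m k)"
text \<open>\<open>S1\<close> will be bounded by \<open>sobolev_norm p f\<close> and
  \<open>S2\<close> by \<open>sobolev_norm 4 f\<close>; its exponent is
  \<open>2 = 4 - 2\<close>.\<close>

definition S1 :: real where "S1 = (\<Sum>\<^sub>\<infinity>k. weight k powr (p - 2) * cmod (a k))"
definition S2 :: real where "S2 = (\<Sum>\<^sub>\<infinity>k. (weight k)\<^sup>2 * cmod (a k))"

lemma S1_nonneg: "S1 \<ge> 0" unfolding S1_def by (intro infsum_nonneg) auto
lemma S2_nonneg: "S2 \<ge> 0" unfolding S2_def by (intro infsum_nonneg) auto

lemma norm_D: "cmod (D i k) \<le> c * weight k"
  using norm_dmul_le[of "2 * R" i k] R by (simp add: c_def)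

lemma norm_lap: "cmod (lap k) \<le> 3 * c\<^sup>2 * (weight k)\<^sup>2"
proof -
  have "cmod (lap k) \<le> (\<Sum>m\<in>(UNIV :: 3 set). (c * weight k) * (c * weight k))"
    unfolding lap_def using c_pos by (intro order.trans[OF norm_sum] sum_mono)
      (auto simp: norm_mult intro!: mult_mono norm_D)
  then show ?thesis by (simp add: power2_eq_square mult_ac)
qed

lemma infsum_weight_le_S2: "(\<Sum>\<^sub>\<infinity>k. weight k * cmod (a k)) \<le> S2"
  unfolding S2_def by (intro infsum_mono summable_weight_a summable_weight2_a mult_right_mono)
    (auto intro: self_le_power)

lemma infsum_norm_le_S2: "(\<Sum>\<^sub>\<infinity>k. cmod (a k)) \<le> S2"
proof -
  have "(\<Sum>\<^sub>\<infinity>k. cmod (a k)) \<le> (\<Sum>\<^sub>\<infinity>k. weight k * cmod (a k))"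
  proof (intro infsum_mono summable_a summable_weight_a)
    show "cmod (a k) \<le> weight k * cmod (a k)" for k
      using mult_right_mono[OF weight_ge_1[of k] norm_ge_zero[of "a k"]] by simp
  qed
  then show ?thesis using infsum_weight_le_S2 by linarith
qed

text \<open>Stated for general \<open>\<kappa>\<close> and \<open>b\<close> to cover both the exact
  potential, with unchanged frequencies, and the discrete one, with residues modulo
  \<open>2 * n\<close>. Hypothesis \<open>B\<close> is the kernel decay at the frequency actually
  used: two derivatives come for free and a third costs one weight.\<close>

lemma potential_series:
  assumes B: "\<And>k. (weight (\<kappa> k))\<^sup>2 * cmod (b k) \<le> P * cmod (a k)" and K: "\<And>k. weight (\<kappa> k) \<le> weight k"
  shows "cmod (D i (\<kappa> k) * (D j (\<kappa> k) * b k)) \<le> c\<^sup>2 * P * cmod (a k)"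
    and "cmod (D i (\<kappa> k) * (lap (\<kappa> k) * b k)) \<le> 3 * c ^ 3 * P * (weight k * cmod (a k))"
    and "hessian (wseries (2 * R) b \<kappa>) x $ i $ j = wseries (2 * R) (\<lambda>k. D i (\<kappa> k) * (D j (\<kappa> k) * b k)) \<kappa> x"
    and "gradient (laplacian (wseries (2 * R) b \<kappa>)) x $ i
      = wseries (2 * R) (\<lambda>k. D i (\<kappa> k) * (lap (\<kappa> k) * b k)) \<kappa> x"
proof -
  have DD: "cmod (D i (\<kappa> k) * (D j (\<kappa> k) * b k)) \<le> c\<^sup>2 * P * cmod (a k)" for i j k
  proof -
    have "cmod (D i (\<kappa> k) * (D j (\<kappa> k) * b k)) \<le> (c * weight (\<kappa> k)) * ((c * weight (\<kappa> k)) * cmod (b k))"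
      unfolding norm_mult using c_pos by (intro mult_mono norm_D) auto
    also have "\<dots> = c\<^sup>2 * ((weight (\<kappa> k))\<^sup>2 * cmod (b k))" by (simp add: power2_eq_square mult_ac)
    also have "\<dots> \<le> c\<^sup>2 * (P * cmod (a k))" by (intro mult_left_mono B) simp
    finally show ?thesis by (simp add: mult_ac)
  qed
  then show "cmod (D i (\<kappa> k) * (D j (\<kappa> k) * b k)) \<le> c\<^sup>2 * P * cmod (a k)" .
  have lb: "cmod (lap (\<kappa> k) * b k) \<le> 3 * c\<^sup>2 * P * cmod (a k)" for k
  proof -
    have "cmod (lap (\<kappa> k) * b k) \<le> 3 * c\<^sup>2 * (weight (\<kappa> k))\<^sup>2 * cmod (b k)"
      unfolding norm_mult by (intro mult_right_mono norm_lap) auto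
    also have "\<dots> = 3 * c\<^sup>2 * ((weight (\<kappa> k))\<^sup>2 * cmod (b k))" by simp
    also have "\<dots> \<le> 3 * c\<^sup>2 * (P * cmod (a k))" by (intro mult_left_mono B) simp
    finally show ?thesis by (simp add: mult_ac)
  qed
  show "cmod (D i (\<kappa> k) * (lap (\<kappa> k) * b k)) \<le> 3 * c ^ 3 * P * (weight k * cmod (a k))"
  proof -
    have "cmod (D i (\<kappa> k) * (lap (\<kappa> k) * b k)) \<le> (c * weight k) * (3 * c\<^sup>2 * P * cmod (a k))"
      unfolding norm_mult[of "D i (\<kappa> k)"] using c_pos order.trans[OF norm_D mult_left_mono[OF K]]
        by (intro mult_mono lb) auto
    then show ?thesis by (simp add: power2_eq_square power3_eq_cube mult_ac)
  qed
  have Ps: "(\<lambda>k. P * cmod (a k)) summable_on UNIV" by (rule summable_on_cmult_right[OF summable_a])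
  have s1: "(\<lambda>k. weight (\<kappa> k) * cmod (b k)) summable_on UNIV"
  proof (rule summable_on_comparison_test[OF Ps])
    show "weight (\<kappa> k) * cmod (b k) \<le> P * cmod (a k)" for k
      by (rule order.trans[OF mult_right_mono B[of k]]) (auto intro: self_le_power)
  qed auto
  have s2: "(\<lambda>k. weight (\<kappa> k) * cmod (D j (\<kappa> k) * b k)) summable_on UNIV" for j
  proof (rule summable_on_comparison_test[OF summable_on_cmult_right[OF Ps, of c]])
    fix k
    have "weight (\<kappa> k) * cmod (D j (\<kappa> k) * b k) \<le> weight (\<kappa> k) * (c * weight (\<kappa> k) * cmod (b k))"
      unfolding norm_mult by (intro mult_left_mono mult_right_mono norm_D) auto
    also have "\<dots> = c * ((weight (\<kappa> k))\<^sup>2 * cmod (b k))" by (simp add: power2_eq_square mult_ac)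
    also have "\<dots> \<le> c * (P * cmod (a k))" using c_pos by (intro mult_left_mono B) auto
    finally show "weight (\<kappa> k) * cmod (D j (\<kappa> k) * b k) \<le> c * (P * cmod (a k))" .
  qed auto
  have s3: "(\<lambda>k. weight (\<kappa> k) * cmod (lap (\<kappa> k) * b k)) summable_on UNIV"
  proof (rule summable_on_comparison_test[OF summable_on_cmult_right[OF summable_weight_a, of "3 * c\<^sup>2 * P"]])
    fix k
    have "weight (\<kappa> k) * cmod (lap (\<kappa> k) * b k) \<le> weight k * (3 * c\<^sup>2 * P * cmod (a k))"
      by (intro mult_mono K lb) auto
    then show "weight (\<kappa> k) * cmod (lap (\<kappa> k) * b k) \<le> 3 * c\<^sup>2 * P * (weight k * cmod (a k))"
      by (simp add: mult_ac)
  qed auto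
  have p1: "partial_deriv j (wseries (2 * R) b \<kappa>) = wseries (2 * R) (\<lambda>k. D j (\<kappa> k) * b k) \<kappa>" for j
    by (rule ext) (rule partial_deriv_wseries[OF s1])
  have p2: "partial_deriv i (partial_deriv j (wseries (2 * R) b \<kappa>)) x
    = wseries (2 * R) (\<lambda>k. D i (\<kappa> k) * (D j (\<kappa> k) * b k)) \<kappa> x" for i j x
    unfolding p1 by (rule partial_deriv_wseries[OF s2])
  then show "hessian (wseries (2 * R) b \<kappa>) x $ i $ j
    = wseries (2 * R) (\<lambda>k. D i (\<kappa> k) * (D j (\<kappa> k) * b k)) \<kappa> x"
    by (simp add: hessian_def)
  have "laplacian (wseries (2 * R) b \<kappa>) = wseries (2 * R) (\<lambda>k. lap (\<kappa> k) * b k) \<kappa>"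
  proof
    fix x
    have "laplacian (wseries (2 * R) b \<kappa>) x = wseries (2 * R) (\<lambda>k. \<Sum>m\<in>UNIV. D m (\<kappa> k) * (D m (\<kappa> k)
      * b k)) \<kappa> x"
      unfolding laplacian_def p2
      by (rule wseries_sum) (auto intro!: summable_on_comparison_test[OF summable_on_cmult_right[OF
        summable_a, of "c\<^sup>2 * P"]] DD)
    then show "laplacian (wseries (2 * R) b \<kappa>) x = wseries (2 * R) (\<lambda>k. lap (\<kappa> k) * b k) \<kappa> x"
      by (simp add: lap_def sum_distrib_right mult.assoc)
  qed
  then show "gradient (laplacian (wseries (2 * R) b \<kappa>)) x $ i
    = wseries (2 * R) (\<lambda>k. D i (\<kappa> k) * (lap (\<kappa> k) * b k)) \<kappa> x"
    by (simp add: gradient_def partial_deriv_wseries[OF s3])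
qed

lemma psi_bound: "(weight (\<kappa> k))\<^sup>2 * cmod (a k * psi_coeff R (\<kappa> k)) \<le> P * cmod (a k)"
proof -
  have "(weight (\<kappa> k))\<^sup>2 * cmod (psi_coeff R (\<kappa> k)) \<le> P"
    using psi[of "\<kappa> k"] by (simp add: pos_le_divide_eq mult.commute)
  from mult_right_mono[OF this, of "cmod (a k)"] show ?thesis by (simp add: norm_mult mult_ac)
qed

lemma gradient_fper: "gradient fper x $ j = wseries (2 * R) (\<lambda>k. D j k * a k) (\<lambda>k. k) x"
  unfolding gradient_def by (simp add: partial_deriv_wseries[OF summable_weight_a])

lemma norm_D_a: "cmod (D j k * a k) \<le> c * (weight k * cmod (a k))"
  using mult_right_mono[OF norm_D[of j k], of "cmod (a k)"] by (simp add: norm_mult mult_ac)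

lemma summable_D_a: "(\<lambda>k. cmod (D j k * a k)) summable_on UNIV"
  by (rule summable_on_comparison_test[OF summable_on_cmult_right[OF summable_weight_a, of c]])
    (auto intro: norm_D_a)

text \<open>A majorant for the flux coefficients at the pair \<open>(k, l)\<close>, carrying the
  highest available weight.\<close>

definition T :: "(int^3) \<times> (int^3) \<Rightarrow> real" where
  "T = (\<lambda>(k, l). (weight k + weight l) powr (p - 2) * (cmod (a k) * cmod (a l)))"

lemma T_nonneg: "T z \<ge> 0" by (simp add: T_def case_prod_unfold)

text \<open>The larger of the two weights dominates their sum up to a factor \<open>2\<close>, so
  the power \<open>p - 2\<close> falls entirely on one factor and the other needs no weight. Adding
  the two symmetric cases turns \<open>2 powr (p - 2)\<close> into
  \<open>2 powr (p - 1)\<close>.\<close>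

lemma T_sum: "T summable_on UNIV" "(\<Sum>\<^sub>\<infinity>z. T z) \<le> 2 powr (p - 1) * S1 * S2"
proof -
  define u where "u = (\<lambda>k. weight k powr (p - 2) * cmod (a k))"
  define w where "w = (\<lambda>k. cmod (a k))"
  define S0 where "S0 = (\<Sum>\<^sub>\<infinity>k. w k)"
  have u: "(u has_sum S1) UNIV" unfolding u_def S1_def by (rule has_sum_infsum[OF summable_powr_a])
  have w: "(w has_sum S0) UNIV" unfolding w_def S0_def by (rule has_sum_infsum[OF summable_a])
  have nn: "u k \<ge> 0" "w k \<ge> 0" for k by (auto simp: u_def w_def)
  have "((\<lambda>(k, l). u k * w l) has_sum (S1 * S0)) (UNIV \<times> UNIV)"
    using u w nn by (intro has_sum_SigmaI[where g="\<lambda>k. u k * S0"] has_sum_cmult_right has_sum_cmult_left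
        summable_on_SigmaI[where g="\<lambda>k. u k * S0"])
          (auto intro: summable_on_cmult_left has_sum_imp_summable has_sum_cmult_right)
  moreover have "((\<lambda>(k, l). w k * u l) has_sum (S0 * S1)) (UNIV \<times> UNIV)"
    using u w nn by (intro has_sum_SigmaI[where g="\<lambda>k. w k * S1"] has_sum_cmult_right has_sum_cmult_left
        summable_on_SigmaI[where g="\<lambda>k. w k * S1"])
          (auto intro: summable_on_cmult_left has_sum_imp_summable has_sum_cmult_right)
  ultimately have "((\<lambda>z. (\<lambda>(k, l). u k * w l) z + (\<lambda>(k, l). w k * u l) z) has_sum (S1 * S0 + S0 * S1)) UNIV"
    using has_sum_add by fastforce
  from has_sum_cmult_right[OF this, of "2 powr (p - 2)"]
  have hs: "((\<lambda>(k, l). 2 powr (p - 2) * (u k * w l + w k * u l))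
    has_sum (2 powr (p - 2) * (S1 * S0 + S0 * S1))) UNIV"
    by (simp add: case_prod_unfold)
  have le: "T (k, l) \<le> 2 powr (p - 2) * (u k * w l + w k * u l)" for k l
  proof -
    have "(weight k + weight l) powr (p - 2) \<le> (2 * max (weight k) (weight l)) powr (p - 2)"
      using p by (intro powr_mono2) auto
    also have "\<dots> = 2 powr (p - 2) * max (weight k) (weight l) powr (p - 2)" by (simp add: powr_mult)
    also have "\<dots> \<le> 2 powr (p - 2) * (weight k powr (p - 2) + weight l powr (p - 2))"
      by (intro mult_left_mono) (auto simp: max_def)
    finally have "(weight k + weight l) powr (p - 2) * (cmod (a k) * cmod (a l))
      \<le> 2 powr (p - 2) * (weight k powr (p - 2) + weight l powr (p - 2)) * (cmod (a k) * cmod (a l))"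
      by (intro mult_right_mono) auto
    then show ?thesis by (simp add: T_def u_def w_def algebra_simps)
  qed
  show s: "T summable_on UNIV"
    by (rule summable_on_comparison_test[OF has_sum_imp_summable[OF hs]]) (auto intro: le T_nonneg)
  have "(\<Sum>\<^sub>\<infinity>z. T z) \<le> 2 powr (p - 2) * (S1 * S0 + S0 * S1)"
    by (rule has_sum_mono[OF has_sum_infsum[OF s] hs]) (auto intro: le)
  also have "\<dots> = 2 powr (p - 1) * S1 * S0"
    using powr_add[of 2 "p - 2" 1] by simp
  also have "\<dots> \<le> 2 powr (p - 1) * S1 * S2"
    using infsum_norm_le_S2 S1_nonneg by (intro mult_left_mono) (auto simp: S0_def w_def)
  finally show "(\<Sum>\<^sub>\<infinity>z. T z) \<le> 2 powr (p - 1) * S1 * S2" .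
qed

text \<open>The coefficient of the flux component \<open>i\<close> at frequency
  \<open>k + l\<close>, where \<open>k\<close> comes from the potential and \<open>l\<close> from
  \<open>f\<close>.\<close>

definition w :: "3 \<Rightarrow> (int^3) \<times> (int^3) \<Rightarrow> complex" where
  "w i = (\<lambda>(k, l). (\<Sum>j\<in>UNIV. (D i k * (D j k * (a k * psi_coeff R k))) * (D j l * a l))
     - (D i k * (lap k * (a k * psi_coeff R k))) * a l)"

abbreviation "\<kappa>2 \<equiv> (\<lambda>(k, l). k + l :: int^3)"

lemmas gper_series = potential_series[where \<kappa>="\<lambda>k. k" and b="\<lambda>k. a k * psi_coeff R k",
   OF psi_bound[where \<kappa>="\<lambda>k. k"] order.refl]

lemma norm_w: "cmod (w i (k, l)) \<le> 6 * c ^ 3 * P * ((weight k + weight l) * (cmod (a k) * cmod (a l)))"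
proof -
  have A: "cmod ((D i k * (D j k * (a k * psi_coeff R k))) * (D j l * a l))
    \<le> (c\<^sup>2 * P * cmod (a k)) * (c * (weight l * cmod (a l)))" for j
    unfolding norm_mult[of "D i k * (D j k * (a k * psi_coeff R k))"]
    using c_pos P by (intro mult_mono gper_series(1) norm_D_a) auto
  have B: "cmod ((D i k * (lap k * (a k * psi_coeff R k))) * a l)
    \<le> (3 * c ^ 3 * P * (weight k * cmod (a k))) * cmod (a l)"
    unfolding norm_mult[of "D i k * (lap k * (a k * psi_coeff R k))"]
    by (intro mult_right_mono gper_series(2)) auto
  have "cmod (w i (k, l)) \<le> (\<Sum>j\<in>(UNIV :: 3 set). (c\<^sup>2 * P * cmod (a k)) * (c * (weight l * cmod (a l))))
    + (3 * c ^ 3 * P * (weight k * cmod (a k))) * cmod (a l)"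
    unfolding w_def prod.case
    by (rule order.trans[OF norm_triangle_ineq4 add_mono[OF order.trans[OF norm_sum sum_mono] B]]) (rule A)
  also have "\<dots> = 3 * c ^ 3 * P * ((weight k + weight l) * (cmod (a k) * cmod (a l)))"
    by (simp add: algebra_simps power2_eq_square power3_eq_cube)
  also have "\<dots> \<le> 6 * c ^ 3 * P * ((weight k + weight l) * (cmod (a k) * cmod (a l)))"
    using c_pos P by (intro mult_right_mono) (auto intro!: mult_nonneg_nonneg add_nonneg_nonneg)
  finally show ?thesis .
qed

text \<open>The flux coefficients already spend one of the \<open>p - 2\<close> powers in
  \<open>T\<close>, which leaves \<open>p - 3\<close>. Since \<open>p \<ge> 4\<close>, the value
  \<open>s = 1\<close> is admissible and the flux series can be differentiated.\<close>

lemma norm_w_T: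
  assumes "0 \<le> s" "s \<le> p - 3"
  shows "weight (k + l) powr s * cmod (w i (k, l)) \<le> 6 * c ^ 3 * P * T (k, l)"
proof -
  have y: "weight k + weight l \<ge> 1" using weight_ge_1[of k] weight_ge_1[of l] by linarith
  have "weight (k + l) powr s * cmod (w i (k, l))
    \<le> (weight k + weight l) powr s * (6 * c ^ 3 * P * ((weight k + weight l) * (cmod (a k) * cmod (a l))))"
    using assms by (intro mult_mono norm_w powr_mono2 weight_add_le) auto
  also have "\<dots> = 6 * c ^ 3 * P * ((weight k + weight l) powr (s + 1) * (cmod (a k) * cmod (a l)))"
    using y by (simp add: powr_add mult_ac)
  also have "\<dots> \<le> 6 * c ^ 3 * P * ((weight k + weight l) powr (p - 2) * (cmod (a k) * cmod (a l)))"
    using y assms c_pos P by (intro mult_left_mono mult_right_mono powr_mono) auto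
  finally show ?thesis by (simp add: T_def)
qed

lemma summable_w: "(\<lambda>z. weight (\<kappa>2 z) * cmod (w i z)) summable_on UNIV" "(\<lambda>z. cmod (w i z)) summable_on UNIV"
proof -
  have s: "(\<lambda>z. 6 * c ^ 3 * P * T z) summable_on UNIV" by (rule summable_on_cmult_right[OF T_sum(1)])
  show "(\<lambda>z. weight (\<kappa>2 z) * cmod (w i z)) summable_on UNIV"
    by (rule summable_on_comparison_test[OF s]) (use norm_w_T[of 1] p in auto)
  show "(\<lambda>z. cmod (w i z)) summable_on UNIV"
    by (rule summable_on_comparison_test[OF s]) (use norm_w_T[of 0] p in auto)
qed

lemma flux_per: "landau_flux gper fper x $ i = wseries (2 * R) (w i) \<kappa>2 x"
proof -
  have sH: "(\<lambda>k. cmod (D i k * (D j k * (a k * psi_coeff R k)))) summable_on UNIV" for j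
    by (rule summable_on_comparison_test[OF summable_on_cmult_right[OF summable_a, of "c\<^sup>2 * P"]])
      (auto intro: gper_series(1))
  have sT: "(\<lambda>k. cmod (D i k * (lap k * (a k * psi_coeff R k)))) summable_on UNIV"
    by (rule summable_on_comparison_test[OF summable_on_cmult_right[OF summable_weight_a, of "3 * c ^ 3
      * P"]]) (auto intro: gper_series(2))
  define h where "h = (\<lambda>j (k, l). (D i k * (D j k * (a k * psi_coeff R k))) * (D j l * a l))"
  define t where "t = (\<lambda>(k, l). (D i k * (lap k * (a k * psi_coeff R k))) * a l)"
  have h: "hessian gper x $ i $ j * gradient fper x $ j
    = wseries (2 * R) (h j) \<kappa>2 x" "(\<lambda>z. cmod (h j z)) summable_on UNIV" for j
    unfolding gper_series(3) gradient_fper h_def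
    by (rule wseries_mult[OF sH summable_D_a])+
  have t: "fper x * gradient (laplacian gper) x $ i
    = wseries (2 * R) t \<kappa>2 x" "(\<lambda>z. cmod (t z)) summable_on UNIV"
    unfolding gper_series(4) t_def mult.commute[of "fper x"]
    by (rule wseries_mult[OF sT summable_a])+
  have "landau_flux gper fper x $ i = (\<Sum>j\<in>UNIV. wseries (2 * R) (h j) \<kappa>2 x) - wseries (2 * R) t \<kappa>2 x"
    unfolding landau_flux_nth h(1) t(1) ..
  also have "((\<lambda>z. (\<Sum>j\<in>UNIV. h j z * wave (2 * R) (\<kappa>2 z) x) - t z * wave (2 * R) (\<kappa>2 z) x) has_sum \<dots>) UNIV"
    unfolding diff_conv_add_uminus
    by (intro has_sum_add has_sum_finite_sum has_sum_wseries h(2))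
      (auto simp: has_sum_uminus intro!: has_sum_wseries t(2))
  then have "(\<Sum>j\<in>UNIV. wseries (2 * R) (h j) \<kappa>2 x) - wseries (2 * R) t \<kappa>2 x = wseries (2 * R) (w i) \<kappa>2 x"
    unfolding wseries_def[of _ "w i"] by (subst infsumI[symmetric], assumption)
      (auto simp: w_def h_def t_def case_prod_unfold sum_distrib_right left_diff_distrib)
  finally show ?thesis .
qed

end

section \<open>The collocation error\<close>

context collocation begin

text \<open>The periodic potential does not vanish in the collar, but every term of the flux
  contains \<open>fper\<close> or its gradient as a factor.\<close>

lemma flux_per_zero:
  assumes x: "R - 2 * d < \<bar>x $ i\<bar>" "\<bar>x $ i\<bar> < 3 * R + 2 * d"
  shows "wseries (2 * R) (w j) \<kappa>2 x = 0"
proof -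
  let ?V = "{x :: real^3. R - 2 * d < \<bar>x $ i\<bar> \<and> \<bar>x $ i\<bar> < 3 * R + 2 * d}"
  have "open ?V" by (intro open_Collect_conj open_Collect_less continuous_intros)
  then have "landau_flux gper fper x = 0"
    by (rule landau_flux_zero) (use x fper_zero in auto)
  then show ?thesis by (simp add: flux_per[symmetric])
qed

text \<open>A shift by \<open>2 * R\<close> sends a coordinate of a point of \<open>U\<close>
  between \<open>R - d\<close> and \<open>3 * R + d\<close>, hence into the gap where the series
  vanishes.\<close>

lemma fold_on_U:
  assumes b: "(\<lambda>x. cmod (b x)) summable_on UNIV" and v: "v \<in> U"
    and z: "\<And>x i. R - 2 * d < \<bar>x $ i\<bar> \<Longrightarrow> \<bar>x $ i\<bar> < 3 * R + 2 * d \<Longrightarrow> wseries (2 * R) b \<kappa> x = 0"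
  shows "wseries (2 * R) b \<kappa> v = wseries R (\<lambda>x. if \<forall>i. even (\<kappa> x $ i) then 8 * b x else 0) (\<lambda>x. half (\<kappa> x)) v"
proof (rule wseries_fold[OF R b])
  fix e :: "int^3" assume e: "\<forall>i. e $ i \<in> {0, 1}" "e \<noteq> 0"
  then obtain i where "e $ i \<noteq> 0" by (auto simp: vec_eq_iff)
  then have "e $ i = 1" using e(1) by auto
  then have "(v + (2 * R) *\<^sub>R real_vec e) $ i = v $ i + 2 * R" by simp
  moreover have "\<bar>v $ i\<bar> < R + d" using v by (auto simp: U_def)
  ultimately show "wseries (2 * R) b \<kappa> (v + (2 * R) *\<^sub>R real_vec e) = 0"
    using d R by (intro z[of _ i]) auto
qed

definition W :: "3 \<Rightarrow> real^3 \<Rightarrow> complex" where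
  "W i x = landau_flux (g_trunc R f) f x $ i"

text \<open>Coefficients of the exact flux relative to the small cube, as produced by
  folding.\<close>

definition w8 :: "3 \<Rightarrow> (int^3) \<times> (int^3) \<Rightarrow> complex" where
  "w8 i z = (if \<forall>m. even (\<kappa>2 z $ m) then 8 * w i z else 0)"

definition a8 :: "int^3 \<Rightarrow> complex" where
  "a8 k = (if \<forall>m. even (k $ m) then 8 * a k else 0)"

lemma flux_U: "x \<in> U \<Longrightarrow> landau_flux (g_trunc R f) f x = landau_flux gper fper x"
  by (rule landau_flux_cong_open[OF open_U]) (auto simp: g_trunc_eq f_eq_fper_U)

lemma W_series: "x \<in> U \<Longrightarrow> W i x = wseries R (w8 i) (\<lambda>z. half (\<kappa>2 z)) x"
  unfolding W_def flux_U flux_per w8_def[abs_def]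
  by (rule fold_on_U[OF summable_w(2)]) (auto intro: flux_per_zero)

lemma f_series: "x \<in> U \<Longrightarrow> f x = wseries R a8 half x"
  unfolding f_eq_fper_U a8_def[abs_def]
  by (rule fold_on_U[OF summable_a, where \<kappa>="\<lambda>k. k"]) (auto intro: fper_zero)

lemma norm_w8: "cmod (w8 i z) \<le> 8 * cmod (w i z)" by (simp add: w8_def norm_mult)
lemma norm_a8: "cmod (a8 k) \<le> 8 * cmod (a k)" by (simp add: a8_def norm_mult)

lemma summable_w8:
  "(\<lambda>z. weight (half (\<kappa>2 z)) * cmod (w8 i z)) summable_on UNIV" "(\<lambda>z. cmod (w8 i z)) summable_on UNIV"
proof -
  show "(\<lambda>z. weight (half (\<kappa>2 z)) * cmod (w8 i z)) summable_on UNIV"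
  proof (rule summable_on_comparison_test[OF summable_on_cmult_right[OF summable_w(1), of 8 i]])
    show "weight (half (\<kappa>2 z)) * cmod (w8 i z) \<le> 8 * (weight (\<kappa>2 z) * cmod (w i z))" for z
      using mult_mono[OF weight_half_le norm_w8, of "\<kappa>2 z" i z] by (simp add: mult_ac)
  qed auto
  show "(\<lambda>z. cmod (w8 i z)) summable_on UNIV"
    by (rule summable_on_comparison_test[OF summable_on_cmult_right[OF summable_w(2), of 8 i]])
      (auto intro: norm_w8)
qed

lemma summable_a8:
  "(\<lambda>k. weight (half k) * cmod (a8 k)) summable_on UNIV" "(\<lambda>k. cmod (a8 k)) summable_on UNIV"
proof -
  show "(\<lambda>k. weight (half k) * cmod (a8 k)) summable_on UNIV"
  proof (rule summable_on_comparison_test[OF summable_on_cmult_right[OF summable_weight_a, of 8]])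
    show "weight (half k) * cmod (a8 k) \<le> 8 * (weight k * cmod (a k))" for k
      using mult_mono[OF weight_half_le norm_a8, of k k] by (simp add: mult_ac)
  qed auto
  show "(\<lambda>k. cmod (a8 k)) summable_on UNIV"
    by (rule summable_on_comparison_test[OF summable_on_cmult_right[OF summable_a, of 8]])
      (auto intro: norm_a8)
qed

section \<open>Aliasing errors of the interpolated quantities\<close>

abbreviation "fn \<equiv> interp R n f"
abbreviation "gn \<equiv> g_double R n fn"

lemma node_U: "j \<in> index_set n \<Longrightarrow> node R n j \<in> U"
  using node_in_cube[OF R n] cube_subset_U by blast

lemma interp_W_series: "interp R n (W i) = wseries R (w8 i) (\<lambda>z. residue n (half (\<kappa>2 z)))"
  by (rule ext, rule interp_eq_wseries[OF R n summable_w8(2)]) (rule W_series[OF node_U])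

lemma fn_series: "fn = wseries R a8 (\<lambda>k. residue n (half k))"
  by (rule ext, rule interp_eq_wseries[OF R n summable_a8(2)]) (rule f_series[OF node_U])

lemma tail_weight:
  assumes "real n / 2 \<le> weight k" "q \<ge> 0"
  shows "1 \<le> (2 / real n) powr q * weight k powr q"
proof -
  have "1 \<le> 2 / real n * weight k" using assms n by (simp add: field_simps)
  then have "1 \<le> (2 / real n * weight k) powr q" using assms(2) by (rule ge_one_powr_ge_zero)
  then show ?thesis by (simp only: powr_mult)
qed

lemma tail_weight_mult:
  assumes k: "real n / 2 \<le> weight k" and q: "q \<ge> 0" and x: "x \<ge> 0"
  shows "weight k * x \<le> (2 / real n) powr q * (weight k powr (q + 1) * x)"
proof -
  have "1 * (weight k * x) \<le> ((2 / real n) powr q * weight k powr q) * (weight k * x)"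
    using x by (intro mult_right_mono tail_weight k q) auto
  then show ?thesis by (simp add: powr_add mult_ac)
qed

lemma half_index: "half k \<notin> index_set n \<Longrightarrow> real n / 2 \<le> weight (half k)"
  by (rule weight_ge_of_not_in_index_set[OF n(1)])

lemma double_index: "k \<notin> index_set (2 * n) \<Longrightarrow> real n / 2 \<le> weight k"
  using weight_ge_of_not_in_index_set[of "2 * n" k] by simp

definition eps :: "real \<Rightarrow> real" where "eps q = (2 / real n) powr q"
lemma eps_nonneg [simp]: "eps q \<ge> 0" by (simp add: eps_def)

text \<open>The divergence takes one weight of each flux coefficient. Of the \<open>p - 3\<close>
  powers available, \<open>p - 4\<close> are left to be traded for powers of \<open>n\<close> on the
  aliased frequencies.\<close>

lemma consistency_derivative:
  "cmod (partial_deriv i (wseries R (w8 i) (\<lambda>z. half (\<kappa>2 z))) v - partial_deriv i (interp R n (W i)) v)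
    \<le> 96 * 2 powr p * (c ^ 4 * P * (eps (p - 4) * S1 * S2))"
proof -
  define \<beta> where "\<beta> = (\<lambda>z. 48 * c ^ 3 * P * eps (p - 4) * T z)"
  have s: "\<beta> summable_on UNIV" unfolding \<beta>_def by (rule summable_on_cmult_right[OF T_sum(1)])
  have "cmod (partial_deriv i (wseries R (w8 i) (\<lambda>z. half (\<kappa>2 z))) v - partial_deriv i (interp R n (W i)) v)
    \<le> 2 * (pi / R) * (\<Sum>\<^sub>\<infinity>z. \<beta> z)"
    unfolding interp_W_series
  proof (rule residue_derivative_bound[OF R n summable_w8(1) s])
    show "\<beta> z \<ge> 0" for z unfolding \<beta>_def using c_pos P T_nonneg by simp
    fix z assume "half (\<kappa>2 z) \<notin> index_set n"
    then have h: "real n / 2 \<le> weight (half (\<kappa>2 z))" by (rule half_index)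
    have "weight (half (\<kappa>2 z)) * cmod (w8 i z) \<le> weight (half (\<kappa>2 z)) * (8 * cmod (w i z))"
      by (intro mult_left_mono norm_w8) simp
    also have "\<dots> \<le> eps (p - 4) * (weight (half (\<kappa>2 z)) powr (p - 4 + 1) * (8 * cmod (w i z)))"
      unfolding eps_def using p by (intro tail_weight_mult h) auto
    also have "\<dots> \<le> eps (p - 4) * (weight (\<kappa>2 z) powr (p - 4 + 1) * (8 * cmod (w i z)))"
      using p by (intro mult_left_mono mult_right_mono powr_mono2 weight_half_le) auto
    also have "\<dots> = 8 * eps (p - 4) * (weight (\<kappa>2 z) powr (p - 3) * cmod (w i z))"
      by (simp add: mult_ac)
    also have "\<dots> \<le> 8 * eps (p - 4) * (6 * c ^ 3 * P * T z)"
      using norm_w_T[of "p - 3" "fst z" "snd z" i] p by (intro mult_left_mono) (auto simp: case_prod_unfold)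
    finally show "weight (half (\<kappa>2 z)) * cmod (w8 i z) \<le> \<beta> z" by (simp add: \<beta>_def mult_ac)
  qed
  also have "(\<Sum>\<^sub>\<infinity>z. \<beta> z) = 48 * c ^ 3 * P * eps (p - 4) * (\<Sum>\<^sub>\<infinity>z. T z)"
    unfolding \<beta>_def by (rule infsum_cmult_right) (use T_sum in auto)
  also have "2 * (pi / R) * (48 * c ^ 3 * P * eps (p - 4) * (\<Sum>\<^sub>\<infinity>z. T z))
    \<le> 2 * (pi / R) * (48 * c ^ 3 * P * eps (p - 4) * (2 powr (p - 1) * S1 * S2))"
    using R c_pos P by (intro mult_left_mono T_sum(2)) auto
  also have "\<dots> = 96 * 2 powr p * (c ^ 4 * P * (eps (p - 4) * S1 * S2))"
  proof -
    have "pi / R = 2 * c" by (simp add: c_def)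
    moreover have "2 powr p = 2 * 2 powr (p - 1)" using powr_add[of 2 "p - 1" 1] by simp
    ultimately show ?thesis by (simp add: power3_eq_cube power4_eq_xxxx)
  qed
  finally show ?thesis .
qed

text \<open>The large-cube series of \<open>f\<close> is first replaced near \<open>v\<close> by its
  folded version, because interpolation aliases frequencies of the small cube.\<close>

lemma gradient_fn_diff:
  assumes v: "v \<in> U"
  shows "cmod (gradient fper v $ j - gradient fn v $ j) \<le> 32 * c * (eps (p - 3) * S1)"
proof -
  define \<beta> where "\<beta> = (\<lambda>k. 8 * eps (p - 3) * (weight k powr (p - 2) * cmod (a k)))"
  have s: "\<beta> summable_on UNIV" unfolding \<beta>_def by (rule summable_on_cmult_right[OF summable_powr_a])
  have "partial_deriv j fper v = partial_deriv j (wseries R a8 half) v"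
    by (rule partial_deriv_cong_open[OF open_U v]) (simp add: f_eq_fper_U[symmetric] f_series)
  then have "cmod (gradient fper v $ j - gradient fn v $ j)
    = cmod (partial_deriv j (wseries R a8 half) v - partial_deriv j (wseries R a8 (\<lambda>k. residue n
      (half k))) v)"
    by (simp add: gradient_def fn_series)
  also have "\<dots> \<le> 2 * (pi / R) * (\<Sum>\<^sub>\<infinity>k. \<beta> k)"
  proof (rule residue_derivative_bound[OF R n summable_a8(1) s])
    show "\<beta> k \<ge> 0" for k unfolding \<beta>_def by simp
    fix k assume "half k \<notin> index_set n"
    then have h: "real n / 2 \<le> weight (half k)" by (rule half_index)
    have "weight (half k) * cmod (a8 k) \<le> weight (half k) * (8 * cmod (a k))"
      by (intro mult_left_mono norm_a8) simp
    also have "\<dots> \<le> eps (p - 3) * (weight (half k) powr (p - 3 + 1) * (8 * cmod (a k)))"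
      unfolding eps_def using p by (intro tail_weight_mult h) auto
    also have "\<dots> \<le> eps (p - 3) * (weight k powr (p - 3 + 1) * (8 * cmod (a k)))"
      using p by (intro mult_left_mono mult_right_mono powr_mono2 weight_half_le) auto
    also have "\<dots> = \<beta> k" by (simp add: \<beta>_def mult_ac)
    finally show "weight (half k) * cmod (a8 k) \<le> \<beta> k" .
  qed
  also have "(\<Sum>\<^sub>\<infinity>k. \<beta> k) = 8 * eps (p - 3) * S1"
    unfolding \<beta>_def S1_def by (rule infsum_cmult_right) (use summable_powr_a in auto)
  finally show ?thesis by (simp add: c_def)
qed

text \<open>Extension by zero of the nodal values agrees with sampling \<open>f\<close> itself on
  the doubled grid, so the discrete potential comes from interpolating \<open>f\<close> there.
  Aliasing replaces the frequency in the kernel coefficient as well as in the wave.\<close>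

lemma gn_series: "gn = wseries (2 * R) (\<lambda>k. a k * psi_coeff R (residue (2 * n) k)) (\<lambda>k. residue (2 * n) k)"
proof
  fix v
  have R2: "2 * R > 0" and n2: "even (2 * n)" "2 * n > 0" using R n by auto
  have node: "node (2 * R) (2 * n) j = node R n j" for j by (simp add: node_def)
  have val: "(if j \<in> index_set n then fn (node R n j) else 0) = f (node R n j)"
    if "j \<in> index_set (2 * n)" for j
  proof (cases "j \<in> index_set n")
    case True
    then show ?thesis by (simp add: interp_node[OF R n])
  next
    case False
    then obtain i where "\<not> (- (int n div 2) \<le> j $ i \<and> j $ i < int n div 2)" by (auto simp: index_set_def)
    then have "int n div 2 \<le> \<bar>j $ i\<bar>" by linarith
    moreover have "int n = 2 * (int n div 2)" using n by simp
    ultimately have "int n \<le> 2 * \<bar>j $ i\<bar>" by linarith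
    then have "real n \<le> 2 * \<bar>real_of_int (j $ i)\<bar>" by linarith
    then have "R * real n \<le> R * (2 * \<bar>real_of_int (j $ i)\<bar>)" using R by (intro mult_left_mono) auto
    \<comment> \<open>A node outside the small index set may still lie on a face of the small cube;
      the collar makes \<open>f\<close> vanish there too.\<close>
    then have "\<bar>node R n j $ i\<bar> \<ge> R" using R n by (simp add: node_def abs_mult field_simps)
    then have "node R n j \<notin> cube (R - 2 * d)" using d by (auto simp: mem_cube not_le intro!: exI[of _ i])
    then show ?thesis using f_0 False by simp
  qed
  have coeff: "double_coeff R n fn k = interp_coeff (2 * R) (2 * n) f k" for k
    unfolding double_coeff_def interp_coeff_def node using val by (simp cong: sum.cong)
  have "((\<lambda>k. a k * (psi_coeff R (residue (2 * n) k) * wave (2 * R) (residue (2 * n) k) v)) has_sum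
     (\<Sum>k\<in>index_set (2 * n). interp_coeff (2 * R) (2 * n) f k * (psi_coeff R k * wave (2 * R) k v))) UNIV"
    by (rule has_sum_interp_coeff[OF R2 n2 summable_a, where \<kappa>="\<lambda>k. k"])
      (rule f_eq[OF node_in_cube[OF R2 n2]])
  moreover have "(\<Sum>k\<in>index_set (2 * n). interp_coeff (2 * R) (2 * n) f k * (psi_coeff R k * wave (2
    * R) k v)) = gn v"
    unfolding g_double_def coeff by (simp add: mult.assoc)
  ultimately show "gn v = wseries (2 * R) (\<lambda>k. a k * psi_coeff R (residue (2 * n) k)) (\<lambda>k. residue (2
    * n) k) v"
    by (simp add: wseries_def mult.assoc infsumI)
qed

lemma weight_residue2: "weight (residue (2 * n) k) \<le> weight k"
  using n by (intro weight_residue_le) auto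

lemmas gn_potential = potential_series[where \<kappa>="\<lambda>k. residue (2 * n) k" and b="\<lambda>k. a k * psi_coeff R
  (residue (2 * n) k)",
   OF psi_bound[where \<kappa>="\<lambda>k. residue (2 * n) k"] weight_residue2]

text \<open>Terms inside the doubled index set cancel exactly; the others form a tail, in which one
  weight is kept and \<open>p - 3\<close> powers are traded for powers of \<open>n\<close>.\<close>

lemma double_diff_bound:
  assumes b: "\<And>k. cmod (b k) \<le> C * (weight k * cmod (a k))" "\<And>k. cmod (b' k)
    \<le> C * (weight k * cmod (a k))" and C: "C \<ge> 0"
    and eq: "\<And>k. residue (2 * n) k = k \<Longrightarrow> b' k = b k"
  shows "cmod (wseries (2 * R) b (\<lambda>k. k) v - wseries (2 * R) b' (\<lambda>k. residue (2 * n) k) v)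
    \<le> 2 * C * (eps (p - 3) * S1)"
proof -
  have s: "(\<lambda>k. C * (weight k * cmod (a k))) summable_on UNIV"
    by (rule summable_on_cmult_right[OF summable_weight_a])
  have "cmod (wseries (2 * R) b (\<lambda>k. k) v - wseries (2 * R) b' (\<lambda>k. residue (2 * n) k) v)
     \<le> (\<Sum>\<^sub>\<infinity>k. 2 * C * eps (p - 3) * (weight k powr (p - 2) * cmod (a k)))"
  proof (rule norm_wseries_diff_le)
    show "(\<lambda>k. cmod (b k)) summable_on UNIV" by (rule summable_on_comparison_test[OF s]) (auto intro: b)
    show "(\<lambda>k. cmod (b' k)) summable_on UNIV" by (rule summable_on_comparison_test[OF s]) (auto intro: b)
    show "(\<lambda>k. 2 * C * eps (p - 3) * (weight k powr (p - 2) * cmod (a k))) summable_on UNIV"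
      by (rule summable_on_cmult_right[OF summable_powr_a])
    fix k
    show "cmod (b k * wave (2 * R) k v - b' k * wave (2 * R) (residue (2 * n) k) v)
      \<le> 2 * C * eps (p - 3) * (weight k powr (p - 2) * cmod (a k))"
    proof (cases "k \<in> index_set (2 * n)")
      case True
      then have r: "residue (2 * n) k = k" using n by (intro residue_id) auto
      show ?thesis using C by (simp add: r eq[OF r])
    next
      case False
      have "cmod (b k * wave (2 * R) k v - b' k * wave (2 * R) (residue (2 * n) k) v)
        \<le> cmod (b k) + cmod (b' k)"
        by (rule order.trans[OF norm_triangle_ineq4]) (simp add: norm_mult)
      also have "\<dots> \<le> 2 * C * (weight k * cmod (a k))" using b[of k] by simp
      also have "\<dots> \<le> 2 * C * (eps (p - 3) * (weight k powr (p - 3 + 1) * cmod (a k)))"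
        unfolding eps_def using p C by (intro mult_left_mono tail_weight_mult double_index[OF False]) auto
      finally show ?thesis by (simp add: mult_ac)
    qed
  qed
  also have "\<dots> = 2 * C * eps (p - 3) * S1"
    unfolding S1_def by (rule infsum_cmult_right) (use summable_powr_a in auto)
  finally show ?thesis by (simp add: mult_ac)
qed

lemma hessian_diff: "cmod (hessian gper v $ i $ j - hessian gn v $ i $ j)
  \<le> 2 * (c\<^sup>2 * P) * (eps (p - 3) * S1)"
  unfolding gn_series gper_series(3) gn_potential(3)
proof (rule double_diff_bound)
  \<comment> \<open>The Hessian bound is relaxed by one weight, so that it has the same rate as the
    differences of the other two factors.\<close>
  have le: "c\<^sup>2 * P * cmod (a k) \<le> c\<^sup>2 * P * (weight k * cmod (a k))" for k
    using P mult_right_mono[OF weight_ge_1[of k] norm_ge_zero[of "a k"]] by (intro mult_left_mono) auto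
  show "cmod (D i k * (D j k * (a k * psi_coeff R k))) \<le> c\<^sup>2 * P * (weight k * cmod (a k))" for k
    using gper_series(1) le by (rule order.trans)
  show "cmod (D i (residue (2 * n) k) * (D j (residue (2 * n) k) * (a k * psi_coeff R (residue (2
    * n) k)))) \<le> c\<^sup>2 * P * (weight k * cmod (a k))" for k
    using gn_potential(1) le by (rule order.trans)
qed (use P in auto)

lemma gradient_laplacian_diff:
  "cmod (gradient (laplacian gper) v $ i - gradient (laplacian gn) v $ i)
    \<le> 2 * (3 * c ^ 3 * P) * (eps (p - 3) * S1)"
  unfolding gn_series gper_series(4) gn_potential(4)
  by (rule double_diff_bound) (use P c_pos gper_series(2) gn_potential(2) in auto)

lemma norm_hessian_gn: "cmod (hessian gn v $ i $ j) \<le> c\<^sup>2 * P * S2"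
proof -
  have s: "(\<lambda>k. c\<^sup>2 * P * cmod (a k)) summable_on UNIV" by (rule summable_on_cmult_right[OF summable_a])
  have s': "(\<lambda>k. cmod (D i (residue (2 * n) k) * (D j (residue (2 * n) k) * (a k * psi_coeff R (residue
    (2 * n) k))))) summable_on UNIV"
    by (rule summable_on_comparison_test[OF s]) (auto intro: gn_potential(1))
  have "cmod (hessian gn v $ i $ j) \<le> (\<Sum>\<^sub>\<infinity>k. cmod (D i (residue (2 * n) k) * (D j (residue (2 * n) k) *
    (a k * psi_coeff R (residue (2 * n) k)))))"
    unfolding gn_series gn_potential(3) by (rule norm_wseries_le[OF s'])
  also have "\<dots> \<le> (\<Sum>\<^sub>\<infinity>k. c\<^sup>2 * P * cmod (a k))"
    by (intro infsum_mono s s' gn_potential(1))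
  also have "\<dots> = c\<^sup>2 * P * (\<Sum>\<^sub>\<infinity>k. cmod (a k))" by (rule infsum_cmult_right) (use summable_a in auto)
  also have "\<dots> \<le> c\<^sup>2 * P * S2" using P infsum_norm_le_S2 by (intro mult_left_mono) auto
  finally show ?thesis .
qed

lemma norm_gradient_fper: "cmod (gradient fper v $ j) \<le> c * S2"
proof -
  have s: "(\<lambda>k. c * (weight k * cmod (a k))) summable_on UNIV"
    by (rule summable_on_cmult_right[OF summable_weight_a])
  have "cmod (gradient fper v $ j) \<le> (\<Sum>\<^sub>\<infinity>k. cmod (D j k * a k))"
    unfolding gradient_fper by (rule norm_wseries_le[OF summable_D_a])
  also have "\<dots> \<le> (\<Sum>\<^sub>\<infinity>k. c * (weight k * cmod (a k)))"
    by (intro infsum_mono s summable_D_a norm_D_a)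
  also have "\<dots> = c * (\<Sum>\<^sub>\<infinity>k. weight k * cmod (a k))"
    by (rule infsum_cmult_right) (use summable_weight_a in auto)
  also have "\<dots> \<le> c * S2" using c_pos infsum_weight_le_S2 by (intro mult_left_mono) auto
  finally show ?thesis .
qed

lemma norm_fper: "cmod (fper v) \<le> S2"
  using norm_wseries_le[OF summable_a] infsum_norm_le_S2 by (rule order.trans)

text \<open>At the nodes \<open>fn\<close> equals \<open>f\<close>, so only differences of
  derivatives occur. In each product one factor is replaced at a time: the difference brings
  \<open>S1\<close> and the decay in \<open>n\<close>, the remaining factor brings
  \<open>S2\<close>.\<close>

lemma flux_node_diff:
  assumes j: "j \<in> index_set n"
  shows "cmod (W i (node R n j) - landau_flux gn fn (node R n j) $ i)
    \<le> 108 * (c ^ 3 * P * (eps (p - 3) * S1 * S2))"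
proof -
  define v where "v = node R n j"
  have vU: "v \<in> U" unfolding v_def by (rule node_U[OF j])
  have fv: "fn v = fper v" unfolding v_def interp_node[OF R n j] by (rule f_eq_fper_U[OF node_U[OF j]])
  define H where "H = (\<lambda>m. hessian gper v $ i $ m)"
  define H' where "H' = (\<lambda>m. hessian gn v $ i $ m)"
  define F where "F = (\<lambda>m. gradient fper v $ m)"
  define F' where "F' = (\<lambda>m. gradient fn v $ m)"
  define t where "t = gradient (laplacian gper) v $ i"
  define t' where "t' = gradient (laplacian gn) v $ i"
  define e where "e = eps (p - 3) * S1"
  have e: "e \<ge> 0" unfolding e_def using S1_nonneg by simp
  have one: "cmod (H m * F m - H' m * F' m) \<le> (2 * (c\<^sup>2 * P) * e) * (c * S2) + (c\<^sup>2 * P * S2) * (32 * c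
    * e)" for m
  proof -
    have "H m * F m - H' m * F' m = (H m - H' m) * F m + H' m * (F m - F' m)" by (simp add: algebra_simps)
    also have "cmod \<dots> \<le> cmod (H m - H' m) * cmod (F m) + cmod (H' m) * cmod (F m - F' m)"
      by (rule order.trans[OF norm_triangle_ineq]) (simp add: norm_mult)
    also have "\<dots> \<le> (2 * (c\<^sup>2 * P) * e) * (c * S2) + (c\<^sup>2 * P * S2) * (32 * c * e)"
      unfolding H_def H'_def F_def F'_def e_def using P S1_nonneg S2_nonneg
      by (intro add_mono mult_mono hessian_diff norm_gradient_fper norm_hessian_gn gradient_fn_diff vU) auto
    finally show ?thesis .
  qed
  have "W i v - landau_flux gn fn v $ i = (\<Sum>m\<in>UNIV. H m * F m - H' m * F' m) - fper v * (t - t')"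
    unfolding W_def flux_U[OF vU] landau_flux_nth fv H_def H'_def F_def F'_def t_def t'_def
    by (simp add: sum_subtractf algebra_simps)
  also have "cmod \<dots> \<le> (\<Sum>m\<in>(UNIV :: 3 set). (2 * (c\<^sup>2 * P) * e) * (c * S2) + (c\<^sup>2 * P * S2) * (32 * c
    * e)) + S2 * (2 * (3 * c ^ 3 * P) * e)"
  proof (rule order.trans[OF norm_triangle_ineq4 add_mono])
    show "cmod (\<Sum>m\<in>UNIV. H m * F m - H' m * F' m)
      \<le> (\<Sum>m\<in>(UNIV :: 3 set). (2 * (c\<^sup>2 * P) * e) * (c * S2) + (c\<^sup>2 * P * S2) * (32 * c * e))"
      by (rule order.trans[OF norm_sum sum_mono]) (rule one)
    show "cmod (fper v * (t - t')) \<le> S2 * (2 * (3 * c ^ 3 * P) * e)"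
      unfolding norm_mult t_def t'_def e_def using S2_nonneg
      by (intro mult_mono norm_fper gradient_laplacian_diff) auto
  qed
  \<comment> \<open>\<open>108 = 3 * (2 + 32) + 6\<close>: three products of Hessian and gradient
    entries, and the third-order term.\<close>
  also have "\<dots> = 108 * (c ^ 3 * P * (e * S2))" by (simp add: power2_eq_square power3_eq_cube)
  finally show ?thesis by (simp add: v_def e_def mult.assoc)
qed

section \<open>Splitting the error and collecting the bounds\<close>

lemma landau_trunc_eq:
  assumes v: "v \<in> U"
  shows "landau_trunc R f v = (\<Sum>i\<in>UNIV. partial_deriv i (wseries R (w8 i) (\<lambda>z. half (\<kappa>2 z))) v)"
  unfolding landau_trunc_def divergence_def W_def[symmetric]
  by (intro sum.cong refl partial_deriv_cong_open[OF open_U v] W_series)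

text \<open>\<open>E1\<close> is the error of interpolating the exact flux and \<open>E2\<close> the
  propagated nodal error. The flux series is used in \<open>E1\<close> so that it is defined and
  continuous everywhere.\<close>

definition E1 :: "3 \<Rightarrow> real^3 \<Rightarrow> complex" where
  "E1 i v = partial_deriv i (wseries R (w8 i) (\<lambda>z. half (\<kappa>2 z))) v - partial_deriv i (interp R n (W i)) v"

definition E2 :: "3 \<Rightarrow> real^3 \<Rightarrow> complex" where
  "E2 i v = partial_deriv i (interp R n (\<lambda>x. W i x - landau_flux gn fn x $ i)) v"

lemma error_eq:
  assumes v: "v \<in> cube R"
  shows "landau_trunc R f v - landau_colloc R n fn v = (\<Sum>i\<in>UNIV. E1 i v + E2 i v)"
proof -
  have ic: "interp_coeff R n (\<lambda>x. W i x - landau_flux gn fn x $ i) k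
    = interp_coeff R n (W i) k - interp_coeff R n (\<lambda>x. landau_flux gn fn x $ i) k" for i k
    unfolding interp_coeff_def by (simp add: sum_subtractf algebra_simps)
  have "E2 i v = partial_deriv i (interp R n (W i)) v - partial_deriv i (interp R n
    (\<lambda>x. landau_flux gn fn x $ i)) v" for i
    unfolding E2_def partial_deriv_interp ic by
      (simp only: sum_subtractf right_diff_distrib left_diff_distrib)
  then show ?thesis
    using v cube_subset_U by (subst landau_trunc_eq)
      (auto simp: E1_def landau_colloc_def divergence_def interp_vec_def sum.distrib sum_subtractf)
qed

lemma continuous_E: "continuous_on S (E1 i)" "continuous_on S (E2 i)"
proof -
  have s: "(\<lambda>z. cmod (dmul R i (half (\<kappa>2 z)) * w8 i z)) summable_on UNIV"
  proof (rule summable_on_comparison_test[OF summable_on_cmult_right[OF summable_w8(1), of "pi / R" i]])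
    show "cmod (dmul R i (half (\<kappa>2 z)) * w8 i z) \<le> pi / R * (weight (half (\<kappa>2 z)) * cmod (w8 i z))" for z
      using mult_right_mono[OF norm_dmul_le[of R i "half (\<kappa>2 z)"], of "cmod (w8 i z)"] R
        by (simp add: norm_mult)
  qed auto
  have "partial_deriv i (wseries R (w8 i) (\<lambda>z. half (\<kappa>2 z)))
    = wseries R (\<lambda>z. dmul R i (half (\<kappa>2 z)) * w8 i z) (\<lambda>z. half (\<kappa>2 z))"
    by (rule ext) (rule partial_deriv_wseries[OF summable_w8(1)])
  then have "continuous_on S (partial_deriv i (wseries R (w8 i) (\<lambda>z. half (\<kappa>2 z))))"
    using continuous_on_wseries[OF s] by simp
  moreover have pi: "continuous_on S (partial_deriv i (interp R n h))" for h
    unfolding partial_deriv_interp[abs_def] by (intro continuous_intros)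
  ultimately show "continuous_on S (E1 i)" unfolding E1_def by (intro continuous_on_diff)
  show "continuous_on S (E2 i)" unfolding E2_def by (rule pi)
qed

text \<open>\<open>E1\<close> is small pointwise. \<open>E2\<close> is estimated in mean square,
  where discrete Parseval passes from nodal values to the interpolant without loss in
  \<open>n\<close>.\<close>

lemma collocation_error:
  defines "err \<equiv> \<lambda>v. landau_trunc R f v - landau_colloc R n fn v"
  shows "square_integrable (cube R) err"
    and "L2_norm (cube R) err \<le> sqrt (18 * (2 * R) ^ 3) * ((96 * 2 powr p + 432) * (c ^ 4 * P * (eps (p
      - 4) * S1 * S2)))"
proof -
  define h where "h = (\<lambda>v. \<Sum>i\<in>UNIV. E1 i v + E2 i v)"
  have eq: "err v = h v" if "v \<in> cube R" for v unfolding err_def h_def by (rule error_eq[OF that])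
  have ch: "continuous_on S h" for S unfolding h_def by (intro continuous_intros continuous_E)
  have ind: "(\<lambda>v. indicator (cube R) v *\<^sub>R err v) = (\<lambda>v. indicator (cube R) v *\<^sub>R h v)"
    "(\<lambda>v. indicator (cube R) v *\<^sub>R (cmod (err v))\<^sup>2) = (\<lambda>v. indicator (cube R) v *\<^sub>R (cmod (h v))\<^sup>2)"
    by (auto simp: fun_eq_iff eq split: split_indicator)
  have ih: "set_integrable lborel (cube R) (\<lambda>v. (cmod (h v))\<^sup>2)"
    by (intro set_integrable_cube continuous_intros ch)
  have "set_borel_measurable lborel (cube R) h"
    using borel_measurable_integrable[OF set_integrable_cube[OF ch, of R, unfolded set_integrable_def]]
    by (simp add: set_borel_measurable_def)
  then show "square_integrable (cube R) err"
    unfolding square_integrable_def set_borel_measurable_def set_integrable_def ind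
    using ih by (simp add: set_borel_measurable_def set_integrable_def)
  define Q where "Q = c ^ 4 * P * (eps (p - 4) * S1 * S2)"
  have Q: "Q \<ge> 0" unfolding Q_def using c_pos P S1_nonneg S2_nonneg by simp
  have B1: "cmod (E1 i v) \<le> 96 * 2 powr p * Q" for i v
    unfolding E1_def Q_def by (rule consistency_derivative)
  have B2: "(LINT v:cube R|lborel. (cmod (E2 i v))\<^sup>2) \<le> (2 * R) ^ 3 * (432 * Q)\<^sup>2" for i
  proof -
    have "(LINT v:cube R|lborel. (cmod (E2 i v))\<^sup>2)
      \<le> (2 * R) ^ 3 * (pi / R * real n * (108 * (c ^ 3 * P * (eps (p - 3) * S1 * S2))))\<^sup>2"
      unfolding E2_def by (rule integral_partial_deriv_interp_sq_le[OF R n]) (rule flux_node_diff)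
    also have "pi / R * real n * (108 * (c ^ 3 * P * (eps (p - 3) * S1 * S2))) = 432 * Q"
    proof -
      \<comment> \<open>The factor \<open>n\<close> of the inverse inequality uses up one power:
        \<open>n * eps (p - 3) = 2 * eps (p - 4)\<close>. Together with
        \<open>pi / R = 2 * c\<close> this gives \<open>432 = 2 * 2 * 108\<close>.\<close>
      have "eps (p - 3) = eps (p - 4) * (2 / real n)"
        using powr_add[of "2 / real n" "p - 4" 1] n by (simp add: eps_def)
      moreover have "pi / R = 2 * c" by (simp add: c_def)
      ultimately show ?thesis using n by (simp add: Q_def power3_eq_cube power4_eq_xxxx)
    qed
    finally show ?thesis .
  qed
  have B1': "(LINT v:cube R|lborel. (cmod (E1 i v))\<^sup>2) \<le> (2 * R) ^ 3 * (96 * 2 powr p * Q)\<^sup>2" for i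
  proof -
    have "(LINT v:cube R|lborel. (cmod (E1 i v))\<^sup>2) \<le> (LINT v:cube R|lborel. (96 * 2 powr p * Q)\<^sup>2)"
      by (intro set_integral_mono set_integrable_cube continuous_intros continuous_E power_mono B1) auto
    also have "\<dots> = (2 * R) ^ 3 * (96 * 2 powr p * Q)\<^sup>2"
      using measure_cube[of R] R by (simp add: set_lebesgue_integral_def)
    finally show ?thesis .
  qed
  \<comment> \<open>\<open>6 = 3 * 2\<close>: Cauchy-Schwarz over three components, and the square
    of a sum of two terms. Equal bounds for the three components later turn it into
    \<open>18\<close>.\<close>
  have pw: "(cmod (h v))\<^sup>2 \<le> 6 * (\<Sum>i\<in>UNIV. (cmod (E1 i v))\<^sup>2 + (cmod (E2 i v))\<^sup>2)" for v
  proof -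
    have "cmod (h v) \<le> (\<Sum>i\<in>UNIV. cmod (E1 i v) + cmod (E2 i v))"
      unfolding h_def by (intro order.trans[OF norm_sum] sum_mono norm_triangle_ineq)
    then have "(cmod (h v))\<^sup>2 \<le> (\<Sum>i\<in>UNIV. cmod (E1 i v) + cmod (E2 i v))\<^sup>2" by (intro power_mono) auto
    also have "\<dots> \<le> 3 * (\<Sum>i\<in>UNIV. (cmod (E1 i v) + cmod (E2 i v))\<^sup>2)"
      using sum_squared_le_sum_of_squares[of "\<lambda>i. cmod (E1 i v) + cmod (E2 i v)" "UNIV :: 3 set"] by simp
    also have "\<dots> \<le> 3 * (\<Sum>i\<in>UNIV. 2 * ((cmod (E1 i v))\<^sup>2 + (cmod (E2 i v))\<^sup>2))"
    proof (intro mult_left_mono sum_mono)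
      show "(x + y)\<^sup>2 \<le> 2 * (x\<^sup>2 + y\<^sup>2)" for x y :: real
        using zero_le_power2[of "x - y"] by (simp add: power2_eq_square algebra_simps)
    qed auto
    also have "\<dots> = 6 * (\<Sum>i\<in>UNIV. (cmod (E1 i v))\<^sup>2 + (cmod (E2 i v))\<^sup>2)"
      unfolding sum_distrib_left[symmetric] by simp
    finally show ?thesis .
  qed
  have iE: "set_integrable lborel (cube R) (\<lambda>v. (cmod (E1 i v))\<^sup>2)" "set_integrable lborel (cube R) (\<lambda>v.
    (cmod (E2 i v))\<^sup>2)" for i
    by (intro set_integrable_cube continuous_intros continuous_E)+
  have "(LINT v:cube R|lborel. (cmod (err v))\<^sup>2) = (LINT v:cube R|lborel. (cmod (h v))\<^sup>2)"
    unfolding set_lebesgue_integral_def ind ..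
  also have "\<dots> \<le> (LINT v:cube R|lborel. 6 * (\<Sum>i\<in>UNIV. (cmod (E1 i v))\<^sup>2 + (cmod (E2 i v))\<^sup>2))"
    by (intro set_integral_mono ih pw set_integrable_cube continuous_intros continuous_E)
  also have "\<dots> = 6 * (\<Sum>i\<in>UNIV. (LINT v:cube R|lborel. (cmod (E1 i v))\<^sup>2) + (LINT v:cube R|lborel. (cmod
    (E2 i v))\<^sup>2))"
    by (simp only: set_integral_mult_right set_integral_sum[OF finite set_integral_add(1)[OF iE]]
      set_integral_add(2)[OF iE])
  also have "\<dots> \<le> 6 * (\<Sum>i\<in>(UNIV :: 3 set). (2 * R) ^ 3 * (96 * 2 powr p * Q)\<^sup>2 + (2 * R) ^ 3 * (432 * Q)\<^sup>2)"
    by (intro mult_left_mono sum_mono add_mono B1' B2) auto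
  also have "\<dots> = 18 * (2 * R) ^ 3 * ((96 * 2 powr p * Q)\<^sup>2 + (432 * Q)\<^sup>2)"
    by (simp add: distrib_left)
  also have "\<dots> \<le> 18 * (2 * R) ^ 3 * (96 * 2 powr p * Q + 432 * Q)\<^sup>2"
    using R Q by (intro mult_left_mono) (auto simp: power2_sum)
  finally have "L2_norm (cube R) err \<le> sqrt (18 * (2 * R) ^ 3 * (96 * 2 powr p * Q + 432 * Q)\<^sup>2)"
    unfolding L2_norm_def by (rule real_sqrt_le_mono)
  also have "\<dots> = sqrt (18 * (2 * R) ^ 3) * ((96 * 2 powr p + 432) * Q)"
    using Q by (simp add: real_sqrt_mult distrib_right add_nonneg_nonneg)
  finally show "L2_norm (cube R) err \<le> sqrt (18 * (2 * R) ^ 3) * ((96 * 2 powr p + 432) * (c ^ 4 * P *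
    (eps (p - 4) * S1 * S2)))"
    unfolding Q_def .
qed

end

section \<open>From coefficient sums to Sobolev norms\<close>

theorem theorem3p1:
  fixes R p :: real
  assumes "R > 0" and "p \<ge> 4"
  shows "\<exists>C>0. \<forall>(f :: real^3 \<Rightarrow> complex) (n :: nat).
    f \<in> sobolev_space p \<and> continuous_on UNIV f \<and>
    compact (closure {v. f v \<noteq> 0}) \<and> closure {v. f v \<noteq> 0} \<subseteq> ball 0 R \<and>
    even n \<and> n > 0 \<longrightarrow>
      square_integrable (cube R) (\<lambda>v. landau_trunc R f v - landau_colloc R n (interp R n f) v) \<and>
      L2_norm (cube R) (\<lambda>v. landau_trunc R f v - landau_colloc R n (interp R n f) v)
        \<le> C / real n powr (p - 4) * sobolev_norm p f * sobolev_norm 4 f"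
proof -
  note R = assms(1) and p = assms(2)
  define c where c_eq: "c = pi / (2 * R)"
  have c: "c > 0" using R by (simp add: c_eq)
  obtain P where P: "P > 0" "\<And>k. cmod (psi_coeff R k) \<le> P / (weight k)\<^sup>2"
    using psi_coeff_decay[OF R] by blast
  have ex: "\<exists>C>0. \<forall>f A. continuous_on UNIV f \<longrightarrow> (\<forall>x. x \<notin> cube R \<longrightarrow> f x = 0) \<longrightarrow>
     integrable lborel (energy t (FT f)) \<longrightarrow> finite A \<longrightarrow>
     (\<Sum>k\<in>A. weight k powr (t - 2) * cmod (FT f (c *\<^sub>R real_vec k))) \<le>
       C * sqrt (integral\<^sup>L lborel (energy t (FT f)))" if "t \<ge> 2" for t
    unfolding c_eq by (rule sampling_bound[OF R that])
  obtain Cp where Cp: "Cp > 0" "\<And>f A. continuous_on UNIV f \<Longrightarrow> (\<And>x. x \<notin> cube R \<Longrightarrow> f x = 0) \<Longrightarrow>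
     integrable lborel (energy p (FT f)) \<Longrightarrow> finite A \<Longrightarrow>
     (\<Sum>k\<in>A. weight k powr (p - 2) * cmod (FT f (c *\<^sub>R real_vec k))) \<le>
       Cp * sqrt (integral\<^sup>L lborel (energy p (FT f)))"
    using ex[of p] p by auto
  obtain C4 where C4: "C4 > 0" "\<And>f A. continuous_on UNIV f \<Longrightarrow> (\<And>x. x \<notin> cube R \<Longrightarrow> f x = 0) \<Longrightarrow>
     integrable lborel (energy 4 (FT f)) \<Longrightarrow> finite A \<Longrightarrow>
     (\<Sum>k\<in>A. weight k powr (4 - 2) * cmod (FT f (c *\<^sub>R real_vec k))) \<le>
       C4 * sqrt (integral\<^sup>L lborel (energy 4 (FT f)))"
    using ex[of 4] by auto
  define V where "V = (2 * (2 * R)) ^ 3"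
  have V: "V > 0" using R by (simp add: V_def)
  define q where "q = (2 * pi) powr (3/2)"
  have q: "q > 0" by (simp add: q_def)
  define K where "K = sqrt (18 * (2 * R) ^ 3) * ((96 * 2 powr p + 432) * (c ^ 4 * P))"
  have K: "K > 0" unfolding K_def using R c P by (intro mult_pos_pos add_pos_pos) auto
  \<comment> \<open>Each coefficient sum contributes its sampling constant, the normalisation
    \<open>q\<close> of the Fourier transform and the factor \<open>1 / V\<close> of the Fourier
    coefficients; \<open>2 powr (p - 4)\<close> comes from \<open>eps\<close>. Everything is fixed
    before \<open>f\<close> and \<open>n\<close>.\<close>
  define C where "C = K * 2 powr (p - 4) * (Cp * q / V) * (C4 * q / V)"
  have C: "C > 0" unfolding C_def using K Cp(1) C4(1) q V by simp
  have "square_integrable (cube R) (\<lambda>v. landau_trunc R f v - landau_colloc R n (interp R n f) v) \<and>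
      L2_norm (cube R) (\<lambda>v. landau_trunc R f v - landau_colloc R n (interp R n f) v)
        \<le> C / real n powr (p - 4) * sobolev_norm p f * sobolev_norm 4 f"
    if fH: "f \<in> sobolev_space p" and fc: "continuous_on UNIV f" and
      fK: "compact (closure {v. f v \<noteq> 0})" "closure {v. f v \<noteq> 0} \<subseteq> ball 0 R" and n: "even n" "n > 0"
    for f :: "real^3 \<Rightarrow> complex" and n :: nat
  proof -
    have f_ball: "f x = 0" if "x \<notin> ball 0 R" for x
      using that fK(2) closure_subset[of "{v. f v \<noteq> 0}"] by auto
    have ball_cube: "ball 0 r \<subseteq> cube r" "cball 0 r \<subseteq> cube r" for r
      using component_le_norm_cart by (fastforce simp: mem_cube intro: order.trans less_imp_le)+
    have f_cube: "f x = 0" if "x \<notin> cube R" for x using that f_ball ball_cube by blast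
    \<comment> \<open>Compactness of the support inside the open ball gives a radius strictly below
      \<open>R\<close>, attained at a point of the support unless that is empty.\<close>
    obtain \<rho> where \<rho>: "0 \<le> \<rho>" "\<rho> < R" "\<And>x. f x \<noteq> 0 \<Longrightarrow> norm x \<le> \<rho>"
    proof (cases "closure {v. f v \<noteq> 0} = {}")
      case True
      then have "f x = 0" for x using closure_subset[of "{v. f v \<noteq> 0}"] by blast
      then show thesis using that[of 0] R by auto
    next
      case False
      obtain y where y: "y \<in> closure {v. f v \<noteq> 0}" "\<forall>x\<in>closure {v. f v \<noteq> 0}. norm x \<le> norm y"
        using continuous_attains_sup[OF fK(1) False, of norm] by (auto intro: continuous_intros)
      show thesis
      proof (rule that[of "norm y"])
        show "norm y < R" using y(1) fK(2) by auto
        show "norm x \<le> norm y" if "f x \<noteq> 0" for x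
          using y(2) closure_subset[of "{v. f v \<noteq> 0}"] that by blast
      qed simp
    qed
    \<comment> \<open>Makes \<open>R - 2 * d\<close> equal to \<open>\<rho>\<close>, so the support
      lies in \<open>cube (R - 2 * d)\<close>.\<close>
    define d where "d = (R - \<rho>) / 2"
    have d: "0 < d" "2 * d \<le> R" "R - 2 * d = \<rho>" using \<rho> by (auto simp: d_def field_simps)
    define a where "a = (\<lambda>k. FT f (c *\<^sub>R real_vec k) / of_real V)"
    have aeq: "a k = (LINT u:cube (2 * R)|lborel. f u * wave (2 * R) (- k) u) / of_real ((2 * (2
      * R)) ^ 3)" for k
    proof -
      have f2: "f u = 0" if "u \<notin> cube (2 * R)" for u
      proof (rule f_cube)
        show "u \<notin> cube R" using that R by (auto simp: mem_cube)
          (metis add_increasing2 less_imp_le mult_2 not_le order.trans)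
      qed
      have "FT f (c *\<^sub>R real_vec k) = (LINT u:cube (2 * R)|lborel. f u * wave (2 * R) (- k) u)"
        unfolding FT_def set_lebesgue_integral_def
        by (rule Bochner_Integration.integral_cong) (auto simp: indicator_def f2 wave_eq_cis c_eq)
      then show ?thesis by (simp add: a_def V_def)
    qed
    have na: "cmod (a k) = cmod (FT f (c *\<^sub>R real_vec k)) / V" for k using V by (simp add: a_def norm_divide)
    have H: "integrable lborel (energy s (FT f))"
      "sqrt (integral\<^sup>L lborel (energy s (FT f))) = q * sobolev_norm s f" if "s \<le> p" for s
      unfolding q_def by (rule sobolev_FT[where R=R, OF fc _ fH that], rule f_ball, assumption)+
    have bp: "(\<Sum>k\<in>A. weight k powr (p - 2) * cmod (a k)) \<le> Cp * q / V * sobolev_norm p f" if "finite A" for A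
    proof -
      have "(\<Sum>k\<in>A. weight k powr (p - 2) * cmod (FT f (c *\<^sub>R real_vec k))) \<le> Cp * (q * sobolev_norm p f)"
        unfolding H(2)[OF order.refl, symmetric]
        by (rule Cp(2)[OF fc _ H(1)[OF order.refl] that]) (rule f_cube)
      from divide_right_mono[OF this, of V] show ?thesis using V by (simp add: na sum_divide_distrib)
    qed
    have b4: "(\<Sum>k\<in>A. (weight k)\<^sup>2 * cmod (a k)) \<le> C4 * q / V * sobolev_norm 4 f" if "finite A" for A
    proof -
      have "(\<Sum>k\<in>A. weight k powr (4 - 2) * cmod (FT f (c *\<^sub>R real_vec k))) \<le> C4 * (q * sobolev_norm 4 f)"
        unfolding H(2)[OF p, symmetric]
        by (rule C4(2)[OF fc _ H(1)[OF p] that]) (rule f_cube)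
      from divide_right_mono[OF this, of V] show ?thesis using V by (simp add: na sum_divide_distrib)
    qed
    have sp: "(\<lambda>k. weight k powr (p - 2) * cmod (a k)) summable_on UNIV"
      by (rule nonneg_bdd_above_summable_on) (auto intro!: bdd_aboveI2 bp)
    have s4: "(\<lambda>k. (weight k)\<^sup>2 * cmod (a k)) summable_on UNIV"
      by (rule nonneg_bdd_above_summable_on) (auto intro!: bdd_aboveI2 b4)
    have s0: "(\<lambda>k. cmod (a k)) summable_on UNIV"
    proof (rule summable_on_comparison_test[OF s4])
      show "cmod (a k) \<le> (weight k)\<^sup>2 * cmod (a k)" for k
        using mult_right_mono[OF one_le_power[OF weight_ge_1[of k], of 2] norm_ge_zero[of "a k"]] by simp
    qed auto
    interpret collocation R d f a P p n
    proof unfold_locales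
      show "f v = wseries (2 * R) a (\<lambda>k. k) v" if "v \<in> cube (2 * R)" for v
        using R by (intro inversion_on_closed_cube[OF _ fc aeq s0 that]) auto
      show "f v = 0" if "v \<notin> cube (R - 2 * d)" for v
      proof (rule ccontr)
        assume "f v \<noteq> 0"
        then have "v \<in> cball 0 \<rho>" using \<rho>(3) by simp
        then show False using that ball_cube(2) unfolding d(3) by blast
      qed
    qed (use R d(1,2) s4 sp P n p in auto)
    have S1: "S1 \<le> Cp * q / V * sobolev_norm p f"
      unfolding S1_def using sp by (intro infsum_le_finite_sums bp) auto
    have S2: "S2 \<le> C4 * q / V * sobolev_norm 4 f"
      unfolding S2_def using s4 by (intro infsum_le_finite_sums b4) auto
    have e: "eps (p - 4) = 2 powr (p - 4) / real n powr (p - 4)" by (simp add: eps_def powr_divide)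
    have "S1 * S2 \<le> (Cp * q / V * sobolev_norm p f) * (C4 * q / V * sobolev_norm 4 f)"
      using S1 S2 S1_nonneg S2_nonneg by (intro mult_mono) auto
    then have "K * eps (p - 4) * (S1 * S2) \<le> K * eps (p - 4) * ((Cp * q / V * sobolev_norm p f) * (C4
      * q / V * sobolev_norm 4 f))"
      using K by (intro mult_left_mono) auto
    also have "\<dots> = C / real n powr (p - 4) * sobolev_norm p f * sobolev_norm 4 f"
      unfolding C_def e by (simp add: mult_ac)
    finally have bound: "K * eps (p - 4) * (S1 * S2)
      \<le> C / real n powr (p - 4) * sobolev_norm p f * sobolev_norm 4 f" .
    have K_eq: "sqrt (18 * (2 * R) ^ 3) * ((96 * 2 powr p + 432) * (collocation.c R ^ 4 * P * (eps (p
      - 4) * S1 * S2))) = K * eps (p - 4) * (S1 * S2)"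
      by (simp add: K_def c_eq c_def)
    show ?thesis
      using collocation_error(1) order.trans[OF collocation_error(2)[unfolded K_eq] bound] by (rule conjI)
  qed
  then show ?thesis using C by (intro exI[of _ C]) blast
qed

end
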